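(* Let $\mathbb{F}_n$ be a free group with basis $\{v_1,\ldots,v_n\}$ and let $0\le l\le n$. If $n-l\ge 3$, the group $\mathrm{SAut}(\mathbb{F}_n,\{v_1,\ldots,v_l\})$ has a presentation with generators $$\{M_{a,b} : a\in L',\ b\in L,\ a\ne b^{\pm1}\}\cup\{w_{a,b} : a,b\in L',\ a\ne b^{\pm1}\}$$ subject to the following relations (for all letters such that every symbol appearing is one of the generators above): 1. $M_{a,b}M_{a,b^{-1}}=1$. 2. $[M_{a,b},M_{c,d}]=1$ if $b\ne c^{\pm1}$, $a\ne d^{\pm1}$ and $a\ne c$. 3. $[M_{b,a^{-1}},M_{c,b^{-1}}]=M_{c,a}$. 4. $w_{a,b}=M_{b^{-1},a^{-1}}M_{a^{-1},b}M_{b,a}$. 5. $w_{a,b}=w_{a^{-1},b^{-1}}$. 6. $w_{a,b}^4=1$.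
   Context: Automorphisms act on the left and compose from right to left. $\mathrm{SAut}(\mathbb{F}_n)$ is the subgroup of $\mathrm{Aut}(\mathbb{F}_n)$ of automorphisms whose image in $\mathrm{Aut}(\mathbb{Z}^n)$ has determinant $1$. For $A\subseteq\mathbb{F}_n$, $\mathrm{SAut}(\mathbb{F}_n,A)=\{\phi\in\mathrm{SAut}(\mathbb{F}_n) : \phi|_A=1_A\}$. Let $L=\{v_1,\ldots,v_n,v_1^{-1},\ldots,v_n^{-1}\}$ be the set of letters and $L'=L\setminus\{v_1,\ldots,v_l,v_1^{-1},\ldots,v_l^{-1}\}$. For $a,b\in L$ with $a\ne b^{\pm1}$, the symbol $M_{a,b}$ represents the automorphism mapping $a$ to $ba$ and fixing $L\setminus\{a,a^{-1}\}$, and $w_{a,b}$ represents the automorphism taking $a$ to $b^{-1}$, $b$ to $a$, and fixing $L\setminus\{a,a^{-1},b,b^{-1}\}$. Commutators are $[x,y]=xyx^{-1}y^{-1}$. *)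

theory Defs
  imports "HOL-Algebra.Bij" "HOL-Algebra.Coset" "Jordan_Normal_Form.Determinant"
begin

section \<open>Free groups\<close>

text \<open>The free group on a set \<open>S\<close> consists of the reduced words over \<open>S\<close> and formal inverses;
  \<open>(s, True)\<close> stands for \<open>s\<close> and \<open>(s, False)\<close> for its inverse.\<close>

type_synonym 's sword = "('s \<times> bool) list"

definition opp :: "'s \<times> bool \<Rightarrow> 's \<times> bool" where
  "opp x = (fst x, \<not> snd x)"

definition reduced :: "'s sword \<Rightarrow> bool" where
  "reduced = successively (\<lambda>x y. y \<noteq> opp x)"

fun push :: "'s \<times> bool \<Rightarrow> 's sword \<Rightarrow> 's sword" where
  "push x [] = [x]"
| "push x (y # w) = (if y = opp x then w else x # y # w)"

definition free_group :: "'s set \<Rightarrow> 's sword monoid" where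
  "free_group S = \<lparr>carrier = {w. set w \<subseteq> S \<times> UNIV \<and> reduced w}, monoid.mult = foldr push, one = []\<rparr>"

lemma opp_opp [simp]: "opp (opp x) = x"
  by (simp add: opp_def)

lemma opp_neq [simp]: "opp x \<noteq> x"
  by (cases x) (simp add: opp_def)

lemma opp_mem [simp]: "opp x \<in> S \<times> UNIV \<longleftrightarrow> x \<in> S \<times> UNIV"
  by (cases x) (simp add: opp_def)

lemma reduced_Nil [simp]: "reduced []"
  by (simp add: reduced_def)

lemma reduced_Cons: "reduced (x # w) \<longleftrightarrow> (w = [] \<or> hd w \<noteq> opp x) \<and> reduced w"
  by (cases w) (auto simp: reduced_def)

lemma reduced_push: "reduced w \<Longrightarrow> reduced (push x w)"
  by (cases w) (auto simp: reduced_Cons)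

lemma set_push: "x \<in> S \<times> UNIV \<Longrightarrow> set w \<subseteq> S \<times> UNIV \<Longrightarrow> set (push x w) \<subseteq> S \<times> UNIV"
  by (cases w) auto

lemma push_opp: "reduced w \<Longrightarrow> push x (push (opp x) w) = w"
proof (cases w)
  case (Cons y v)
  assume "reduced w"
  then show ?thesis using Cons by (cases v) (auto simp: reduced_Cons)
qed auto

lemma reduced_foldr_push: "reduced w \<Longrightarrow> reduced (foldr push u w)"
  by (induction u) (auto intro: reduced_push)

lemma set_foldr_push:
  "set u \<subseteq> S \<times> UNIV \<Longrightarrow> set w \<subseteq> S \<times> UNIV \<Longrightarrow> set (foldr push u w) \<subseteq> S \<times> UNIV"
proof (induction u)
  case (Cons x u)
  then have "x \<in> S \<times> UNIV" "set (foldr push u w) \<subseteq> S \<times> UNIV" by auto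
  then show ?case using set_push by fastforce
qed simp

lemma foldr_push_push: "reduced w \<Longrightarrow> foldr push (push x u) w = push x (foldr push u w)"
proof (cases u)
  case (Cons y v)
  assume w: "reduced w"
  show ?thesis
  proof (cases "y = opp x")
    case True
    then show ?thesis using Cons push_opp[OF reduced_foldr_push[OF w]] by simp
  qed (use Cons in simp)
qed simp

lemma foldr_push_assoc:
  "reduced w \<Longrightarrow> foldr push (foldr push u v) w = foldr push u (foldr push v w)"
  by (induction u) (auto simp: foldr_push_push)

lemma foldr_push_Nil: "reduced w \<Longrightarrow> foldr push w [] = w"
proof (induction w)
  case (Cons x w)
  then show ?case by (cases w) (auto simp: reduced_Cons)
qed simp

lemma foldr_push_inverse: "reduced v \<Longrightarrow> foldr push (rev (map opp u)) (foldr push u v) = v"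
proof (induction u)
  case (Cons x u)
  then show ?case
    using push_opp[of "foldr push u v" "opp x"] by (simp add: reduced_foldr_push)
qed simp

lemma group_free_group: "group (free_group S)"
proof (rule groupI)
  fix x assume x: "x \<in> carrier (free_group S)"
  define y where "y = foldr push (rev (map opp x)) []"
  have s: "set (rev (map opp x)) \<subseteq> S \<times> UNIV"
    using x by (force simp: free_group_def opp_def)
  have "set y \<subseteq> S \<times> UNIV" unfolding y_def
    by (rule set_foldr_push[OF s]) simp
  moreover have "reduced y"
    unfolding y_def by (rule reduced_foldr_push) simp
  moreover have "foldr push y x = []"
  proof -
    have r: "reduced x" using x by (simp add: free_group_def)
    have "foldr push y x = foldr push (rev (map opp x)) x"
      using foldr_push_assoc[OF r, of "rev (map opp x)" "[]"] by (simp add: y_def)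
    also have "\<dots> = foldr push (rev (map opp x)) (foldr push x [])"
      by (simp add: foldr_push_Nil[OF r])
    also have "\<dots> = []" by (rule foldr_push_inverse) simp
    finally show ?thesis .
  qed
  ultimately show "\<exists>y\<in>carrier (free_group S). y \<otimes>\<^bsub>free_group S\<^esub> x = \<one>\<^bsub>free_group S\<^esub>"
    by (intro bexI[of _ y]) (simp_all add: free_group_def)
next
  fix x y assume "x \<in> carrier (free_group S)" "y \<in> carrier (free_group S)"
  then show "x \<otimes>\<^bsub>free_group S\<^esub> y \<in> carrier (free_group S)"
    using set_foldr_push[of x S y] by (simp add: free_group_def reduced_foldr_push)
qed (simp_all add: free_group_def foldr_push_assoc)

definition word_eval :: "('g, 'm) monoid_scheme \<Rightarrow> ('s \<Rightarrow> 'g) \<Rightarrow> 's sword \<Rightarrow> 'g" where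
  "word_eval G f w =
     foldr (\<lambda>(s, e) g. (if e then f s else inv\<^bsub>G\<^esub> f s) \<otimes>\<^bsub>G\<^esub> g) w \<one>\<^bsub>G\<^esub>"

lemma word_eval_Nil [simp]: "word_eval G f [] = \<one>\<^bsub>G\<^esub>"
  by (simp add: word_eval_def)

lemma word_eval_Cons:
  "word_eval G f (x # w) =
     (if snd x then f (fst x) else inv\<^bsub>G\<^esub> f (fst x)) \<otimes>\<^bsub>G\<^esub> word_eval G f w"
  by (cases x) (simp add: word_eval_def)

lemma word_eval_closed:
  assumes "group G" "f \<in> S \<rightarrow> carrier G" "set w \<subseteq> S \<times> UNIV"
  shows "word_eval G f w \<in> carrier G"
proof -
  interpret group G by fact
  show ?thesis
    using assms(3)
  proof (induction w)
    case (Cons x w)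
    then have "f (fst x) \<in> carrier G" using assms(2) by auto
    then show ?case using Cons by (simp add: word_eval_Cons)
  qed simp
qed

lemma word_eval_push:
  assumes "group G" "f \<in> S \<rightarrow> carrier G" "x \<in> S \<times> UNIV" "set w \<subseteq> S \<times> UNIV"
  shows "word_eval G f (push x w) = word_eval G f (x # w)"
proof (cases w)
  case (Cons y v)
  interpret group G by fact
  have c: "f (fst x) \<in> carrier G" "word_eval G f v \<in> carrier G"
    using assms Cons word_eval_closed[OF assms(1,2), of v] by auto
  show ?thesis
    using c unfolding Cons by (auto simp: word_eval_Cons opp_def m_assoc[symmetric])
qed simp

lemma word_eval_hom:
  assumes "group G" "f \<in> S \<rightarrow> carrier G"
  shows "word_eval G f \<in> hom (free_group S) G"
proof (rule homI)
  interpret group G by fact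
  fix u w assume u: "u \<in> carrier (free_group S)" and w: "w \<in> carrier (free_group S)"
  from w have w': "set w \<subseteq> S \<times> UNIV" by (simp add: free_group_def)
  from u have "set u \<subseteq> S \<times> UNIV" by (simp add: free_group_def)
  then have "word_eval G f (foldr push u w) = word_eval G f u \<otimes>\<^bsub>G\<^esub> word_eval G f w"
  proof (induction u)
    case Nil
    then show ?case using word_eval_closed[OF assms w'] by simp
  next
    case (Cons x u)
    then have c: "f (fst x) \<in> carrier G" "word_eval G f u \<in> carrier G" "word_eval G f w \<in> carrier G"
      using assms w' word_eval_closed[OF assms, of u] word_eval_closed[OF assms, of w] by auto
    have "word_eval G f (push x (foldr push u w)) = word_eval G f (x # foldr push u w)"
      using Cons.prems w' by (intro word_eval_push[OF assms] set_foldr_push) auto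
    then show ?case using Cons c by (simp add: word_eval_Cons m_assoc)
  qed
  then show "word_eval G f (u \<otimes>\<^bsub>free_group S\<^esub> w) = word_eval G f u \<otimes>\<^bsub>G\<^esub> word_eval G f w"
    by (simp add: free_group_def)
qed (use word_eval_closed[OF assms] in \<open>simp add: free_group_def\<close>)

text \<open>\<open>F\<close> is free with basis the family \<open>v\<close> indexed by \<open>I\<close>; injectivity of \<open>v\<close> on \<open>I\<close> is implied.\<close>

definition free_with_basis :: "('a, 'm) monoid_scheme \<Rightarrow> 'i set \<Rightarrow> ('i \<Rightarrow> 'a) \<Rightarrow> bool" where
  "free_with_basis F I v \<longleftrightarrow>
     group F \<and> v \<in> I \<rightarrow> carrier F \<and> word_eval F v \<in> iso (free_group I) F"

definition free_gen :: "'s \<Rightarrow> 's sword" where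
  "free_gen s = [(s, True)]"

lemma free_gen_closed: "s \<in> S \<Longrightarrow> free_gen s \<in> carrier (free_group S)"
  by (simp add: free_gen_def free_group_def reduced_Cons)

lemma inv_free_gen: "s \<in> S \<Longrightarrow> inv\<^bsub>free_group S\<^esub> free_gen s = [(s, False)]"
proof -
  assume s: "s \<in> S"
  interpret group "free_group S" by (rule group_free_group)
  show ?thesis
    using s by (intro inv_equality) (auto simp: free_gen_def free_group_def opp_def reduced_Cons)
qed

lemma free_with_basis_free_group: "free_with_basis (free_group S) S free_gen"
proof -
  have "word_eval (free_group S) free_gen w = w" if "w \<in> carrier (free_group S)" for w
  proof -
    have "word_eval (free_group S) free_gen w = foldr push w []" if "set w \<subseteq> S \<times> UNIV"
      using that
    proof (induction w)
      case Nil
      then show ?case by (simp add: free_group_def)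
    next
      case (Cons x w)
      obtain s e where x: "x = (s, e)" by (cases x)
      have "(if e then free_gen s else inv\<^bsub>free_group S\<^esub> free_gen s) = [x]"
        using Cons.prems by (auto simp: inv_free_gen x) (simp add: free_gen_def)
      moreover have "word_eval (free_group S) free_gen w = foldr push w []" using Cons by simp
      ultimately have "word_eval (free_group S) free_gen (x # w)
          = [x] \<otimes>\<^bsub>free_group S\<^esub> foldr push w []"
        by (simp only: word_eval_Cons x fst_conv snd_conv)
      then show ?case by (simp add: free_group_def)
    qed
    then show ?thesis using that by (simp add: free_group_def foldr_push_Nil)
  qed
  then have "bij_betw (word_eval (free_group S) free_gen)
      (carrier (free_group S)) (carrier (free_group S))"
    by (simp add: bij_betw_def inj_on_def)
  moreover have g: "free_gen \<in> S \<rightarrow> carrier (free_group S)"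
    by (auto intro: free_gen_closed)
  ultimately show ?thesis
    by (simp add: free_with_basis_def group_free_group iso_def word_eval_hom)
qed

section \<open>Presentations\<close>

definition normal_closure :: "('g, 'm) monoid_scheme \<Rightarrow> 'g set \<Rightarrow> 'g set" where
  "normal_closure G R = \<Inter> {N. N \<lhd> G \<and> R \<subseteq> N}"

text \<open>Here \<open>S\<close> is a set of symbols, \<open>f\<close> gives the element of \<open>G\<close> that each symbol represents, and
  a pair \<open>(u, w)\<close> of \<open>R\<close> is the relation \<open>u = w\<close> between elements of the free group on \<open>S\<close>.\<close>

definition has_presentation ::
  "('g, 'm) monoid_scheme \<Rightarrow> 's set \<Rightarrow> ('s \<Rightarrow> 'g) \<Rightarrow> ('s sword \<times> 's sword) set \<Rightarrow> bool" where
  "has_presentation G S f R \<longleftrightarrow>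
     group G \<and> f \<in> S \<rightarrow> carrier G \<and>
     R \<subseteq> carrier (free_group S) \<times> carrier (free_group S) \<and>
     word_eval G f ` carrier (free_group S) = carrier G \<and>
     kernel (free_group S) G (word_eval G f) =
       normal_closure (free_group S)
         ((\<lambda>(u, w). u \<otimes>\<^bsub>free_group S\<^esub> inv\<^bsub>free_group S\<^esub> w) ` R)"

definition commutator :: "('g, 'm) monoid_scheme \<Rightarrow> 'g \<Rightarrow> 'g \<Rightarrow> 'g" where
  "commutator G x y = x \<otimes>\<^bsub>G\<^esub> y \<otimes>\<^bsub>G\<^esub> inv\<^bsub>G\<^esub> x \<otimes>\<^bsub>G\<^esub> inv\<^bsub>G\<^esub> y"

section \<open>Special automorphisms\<close>

definition exp_sum :: "'s \<Rightarrow> 's sword \<Rightarrow> int" where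
  "exp_sum s w = (\<Sum>x\<leftarrow>w. if fst x = s then if snd x then 1 else -1 else 0)"

text \<open>In this section \<open>v\<close> is a basis of \<open>F\<close> indexed by \<open>{1..n}\<close>. Coordinates of vectors and matrices
  are numbered from 0, so coordinate \<open>i\<close> belongs to the basis element \<open>v (Suc i)\<close>.\<close>

definition abelianization :: "('a, 'm) monoid_scheme \<Rightarrow> nat \<Rightarrow> (nat \<Rightarrow> 'a) \<Rightarrow> 'a \<Rightarrow> int vec" where
  "abelianization F n v g =
     vec n (\<lambda>i. exp_sum (Suc i) (the_inv_into (carrier (free_group {1..n})) (word_eval F v) g))"

text \<open>The matrix of the automorphism that \<open>\<phi>\<close> induces on the abelianization; see the lemma
  \<open>abelianization_auto\<close>.\<close>

definition induced_matrix ::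
  "('a, 'm) monoid_scheme \<Rightarrow> nat \<Rightarrow> (nat \<Rightarrow> 'a) \<Rightarrow> ('a \<Rightarrow> 'a) \<Rightarrow> int mat" where
  "induced_matrix F n v \<phi> =
     mat_of_cols n (map (\<lambda>j. abelianization F n v (\<phi> (v (Suc j)))) [0..<n])"

definition SAut ::
  "('a, 'm) monoid_scheme \<Rightarrow> nat \<Rightarrow> (nat \<Rightarrow> 'a) \<Rightarrow> ('a \<Rightarrow> 'a) monoid" where
  "SAut F n v = (AutoGroup F)\<lparr>carrier := {\<phi> \<in> auto F. det (induced_matrix F n v \<phi>) = 1}\<rparr>"

definition SAut_fixing ::
  "('a, 'm) monoid_scheme \<Rightarrow> nat \<Rightarrow> (nat \<Rightarrow> 'a) \<Rightarrow> 'a set \<Rightarrow> ('a \<Rightarrow> 'a) monoid" where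
  "SAut_fixing F n v A =
     (SAut F n v)\<lparr>carrier := {\<phi> \<in> carrier (SAut F n v). \<forall>x\<in>A. \<phi> x = x}\<rparr>"

lemma exp_sum_push: "exp_sum s (push x w) = exp_sum s [x] + exp_sum s w"
  by (cases w) (auto simp: exp_sum_def opp_def)

lemma exp_sum_foldr_push: "exp_sum s (foldr push u w) = exp_sum s u + exp_sum s w"
  by (induction u) (auto simp: exp_sum_push, auto simp: exp_sum_def)

lemma dim_abelianization [simp]: "dim_vec (abelianization F n v g) = n"
  by (simp add: abelianization_def)

lemma abelianization_carrier [simp]: "abelianization F n v g \<in> carrier_vec n"
  by (simp add: abelianization_def)

lemma abelianization_mult:
  assumes "free_with_basis F {1..n} v" "g \<in> carrier F" "h \<in> carrier F"
  shows "abelianization F n v (g \<otimes>\<^bsub>F\<^esub> h) = abelianization F n v g + abelianization F n v h"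
proof -
  let ?W = "free_group {1..n}"
  have iso: "word_eval F v \<in> hom ?W F" "bij_betw (word_eval F v) (carrier ?W) (carrier F)"
    using assms(1) by (auto simp: free_with_basis_def iso_def)
  then have inj: "inj_on (word_eval F v) (carrier ?W)" by (simp add: bij_betw_def)
  obtain a b where ab: "a \<in> carrier ?W" "b \<in> carrier ?W" "g = word_eval F v a" "h = word_eval F v b"
  proof -
    have im: "carrier F = word_eval F v ` carrier ?W" using iso(2) by (simp add: bij_betw_def)
    from assms(2) im obtain a where "a \<in> carrier ?W" "g = word_eval F v a" by blast
    moreover from assms(3) im obtain b where "b \<in> carrier ?W" "h = word_eval F v b" by blast
    ultimately show ?thesis using that by blast
  qed
  have "g \<otimes>\<^bsub>F\<^esub> h = word_eval F v (a \<otimes>\<^bsub>?W\<^esub> b)"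
    using iso(1) ab by (simp add: hom_mult)
  moreover have "a \<otimes>\<^bsub>?W\<^esub> b \<in> carrier ?W"
    using group_free_group[of "{1..n}"] ab by (simp add: group.is_monoid monoid.m_closed)
  ultimately have "the_inv_into (carrier ?W) (word_eval F v) (g \<otimes>\<^bsub>F\<^esub> h) = foldr push a b"
    using inj by (simp add: the_inv_into_f_f) (simp add: free_group_def)
  moreover have "the_inv_into (carrier ?W) (word_eval F v) g = a"
    "the_inv_into (carrier ?W) (word_eval F v) h = b"
    using inj ab by (simp_all add: the_inv_into_f_f)
  ultimately show ?thesis
    by (intro eq_vecI) (auto simp: abelianization_def exp_sum_foldr_push)
qed

lemma abelianization_basis:
  assumes "free_with_basis F {1..n} v" "j < n"
  shows "abelianization F n v (v (Suc j)) = unit_vec n j"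
proof -
  let ?W = "free_group {1..n}"
  interpret group F using assms(1) by (simp add: free_with_basis_def)
  have inj: "inj_on (word_eval F v) (carrier ?W)"
    using assms(1) by (auto simp: free_with_basis_def iso_def bij_betw_def)
  have "v (Suc j) \<in> carrier F" using assms by (auto simp: free_with_basis_def)
  then have "word_eval F v (free_gen (Suc j)) = v (Suc j)"
    by (simp add: free_gen_def word_eval_Cons)
  moreover have "free_gen (Suc j) \<in> carrier ?W" using assms(2) by (intro free_gen_closed) auto
  ultimately have "the_inv_into (carrier ?W) (word_eval F v) (v (Suc j)) = free_gen (Suc j)"
    using the_inv_into_f_f[OF inj, of "free_gen (Suc j)"] by simp
  then show ?thesis
    by (intro eq_vecI) (auto simp: abelianization_def exp_sum_def free_gen_def unit_vec_def)
qed

lemma abelianization_auto: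
  assumes fb: "free_with_basis F {1..n} v" and phi: "\<phi> \<in> auto F" and g: "g \<in> carrier F"
  shows "abelianization F n v (\<phi> g) = induced_matrix F n v \<phi> *\<^sub>v abelianization F n v g"
proof -
  let ?W = "free_group {1..n}"
  let ?ab = "abelianization F n v"
  let ?A = "induced_matrix F n v \<phi>"
  interpret group F using fb by (simp add: free_with_basis_def)
  have ph: "\<phi> \<in> hom F F" using phi by (simp add: auto_def)
  have vc: "v \<in> {1..n} \<rightarrow> carrier F" using fb by (simp add: free_with_basis_def)
  have cl: "\<phi> x \<in> carrier F" if "x \<in> carrier F" for x using hom_in_carrier[OF ph that] .
  have A: "?A \<in> carrier_mat n n" by (auto simp: induced_matrix_def mat_of_cols_def)
  have one: "?ab \<one>\<^bsub>F\<^esub> = 0\<^sub>v n"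
  proof -
    have "?ab \<one>\<^bsub>F\<^esub> + ?ab \<one>\<^bsub>F\<^esub> = ?ab \<one>\<^bsub>F\<^esub>" using abelianization_mult[OF fb, of "\<one>\<^bsub>F\<^esub>" "\<one>\<^bsub>F\<^esub>"] by simp
    then have e: "(?ab \<one>\<^bsub>F\<^esub> + ?ab \<one>\<^bsub>F\<^esub>) $ i = ?ab \<one>\<^bsub>F\<^esub> $ i" for i by simp
    have d: "dim_vec (?ab \<one>\<^bsub>F\<^esub>) = n" by (simp add: abelianization_def)
    show ?thesis
    proof (rule eq_vecI)
      fix i assume "i < dim_vec (0\<^sub>v n :: int vec)"
      then show "?ab \<one>\<^bsub>F\<^esub> $ i = 0\<^sub>v n $ i"
        using e[of i] d by simp
    qed (simp add: d)
  qed
  have ivr: "?ab (inv\<^bsub>F\<^esub> x) = - ?ab x" if "x \<in> carrier F" for x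
  proof -
    have "?ab (inv\<^bsub>F\<^esub> x) + ?ab x = 0\<^sub>v n" using abelianization_mult[OF fb, of "inv\<^bsub>F\<^esub> x" x] one that by simp
    then have e: "(?ab (inv\<^bsub>F\<^esub> x) + ?ab x) $ i = 0" if "i < n" for i using that by simp
    show ?thesis
    proof (rule eq_vecI)
      fix i assume "i < dim_vec (- ?ab x)"
      then have "i < n" by (simp add: abelianization_def)
      then show "?ab (inv\<^bsub>F\<^esub> x) $ i = (- ?ab x) $ i"
        using e[of i] by (simp add: abelianization_def)
    qed (simp add: abelianization_def)
  qed
  have gen: "?ab (\<phi> (v k)) = ?A *\<^sub>v ?ab (v k)" if "k \<in> {1..n}" for k
  proof -
    obtain j where j: "k = Suc j" "j < n"
      using \<open>k \<in> {1..n}\<close> by (metis Suc_le_D Suc_le_lessD One_nat_def atLeastAtMost_iff)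
    have "?A *\<^sub>v unit_vec n j = col ?A j" using A j(2) by (intro eq_vecI) auto
    also have "\<dots> = ?ab (\<phi> (v k))" using j by (simp add: induced_matrix_def)
    finally show ?thesis using abelianization_basis[OF fb j(2)] j(1) by simp
  qed
  have "word_eval F v ` carrier ?W = carrier F"
    using fb by (simp add: free_with_basis_def iso_def bij_betw_def)
  with g obtain w where "w \<in> carrier ?W" and gw: "g = word_eval F v w" by auto
  then have "set w \<subseteq> {1..n} \<times> UNIV" by (simp add: free_group_def)
  then have "?ab (\<phi> (word_eval F v w)) = ?A *\<^sub>v ?ab (word_eval F v w)"
  proof (induction w)
    case Nil
    have "\<phi> \<one>\<^bsub>F\<^esub> = \<one>\<^bsub>F\<^esub>" using hom_one[OF ph] is_group by simp
    moreover have "?A *\<^sub>v 0\<^sub>v n = 0\<^sub>v n"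
      using A by (intro eq_vecI) (auto simp: scalar_prod_def)
    ultimately show ?case by (simp add: one)
  next
    case (Cons x w)
    define y where "y = (if snd x then v (fst x) else inv\<^bsub>F\<^esub> v (fst x))"
    have k: "fst x \<in> {1..n}" using Cons.prems by auto
    have vx: "v (fst x) \<in> carrier F" using k vc by auto
    have wc: "word_eval F v w \<in> carrier F"
      using Cons.prems by (intro word_eval_closed[OF is_group vc]) auto
    have yc: "y \<in> carrier F" using vx by (simp add: y_def)
    have "\<phi> (inv\<^bsub>F\<^esub> v (fst x)) = inv\<^bsub>F\<^esub> \<phi> (v (fst x))"
      using group_hom.hom_inv[of F F \<phi>] vx ph is_group by (simp add: group_hom_def group_hom_axioms_def)
    moreover have "?A *\<^sub>v (- ?ab (v (fst x))) = - (?A *\<^sub>v ?ab (v (fst x)))"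
      using carrier_matD[OF A]
      by (intro eq_vecI) auto
    ultimately have y: "?ab (\<phi> y) = ?A *\<^sub>v ?ab y"
      using gen[OF k] vx cl[OF vx] by (simp add: y_def ivr)
    have "?ab (\<phi> (y \<otimes>\<^bsub>F\<^esub> word_eval F v w)) = ?ab (\<phi> y) + ?ab (\<phi> (word_eval F v w))"
      using ph yc wc cl by (simp add: hom_mult abelianization_mult[OF fb])
    also have "\<dots> = ?A *\<^sub>v (?ab y + ?ab (word_eval F v w))"
      using y Cons mult_add_distrib_mat_vec[OF A] by simp
    also have "\<dots> = ?A *\<^sub>v ?ab (y \<otimes>\<^bsub>F\<^esub> word_eval F v w)"
      using yc wc by (simp add: abelianization_mult[OF fb])
    finally show ?case by (simp add: word_eval_Cons y_def)
  qed
  then show ?thesis by (simp add: gw)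
qed

section \<open>Generators and relations\<close>

definition letters :: "('a, 'm) monoid_scheme \<Rightarrow> (nat \<Rightarrow> 'a) \<Rightarrow> nat \<Rightarrow> 'a set" where
  "letters F v k = v ` {1..k} \<union> (\<lambda>i. inv\<^bsub>F\<^esub> v i) ` {1..k}"

text \<open>In the next two definitions \<open>L\<close> is the set of all letters. Since \<open>F\<close> is free and the members of
  \<open>auto F\<close> are extensional functions, there is exactly one automorphism with the stated values. The
  product \<open>\<phi> \<otimes> \<psi>\<close> in \<open>AutoGroup F\<close> is \<open>\<phi>\<close> after \<open>\<psi>\<close>.\<close>

definition trans_aut :: "('a, 'm) monoid_scheme \<Rightarrow> 'a set \<Rightarrow> 'a \<Rightarrow> 'a \<Rightarrow> 'a \<Rightarrow> 'a" where
  "trans_aut F L a b = (THE \<phi>. \<phi> \<in> auto F \<and> \<phi> a = b \<otimes>\<^bsub>F\<^esub> a \<and>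
     (\<forall>x \<in> L - {a, inv\<^bsub>F\<^esub> a}. \<phi> x = x))"

definition swap_aut :: "('a, 'm) monoid_scheme \<Rightarrow> 'a set \<Rightarrow> 'a \<Rightarrow> 'a \<Rightarrow> 'a \<Rightarrow> 'a" where
  "swap_aut F L a b = (THE \<phi>. \<phi> \<in> auto F \<and> \<phi> a = inv\<^bsub>F\<^esub> b \<and> \<phi> b = a \<and>
     (\<forall>x \<in> L - {a, inv\<^bsub>F\<^esub> a, b, inv\<^bsub>F\<^esub> b}. \<phi> x = x))"

text \<open>The generating symbols, \<open>M a b\<close> and \<open>W a b\<close> being the mathematical \<open>M\<^sub>a\<^sub>,\<^sub>b\<close> and \<open>w\<^sub>a\<^sub>,\<^sub>b\<close>.\<close>

datatype 'a symbol = M 'a 'a | W 'a 'a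

fun symbol_aut :: "('a, 'm) monoid_scheme \<Rightarrow> 'a set \<Rightarrow> 'a symbol \<Rightarrow> 'a \<Rightarrow> 'a" where
  "symbol_aut F L (M a b) = trans_aut F L a b"
| "symbol_aut F L (W a b) = swap_aut F L a b"

text \<open>\<open>L\<close> is the set of all letters and \<open>L'\<close> the set of those that are not required to be fixed.\<close>

definition symbols :: "('a, 'm) monoid_scheme \<Rightarrow> 'a set \<Rightarrow> 'a set \<Rightarrow> 'a symbol set" where
  "symbols F L L' =
     {M a b | a b. a \<in> L' \<and> b \<in> L \<and> a \<noteq> b \<and> a \<noteq> inv\<^bsub>F\<^esub> b} \<union>
     {W a b | a b. a \<in> L' \<and> b \<in> L' \<and> a \<noteq> b \<and> a \<noteq> inv\<^bsub>F\<^esub> b}"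

definition relations ::
  "('a, 'm) monoid_scheme \<Rightarrow> 'a symbol set \<Rightarrow> ('a symbol sword \<times> 'a symbol sword) set" where
  "relations F S =
     (let P = free_group S;
          m = (\<lambda>a b. free_gen (M a b));
          w = (\<lambda>a b. free_gen (W a b));
          i = (\<lambda>a. inv\<^bsub>F\<^esub> a)
      in {(m a b \<otimes>\<^bsub>P\<^esub> m a (i b), \<one>\<^bsub>P\<^esub>) | a b. M a b \<in> S \<and> M a (i b) \<in> S}
       \<union> {(commutator P (m a b) (m c d), \<one>\<^bsub>P\<^esub>) | a b c d.
            M a b \<in> S \<and> M c d \<in> S \<and> b \<noteq> c \<and> b \<noteq> i c \<and> a \<noteq> d \<and> a \<noteq> i d \<and> a \<noteq> c}
       \<union> {(commutator P (m b (i a)) (m c (i b)), m c a) | a b c.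
            M b (i a) \<in> S \<and> M c (i b) \<in> S \<and> M c a \<in> S}
       \<union> {(w a b, m (i b) (i a) \<otimes>\<^bsub>P\<^esub> m (i a) b \<otimes>\<^bsub>P\<^esub> m b a) | a b.
            W a b \<in> S \<and> M (i b) (i a) \<in> S \<and> M (i a) b \<in> S \<and> M b a \<in> S}
       \<union> {(w a b, w (i a) (i b)) | a b. W a b \<in> S \<and> W (i a) (i b) \<in> S}
       \<union> {(w a b [^]\<^bsub>P\<^esub> (4::nat), \<one>\<^bsub>P\<^esub>) | a b. W a b \<in> S})"

end

theory Submission
  imports Defs
begin

text \<open>Let \<open>Q\<close> be the group presented by the symbols and relations and \<open>G\<close> the group of automorphisms. The relations
hold in \<open>G\<close>, as one sees on letters, so \<open>Q\<close> maps to \<open>G\<close>. That this map is bijective is proved by a form of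
Nielsen reduction in which the choices are compared by means of the relations.

An automorphism \<open>\<phi>\<close> is determined by the images of the letters. Multiplying it from the right by \<open>M a b\<close> is a Nielsen move,
replacing \<open>\<phi> a\<close> by \<open>\<phi> b \<phi> a\<close>, and multiplying it by \<open>W a b\<close> permutes the images up to inversion. Nielsen's well-order
ranks the words up to inversion, and the height of \<open>\<phi>\<close> is the sum of the powers of 2 given by the ranks of the images. Moves
always change the height. If no move lowers it, then \<open>\<phi>\<close> permutes the letters (\<open>irreducible_permutes\<close>). Since its
determinant is 1, it is then a product of automorphisms \<open>W a b\<close> (\<open>wgroup_almost_transitive\<close>, \<open>reflection_det\<close>), and this part of \<open>Q\<close>
maps injectively to \<open>G\<close> (\<open>wgroup_faithful\<close>). So \<open>Q\<close> maps onto \<open>G\<close>: descend from \<open>\<phi>\<close> to a signed permutation and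
read the moves backwards. The elements of \<open>Q\<close> obtained in this way are called the values of \<open>\<phi>\<close>.

The main point is that \<open>\<phi>\<close> has only one value (\<open>V_unique\<close>). As in Newman's lemma, by induction on the height, it is enough
to connect the ends of any two descending moves from \<open>\<phi>\<close> by a path that stays below \<open>\<phi>\<close> and closes up by the relations
(\<open>joined_desc\<close>). The images of \<open>a\<close>, \<open>b\<close> and their product form a triangle in the Cayley tree of \<open>F\<close>. One may restrict
attention to moves that replace the side of largest rank (\<open>joined_swap\<close>, where the \<open>W a b\<close> come in). Then few
configurations of two moves remain, and in each of them the edges that are needed for the path are short by two
properties of the order, \<open>lens_dist\<close> and \<open>lens_trans\<close>. Letters that have to be fixed do no harm, because a word of length one never
has to be moved (\<open>letter_not_max\<close>, \<open>letters_not_both_shorten\<close>).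

The relations in \<open>Q\<close> that close up the paths are consequences of the given ones. Apart from the triangle relation they need that
conjugation by \<open>W a b\<close> permutes the symbols \<open>M c d\<close> (\<open>cj_w_m\<close>), which is proved with the help of a third movable letter;
this is the role of the hypothesis on \<open>n - l\<close>.

Uniqueness makes values compatible with moves and signed permutations, so that the element of \<open>Q\<close> defined by a word is the
value of the automorphism represented by the word. Words that represent the identity are therefore trivial in \<open>Q\<close>.\<close>

(* Keeps index sets in the form {1..n} that they have in the definitions. *)

declare One_nat_def [simp del]

section \<open>Reduced words\<close>

definition winv :: "'s sword \<Rightarrow> 's sword" where
  "winv w = rev (map opp w)"

lemma length_winv [simp]: "length (winv w) = length w"
  by (simp add: winv_def)

lemma winv_winv [simp]: "winv (winv w) = w"
  by (simp add: winv_def rev_map comp_def)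

lemma winv_append [simp]: "winv (u @ v) = winv v @ winv u"
  by (simp add: winv_def)

lemma winv_Nil [simp]: "winv [] = []"
  by (simp add: winv_def)

lemma winv_eq_Nil [simp]: "winv w = [] \<longleftrightarrow> w = []"
  by (simp add: winv_def)

lemma hd_winv: "w \<noteq> [] \<Longrightarrow> hd (winv w) = opp (last w)"
  by (simp add: winv_def hd_rev last_map)

lemma last_winv: "w \<noteq> [] \<Longrightarrow> last (winv w) = opp (hd w)"
  by (simp add: winv_def last_rev hd_map)

lemma opp_inject [simp]: "opp x = opp y \<longleftrightarrow> x = y"
  by (metis opp_opp)

lemma set_winv: "set w \<subseteq> S \<times> UNIV \<Longrightarrow> set (winv w) \<subseteq> S \<times> UNIV"
  by (force simp: winv_def opp_def)

lemma reduced_append: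
  "reduced (u @ v) \<longleftrightarrow> reduced u \<and> reduced v \<and> (u = [] \<or> v = [] \<or> hd v \<noteq> opp (last u))"
  by (auto simp: reduced_def successively_append_iff)

lemma reduced_winv [simp]: "reduced (winv w) \<longleftrightarrow> reduced w"
proof -
  have "reduced (winv w)" if "reduced w" for w :: "'a sword"
    using that
  proof (induction w)
    case (Cons x w)
    have "winv (x # w) = winv w @ [opp x]" by (simp add: winv_def)
    then show ?case using Cons
      by (auto simp: reduced_append reduced_Cons last_winv)
  qed simp
  from this[of w] this[of "winv w"] show ?thesis by auto
qed

lemma foldr_push_append: "reduced (u @ v) \<Longrightarrow> foldr push u v = u @ v"
proof (induction u)
  case (Cons x u)
  then have "foldr push u v = u @ v" by (simp add: reduced_Cons)
  then show ?case using Cons.prems by (cases "u @ v") (auto simp: reduced_Cons)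
qed simp

lemma inv_free_group:
  assumes "w \<in> carrier (free_group S)"
  shows "inv\<^bsub>free_group S\<^esub> w = winv w"
proof (rule group.inv_equality[OF group_free_group _ assms])
  have "foldr push (winv w) (foldr push w []) = []"
    unfolding winv_def by (rule foldr_push_inverse) simp
  moreover have "foldr push w [] = w"
    using assms by (simp add: free_group_def foldr_push_Nil)
  ultimately show "winv w \<otimes>\<^bsub>free_group S\<^esub> w = \<one>\<^bsub>free_group S\<^esub>"
    by (simp add: free_group_def)
  show "winv w \<in> carrier (free_group S)"
    using assms set_winv[of w S] by (simp add: free_group_def)
qed

text \<open>The label of the geodesic from \<open>x\<close> to \<open>y\<close> in the Cayley tree, that is, \<open>x\<close> inverse times \<open>y\<close>.\<close>

definition wdiff :: "'s sword \<Rightarrow> 's sword \<Rightarrow> 's sword" where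
  "wdiff x y = foldr push (winv x) y"

lemma wdiff_prefix: "reduced (p @ y) \<Longrightarrow> wdiff (p @ x) (p @ y) = wdiff x y"
proof -
  assume r: "reduced (p @ y)"
  have "foldr push (winv p) (p @ y) = foldr push (winv p) (foldr push p y)"
    using foldr_push_append[OF r] by simp
  also have "\<dots> = y" unfolding winv_def using r by (intro foldr_push_inverse) (simp add: reduced_append)
  finally show ?thesis by (simp add: wdiff_def)
qed

text \<open>If \<open>x\<close> and \<open>y\<close> leave the origin in different directions, the geodesic between them
  passes through the origin and nothing cancels.\<close>

lemma wdiff_branch:
  assumes "reduced x" "reduced y" "x = [] \<or> y = [] \<or> hd x \<noteq> hd y"
  shows "wdiff x y = winv x @ y"
  unfolding wdiff_def using assms
  by (intro foldr_push_append) (auto simp: reduced_append last_winv)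

lemma common_prefix:
  obtains p x' y' where "x = p @ x'" "y = p @ y'" "x' = [] \<or> y' = [] \<or> hd x' \<noteq> hd y'"
proof -
  have "\<exists>p x' y'. x = p @ x' \<and> y = p @ y' \<and> (x' = [] \<or> y' = [] \<or> hd x' \<noteq> hd y')"
  proof (induction x arbitrary: y)
    case (Cons a x)
    show ?case
    proof (cases "y \<noteq> [] \<and> hd y = a")
      case True
      then obtain z where y: "y = a # z" by (cases y) auto
      from Cons[of z] obtain p x' y' where "x = p @ x'" "z = p @ y'" "x' = [] \<or> y' = [] \<or> hd x' \<noteq> hd y'"
        by blast
      then show ?thesis using y by (metis append_Cons)
    next
      case False
      then show ?thesis by (metis append_Nil list.sel(1))
    qed
  qed auto
  then show ?thesis using that by blast
qed

lemma length_wdiff_le: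
  assumes "reduced x" "reduced y"
  shows "length (wdiff x y) \<le> length x + length y"
proof -
  obtain p x' y' where p: "x = p @ x'" "y = p @ y'" "x' = [] \<or> y' = [] \<or> hd x' \<noteq> hd y'"
    by (rule common_prefix)
  then have "wdiff x y = winv x' @ y'"
    using assms wdiff_prefix[of p y' x'] by (simp add: reduced_append wdiff_branch)
  then show ?thesis using p by simp
qed

lemma length_wdiff_eqD:
  assumes "reduced x" "reduced y" "length (wdiff x y) = length x + length y"
  shows "x = [] \<or> y = [] \<or> hd x \<noteq> hd y"
proof -
  obtain p x' y' where p: "x = p @ x'" "y = p @ y'" "x' = [] \<or> y' = [] \<or> hd x' \<noteq> hd y'"
    by (rule common_prefix)
  then have "wdiff x y = winv x' @ y'"
    using assms wdiff_prefix[of p y' x'] by (simp add: reduced_append wdiff_branch)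
  then show ?thesis using p assms(3) by simp
qed

lemma winv_wdiff: "reduced x \<Longrightarrow> reduced y \<Longrightarrow> winv (wdiff x y) = wdiff y x"
proof -
  assume r: "reduced x" "reduced y"
  obtain p x' y' where p: "x = p @ x'" "y = p @ y'" "x' = [] \<or> y' = [] \<or> hd x' \<noteq> hd y'"
    by (rule common_prefix)
  then show ?thesis
    using r wdiff_prefix[of p y' x'] wdiff_prefix[of p x' y'] 
    by (auto simp add: reduced_append wdiff_branch)
qed

section \<open>A well-order on words\<close>

text \<open>A word over the letters with indices up to \<open>n\<close> is read as a numeral in base \<open>2 n + 2\<close>. Among words
  of the same length, the order of the codes is a lexicographic order. It is decided by the letters
  furthest to the left, which is what makes codes compatible with passing to a common end.\<close>

definition digit :: "nat \<times> bool \<Rightarrow> nat" where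
  "digit x = 2 * fst x + of_bool (snd x)"

definition code :: "nat \<Rightarrow> nat sword \<Rightarrow> nat" where
  "code n w = foldl (\<lambda>a x. a * (2 * n + 2) + digit x) 0 w"

lemma code_Nil [simp]: "code n [] = 0"
  by (simp add: code_def)

lemma code_snoc: "code n (w @ [x]) = code n w * (2 * n + 2) + digit x"
  by (simp add: code_def)

lemma code_append: "code n (u @ v) = code n u * (2 * n + 2) ^ length v + code n v"
proof (induction v rule: rev_induct)
  case (snoc x v)
  have "code n (u @ v @ [x]) = code n (u @ v) * (2 * n + 2) + digit x"
    using code_snoc[of n "u @ v" x] by simp
  then show ?case using snoc by (simp add: code_snoc algebra_simps)
qed simp

lemma digit_less: "x \<in> {1..n} \<times> UNIV \<Longrightarrow> digit x < 2 * n + 2"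
  by (auto simp: digit_def)

lemma digit_inject: "digit x = digit y \<longleftrightarrow> x = y"
proof -
  have "(2 * a + of_bool p = 2 * b + (of_bool q :: nat)) \<longleftrightarrow> a = b \<and> p = q" for a b p q
    by (cases p; cases q) (simp_all, presburger+)
  then show ?thesis by (cases x; cases y) (simp add: digit_def)
qed

lemma code_less: "set w \<subseteq> {1..n} \<times> UNIV \<Longrightarrow> code n w < (2 * n + 2) ^ length w"
proof (induction w rule: rev_induct)
  case (snoc x w)
  have d: "digit x < 2 * n + 2" using snoc.prems by (intro digit_less) auto
  have "code n w + 1 \<le> (2 * n + 2) ^ length w" using snoc by simp
  then have "(code n w + 1) * (2 * n + 2) \<le> (2 * n + 2) ^ length w * (2 * n + 2)"
    by (rule mult_le_mono1)
  then show ?case using d by (simp add: code_snoc algebra_simps)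
qed simp

lemma code_inject:
  assumes "length u = length v" "set u \<subseteq> {1..n} \<times> UNIV" "set v \<subseteq> {1..n} \<times> UNIV" "code n u = code n v"
  shows "u = v"
  using assms
proof (induction u arbitrary: v rule: rev_induct)
  case (snoc x u)
  then obtain v' y where v: "v = v' @ [y]" "length v' = length u"
    by (metis append_butlast_last_id length_0_conv length_append_singleton length_butlast diff_Suc_1 snoc_eq_iff_butlast)
  let ?B = "2 * n + 2"
  have "x \<in> {1..n} \<times> UNIV" "y \<in> {1..n} \<times> UNIV" using snoc.prems v by auto
  then have "digit x < ?B" "digit y < ?B" by (blast intro: digit_less)+
  moreover have e: "code n u * ?B + digit x = code n v' * ?B + digit y"
    using snoc.prems(4) v by (simp only: code_snoc)
  ultimately have d: "digit x = digit y"
    by (metis mod_less mod_mult_self3)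
  then have "code n u * ?B = code n v' * ?B" using e by linarith
  then have "code n u = code n v'" by (metis mult_cancel2 add_is_0 zero_neq_numeral)
  then show ?case using snoc v d by (auto simp: digit_inject)
qed simp

definition half :: "'s sword \<Rightarrow> 's sword" where
  "half w = take (length w div 2) w"

text \<open>Nielsen's order on words, packed into one natural number: the tower makes the length decide first,
  and the two powers of 2 represent the unordered pair of the initial halves of the word and of its
  inverse. Their sum determines the pair and increases strictly with each member of it. A value in
  the natural numbers allows the ranks of the members of a basis to be combined into one height.\<close>

definition rk :: "nat \<Rightarrow> nat sword \<Rightarrow> nat" where
  "rk n w = 4 ^ ((2 * n + 2) ^ length w) + 2 ^ code n (half w) + 2 ^ code n (half (winv w))"

lemma rk_winv [simp]: "rk n (winv w) = rk n w"
  by (simp add: rk_def)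

lemma code_half_less:
  assumes "set w \<subseteq> {1..n} \<times> UNIV"
  shows "code n (half w) < (2 * n + 2) ^ length w"
proof -
  have "set (half w) \<subseteq> {1..n} \<times> UNIV" using assms set_take_subset[of _ w] by (force simp: half_def)
  from code_less[OF this] have "code n (half w) < (2 * n + 2) ^ (length w div 2)"
    by (simp add: half_def min_absorb2 del: mult_2_right add_2_eq_Suc' add_2_eq_Suc split del: if_split)
  also have "\<dots> \<le> (2 * n + 2) ^ length w" by (rule power_increasing) auto
  finally show ?thesis .
qed

lemma rk_short:
  assumes "set w \<subseteq> {1..n} \<times> UNIV" "length w < k"
  shows "rk n w < 4 ^ ((2 * n + 2) ^ k)"
proof -
  let ?B = "2 * n + 2"
  let ?N = "?B ^ length w"
  have c: "code n (half w) < ?N" "code n (half (winv w)) < ?N"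
    using code_half_less[OF assms(1)] code_half_less[OF set_winv[OF assms(1)]] by auto
  have p: "(2::nat) ^ c \<le> 4 ^ ?N" if "c < ?N" for c
  proof -
    have "(2::nat) ^ c \<le> 2 ^ ?N" using that by (intro power_increasing) auto
    also have "\<dots> \<le> 4 ^ ?N" by (intro power_mono) auto
    finally show ?thesis .
  qed
  have "rk n w \<le> 3 * 4 ^ ?N" using p[OF c(1)] p[OF c(2)] by (simp add: rk_def)
  also have "\<dots> < 4 ^ (Suc ?N)" by simp
  also have "\<dots> \<le> 4 ^ (?B ^ k)"
  proof (rule power_increasing)
    have "?N < ?B ^ k" using assms(2) by (intro power_strict_increasing) auto
    then show "Suc ?N \<le> ?B ^ k" by (rule Suc_leI)
  qed simp
  finally show ?thesis .
qed

lemma rk_less_length: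
  assumes "set w \<subseteq> {1..n} \<times> UNIV" "length w < length w'"
  shows "rk n w < rk n w'"
  using rk_short[OF assms] by (simp add: rk_def)

lemma rk_less_lengthD:
  assumes "set w' \<subseteq> {1..n} \<times> UNIV" "rk n w < rk n w'"
  shows "length w \<le> length w'"
  using rk_less_length[OF assms(1), of w] assms(2) by fastforce

lemma power2_pair:
  assumes "(2::nat) ^ a + 2 ^ b = 2 ^ c + 2 ^ d"
  shows "(a = c \<and> b = d) \<or> (a = d \<and> b = c)"
proof -
  have less: "(2::nat) ^ a + 2 ^ b < 2 ^ c + 2 ^ d" if "max a b < max c d" for a b c d
  proof -
    have "(2::nat) ^ a \<le> 2 ^ max a b" "(2::nat) ^ b \<le> 2 ^ max a b" by (auto intro: power_increasing)
    then have "(2::nat) ^ a + 2 ^ b \<le> 2 ^ Suc (max a b)" unfolding power_Suc by linarith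
    also have "\<dots> \<le> 2 ^ max c d" using that by (intro power_increasing) auto
    also have "\<dots> < 2 ^ c + 2 ^ d" by (auto simp: max_def)
    finally show ?thesis .
  qed
  from less[of a b c d] less[of c d a b] assms have "max a b = max c d" by force
  then show ?thesis using assms by (auto simp: max_def split: if_splits)
qed

text \<open>A word of even length consists of its first half and the inverse of the first half of its inverse;
  exchanging the two halves in the unordered pair amounts to inverting the word.\<close>

lemma rk_inject:
  assumes "u \<in> carrier (free_group {1..n})" "v \<in> carrier (free_group {1..n})" "even (length u)"
    and "rk n u = rk n v"
  shows "u = v \<or> u = winv v"
proof -
  have s: "set u \<subseteq> {1..n} \<times> UNIV" "set v \<subseteq> {1..n} \<times> UNIV" using assms by (auto simp: free_group_def)
  have l: "length u = length v"
    using rk_less_length[OF s(1), of v] rk_less_length[OF s(2), of u] assms(4) by force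
  then have "(2::nat) ^ code n (half u) + 2 ^ code n (half (winv u)) = 2 ^ code n (half v) + 2 ^ code n (half (winv v))"
    using assms(4) by (simp add: rk_def)
  then have c: "(code n (half u) = code n (half v) \<and> code n (half (winv u)) = code n (half (winv v))) \<or>
      (code n (half u) = code n (half (winv v)) \<and> code n (half (winv u)) = code n (half v))"
    by (rule power2_pair)
  have hs: "set (half w) \<subseteq> {1..n} \<times> UNIV" if "set w \<subseteq> {1..n} \<times> UNIV" for w :: "nat sword"
    using that set_take_subset[of _ w] by (force simp: half_def)
  have inj: "half w = half w'" if "length w = length w'" "set w \<subseteq> {1..n} \<times> UNIV"
    "set w' \<subseteq> {1..n} \<times> UNIV" "code n (half w) = code n (half w')" for w w' :: "nat sword"
    using code_inject[OF _ hs[OF that(2)] hs[OF that(3)] that(4)] that(1) by (simp add: half_def)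
  have dec: "w = half w @ winv (half (winv w))" if "even (length w)" for w :: "nat sword"
  proof -
    have "length w - length w div 2 = length w div 2" using that by (auto elim: evenE)
    moreover have "winv (take k (winv w)) = drop (length w - k) w" for k
      by (simp add: winv_def take_map rev_map[symmetric] take_rev drop_map comp_def)
    ultimately show ?thesis by (simp add: half_def)
  qed
  have ws: "set (winv u) \<subseteq> {1..n} \<times> UNIV" "set (winv v) \<subseteq> {1..n} \<times> UNIV"
    using s by (auto dest: set_winv)
  from c show ?thesis
  proof
    assume "code n (half u) = code n (half v) \<and> code n (half (winv u)) = code n (half (winv v))"
    then have "half u = half v" "half (winv u) = half (winv v)"
      using s ws l by (auto intro!: inj)
    then show ?thesis using dec[of u] dec[of v] assms(3) l by metis
  next
    assume "code n (half u) = code n (half (winv v)) \<and> code n (half (winv u)) = code n (half v)"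
    then have "half u = half (winv v)" "half (winv u) = half v"
      using s ws l by (auto intro!: inj)
    then show ?thesis using dec[of u] dec[of "winv v"] assms(3) l by (metis length_winv winv_winv)
  qed
qed

section \<open>Distances in the Cayley tree\<close>

abbreviation words :: "nat \<Rightarrow> nat sword set" where
  "words n \<equiv> carrier (free_group {1..n})"

lemma words_iff: "w \<in> words n \<longleftrightarrow> set w \<subseteq> {1..n} \<times> UNIV \<and> reduced w"
  by (simp add: free_group_def)

lemma wordsD: "w \<in> words n \<Longrightarrow> set w \<subseteq> {1..n} \<times> UNIV" "w \<in> words n \<Longrightarrow> reduced w"
  by (auto simp: words_iff)

lemma winv_words: "w \<in> words n \<Longrightarrow> winv w \<in> words n"
  using set_winv[of w "{1..n}"] by (simp add: words_iff)

lemma wdiff_group: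
  "x \<in> carrier (free_group S) \<Longrightarrow> wdiff x y = inv\<^bsub>free_group S\<^esub> x \<otimes>\<^bsub>free_group S\<^esub> y"
  by (simp add: inv_free_group) (simp add: wdiff_def free_group_def)

lemma wdiff_words: "x \<in> words n \<Longrightarrow> y \<in> words n \<Longrightarrow> wdiff x y \<in> words n"
  by (simp add: wdiff_group group.inv_closed[OF group_free_group] monoid.m_closed[OF group.is_monoid[OF group_free_group]])

lemma wdiff_translate:
  assumes "g \<in> words n" "a \<in> words n" "b \<in> words n"
  shows "wdiff (wdiff g a) (wdiff g b) = wdiff a b"
proof -
  interpret W: group "free_group {1..n}" by (rule group_free_group)
  show ?thesis
    using assms by (simp add: wdiff_group[of _ "{1..n}"] W.inv_mult_group W.m_assoc)
      (metis W.inv_closed W.inv_inv W.inv_solve_left W.m_assoc W.m_closed)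
qed

definition wdist :: "nat \<Rightarrow> nat sword \<Rightarrow> nat sword \<Rightarrow> nat" where
  "wdist n x y = rk n (wdiff x y)"

lemma wdist_commute: "x \<in> words n \<Longrightarrow> y \<in> words n \<Longrightarrow> wdist n x y = wdist n y x"
  by (metis wdist_def rk_winv winv_wdiff wordsD(2))

lemma wdist_sphere:
  assumes "x \<in> words n" "y \<in> words n" "length x = r" "length y = r" "hd x \<noteq> hd y"
  shows "length (wdiff x y) = 2 * r"
    and "wdist n x y = 4 ^ ((2 * n + 2) ^ (2 * r)) + 2 ^ code n (winv x) + 2 ^ code n (winv y)"
proof -
  have w: "wdiff x y = winv x @ y" using assms by (intro wdiff_branch) (auto simp: words_iff)
  then show "length (wdiff x y) = 2 * r" using assms by simp
  then show "wdist n x y = 4 ^ ((2 * n + 2) ^ (2 * r)) + 2 ^ code n (winv x) + 2 ^ code n (winv y)"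
    using assms w by (simp add: wdist_def rk_def half_def)
qed

lemma wdist_less_length:
  assumes "x \<in> words n" "y \<in> words n" "x' \<in> words n" "y' \<in> words n"
    and "length (wdiff x' y') < length (wdiff x y)"
  shows "wdist n x' y' < wdist n x y"
  unfolding wdist_def using assms wdiff_words[of x' n y'] by (intro rk_less_length) (auto dest: wordsD)

lemma wdist_less_lengthD:
  assumes "x \<in> words n" "y \<in> words n" "wdist n x' y' < wdist n x y"
  shows "length (wdiff x' y') \<le> length (wdiff x y)"
  using rk_less_lengthD[of "wdiff x y" n "wdiff x' y'"] assms wdiff_words[of x n y]
  by (auto simp: wdist_def dest: wordsD)

text \<open>The points that are closer to \<open>x\<close> and to \<open>y\<close> than these two are to each other. Peak reduction
  rests on two closure properties of these sets, \<open>lens_dist\<close> and \<open>lens_trans\<close>. For lengths alone, they would follow from the four-point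
  inequality in a tree; with ties broken by codes they are proved by looking at the midpoint of \<open>x\<close> and \<open>y\<close>.\<close>

definition lens :: "nat \<Rightarrow> nat sword \<Rightarrow> nat sword \<Rightarrow> nat sword set" where
  "lens n x y = {z \<in> words n. wdist n x z < wdist n x y \<and> wdist n z y < wdist n x y}"

lemma lens_commute: "x \<in> words n \<Longrightarrow> y \<in> words n \<Longrightarrow> lens n x y = lens n y x"
  by (auto simp: lens_def wdist_commute)

lemma rk_ge: "rk n w \<ge> rk n []"
proof -
  have "(4::nat) ^ 1 \<le> 4 ^ ((2 * n + 2) ^ length w)" by (rule power_increasing) auto
  moreover have "(1::nat) \<le> 2 ^ code n (half w)" "(1::nat) \<le> 2 ^ code n (half (winv w))"
    by (rule one_le_power, simp)+
  ultimately have "4 ^ 1 + 1 + 1 \<le> rk n w" unfolding rk_def by (intro add_mono)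
  moreover have "rk n [] = 6" by (simp add: rk_def half_def)
  ultimately show ?thesis by simp
qed

lemma lens_nonempty: "z \<in> lens n x y \<Longrightarrow> wdiff x y \<noteq> []"
  using rk_ge[of n "wdiff x z"] by (auto simp: lens_def wdist_def)

text \<open>Here the origin is the midpoint of \<open>x\<close> and \<open>y\<close>. A point \<open>z\<close> leaves it in a direction other than that of
  \<open>x\<close> or other than that of \<open>y\<close>, so one of the geodesics from \<open>z\<close> to these two runs through the origin.\<close>

lemma lens_ball:
  assumes "x \<in> words n" "y \<in> words n" "length x = r" "length y = r" "hd x \<noteq> hd y" "z \<in> lens n x y"
  shows "length z \<le> r"
proof -
  have z: "z \<in> words n" using assms by (simp add: lens_def)
  have d: "length (wdiff x z) \<le> 2 * r" "length (wdiff z y) \<le> 2 * r"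
    using assms wdist_less_lengthD[OF assms(1,2)] wdist_sphere(1)[OF assms(1-5)]
    by (auto simp: lens_def)
  consider "z = []" | "z \<noteq> []" "hd z \<noteq> hd x" | "z \<noteq> []" "hd z \<noteq> hd y" using assms(5) by metis
  then show ?thesis
  proof cases
    case 2
    then have "wdiff x z = winv x @ z" using assms z by (intro wdiff_branch) (auto simp: words_iff)
    then show ?thesis using d assms by simp
  next
    case 3
    then have "wdiff z y = winv z @ y" using assms z by (intro wdiff_branch) (auto simp: words_iff)
    then show ?thesis using d assms by simp
  qed simp
qed

text \<open>On a sphere about the midpoint, ties in length are broken by the code of the path back to
  the midpoint. This does not depend on the point \<open>y\<close> from which the sphere is seen.\<close>

lemma sphere_less:
  assumes "x \<in> words n" "y \<in> words n" "z \<in> words n" "length x = r" "length y = r" "length z = r"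
    and "hd x \<noteq> hd y" "hd z \<noteq> hd y"
  shows "wdist n z y < wdist n x y \<longleftrightarrow> code n (winv z) < code n (winv x)"
  using wdist_sphere(2)[of x n y r] wdist_sphere(2)[of z n y r] assms by simp

lemma lens_sphere_less:
  assumes "x \<in> words n" "y \<in> words n" "length x = r" "length y = r" "hd x \<noteq> hd y"
    and "z \<in> lens n x y" "length z = r" "hd z \<noteq> hd y"
  shows "code n (winv z) < code n (winv x)"
  using sphere_less[of x n y z r] assms by (simp add: lens_def)

text \<open>Two points of the ball of radius \<open>r\<close> have distance at most \<open>2 r\<close>, with equality only if both lie on the
  sphere and in different directions. Then the codes of \<open>z\<close> and \<open>w\<close> are smaller than those of \<open>x\<close> and \<open>y\<close>, in
  one of the two possible orders.\<close>

lemma lens_dist_centred: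
  assumes x: "x \<in> words n" and y: "y \<in> words n" and r: "length x = r" "length y = r" and h: "hd x \<noteq> hd y"
    and z: "z \<in> lens n x y" and w: "w \<in> lens n x y"
  shows "wdist n z w < wdist n x y"
proof -
  have zw: "z \<in> words n" "w \<in> words n" using z w by (auto simp: lens_def)
  have l: "length z \<le> r" "length w \<le> r" using lens_ball[OF x y r h] z w by auto
  have yx: "hd y \<noteq> hd x" using h by simp
  have z': "z \<in> lens n y x" "w \<in> lens n y x" using z w lens_commute[OF x y] by auto
  have le: "length (wdiff z w) \<le> length z + length w"
    using zw by (intro length_wdiff_le) (auto dest: wordsD)
  have sxy: "length (wdiff x y) = 2 * r" by (rule wdist_sphere[OF x y r h])
  show ?thesis
  proof (cases "length (wdiff z w) < 2 * r")
    case True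
    then show ?thesis using x y zw sxy by (intro wdist_less_length) auto
  next
    case False
    then have lr: "length z = r" "length w = r" "length (wdiff z w) = length z + length w" using l le by auto
    have "r \<noteq> 0" using lens_nonempty[OF z] sxy by (intro notI) simp
    then have hz: "hd z \<noteq> hd w" using length_wdiff_eqD[of z w] zw lr wordsD(2) by force
    have less: "wdist n z w < wdist n x y" if "code n (winv z) < code n (winv x)" "code n (winv w) < code n (winv y)"
      using that wdist_sphere(2)[OF x y r h] wdist_sphere(2)[OF zw lr(1,2) hz]
      by (simp add: add_strict_mono)
    have less': "wdist n z w < wdist n x y" if "code n (winv z) < code n (winv y)" "code n (winv w) < code n (winv x)"
      using that wdist_sphere(2)[OF x y r h] wdist_sphere(2)[OF zw lr(1,2) hz]
      by (simp add: add_strict_mono add.commute)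
    note c = lens_sphere_less[OF x y r h z lr(1)] lens_sphere_less[OF x y r h w lr(2)]
      lens_sphere_less[OF y x r(2,1) yx z'(1) lr(1)] lens_sphere_less[OF y x r(2,1) yx z'(2) lr(2)]
    show ?thesis
    proof (cases "hd z = hd y \<or> hd w = hd x")
      case True
      then show ?thesis using c hz h less' by metis
    next
      case False
      then show ?thesis using c hz h less less' by metis
    qed
  qed
qed

text \<open>The midpoint \<open>p\<close> of \<open>x\<close> and \<open>z\<close> lies on the segment from the origin to \<open>x\<close>, and the ball about \<open>p\<close>
  through \<open>x\<close> is contained in the ball about the origin through \<open>x\<close>. So \<open>w\<close> cannot be further from \<open>y\<close> than \<open>x\<close> is,
  and in the case of equality \<open>w\<close> and \<open>x\<close> reach the origin along the same path from \<open>p\<close> on. The comparison of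
  their codes is then decided on the sphere about \<open>p\<close>.\<close>

lemma lens_trans_centred:
  assumes x: "x \<in> words n" and y: "y \<in> words n" and r: "length x = r" "length y = r" and h: "hd x \<noteq> hd y"
    and z: "z \<in> lens n x y" and ev: "even (length (wdiff x z))" and w: "w \<in> lens n x z"
  shows "wdist n w y < wdist n x y"
proof -
  have zw: "z \<in> words n" "w \<in> words n" using z w by (auto simp: lens_def)
  have lz: "length z \<le> r" using lens_ball[OF x y r h z] .
  have sxy: "length (wdiff x y) = 2 * r" by (rule wdist_sphere[OF x y r h])
  obtain k x'' z'' where k: "x = k @ x''" "z = k @ z''" "x'' = [] \<or> z'' = [] \<or> hd x'' \<noteq> hd z''"
    by (rule common_prefix)
  have red: "reduced x''" "reduced z''" using k x zw by (auto simp: words_iff reduced_append)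
  have wd: "wdiff x z = winv x'' @ z''"
    using k zw wdiff_prefix[of k z'' x''] red by (simp add: words_iff wdiff_branch)
  obtain s where s: "length (wdiff x z) = 2 * s" using ev by blast
  have ls: "length x'' + length z'' = 2 * s" using s wd by simp
  have sle: "s \<le> length x''" using ls k lz r by auto
  define p where "p = take (r - s) x"
  define x' where "x' = drop (r - s) x"
  have xp: "x = p @ x'" by (simp add: p_def x'_def)
  have sr: "s \<le> r" using sle k(1) r(1) by auto
  have lx': "length x' = s" using r sr by (simp add: x'_def)
  have lp: "length p = r - s" using r by (simp add: p_def)
  have kp: "p = k @ take (length x'' - s) x''"
  proof -
    have "r - s - length k = length x'' - s" "length k \<le> r - s" using k(1) r(1) sle by auto
    then show ?thesis using k(1) by (simp add: p_def)
  qed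
  define x1 where "x1 = take (length x'' - s) x''"
  have x1: "x'' = x1 @ x'" using xp k(1) kp by (simp add: x1_def)
  have s0: "s \<noteq> 0"
  proof
    assume "s = 0"
    then have "x = z" using ls k by simp
    then show False using lens_nonempty[OF w] s by (simp add: \<open>s = 0\<close>)
  qed
  \<comment> \<open>The primed points are the images under the translation that moves \<open>p\<close> to the origin.\<close>
  have pw: "p \<in> words n" and x'w: "x' \<in> words n" using x xp by (auto simp: words_iff reduced_append)
  define z' where "z' = wdiff p z"
  define w' where "w' = wdiff p w"
  have z'w: "z' \<in> words n" and w'w: "w' \<in> words n" using pw zw by (auto simp: z'_def w'_def wdiff_words)
  have z'eq: "z' = winv x1 @ z''"
  proof -
    have "wdiff (k @ x1) (k @ z'') = wdiff x1 z''" using zw k by (intro wdiff_prefix) (simp add: words_iff)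
    moreover have "wdiff x1 z'' = winv x1 @ z''"
    proof (cases "x1 = []")
      case True
      then show ?thesis by (simp add: wdiff_def)
    next
      case False
      then show ?thesis using red x1 k(3) by (intro wdiff_branch) (auto simp: reduced_append)
    qed
    ultimately show ?thesis using k(2) kp by (simp add: z'_def x1_def)
  qed
  have lz': "length z' = s" using z'eq ls x1 lx' by simp
  interpret W: group "free_group {1..n}" by (rule group_free_group)
  have px: "wdiff p x = x'" using wdiff_prefix[of p x' "[]"] x xp by (simp add: words_iff) (simp add: wdiff_def)
  have pback: "a = foldr push p (wdiff p a)" if "a \<in> words n" for a
  proof -
    have "p \<otimes>\<^bsub>free_group {1..n}\<^esub> (inv\<^bsub>free_group {1..n}\<^esub> p \<otimes>\<^bsub>free_group {1..n}\<^esub> a) = a"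
      using that pw by (simp add: W.m_assoc[symmetric])
    then show ?thesis using pw by (simp add: wdiff_group[symmetric]) (simp add: free_group_def)
  qed
  have dtr: "wdist n (wdiff p a) (wdiff p b) = wdist n a b" if "a \<in> words n" "b \<in> words n" for a b
    using wdiff_translate[OF pw that] by (simp add: wdist_def)
  have hxz: "hd x' \<noteq> hd z'"
    using length_wdiff_eqD[of x' z'] x'w z'w wdiff_translate[OF pw x zw(1)] px s lx' lz' s0
      wordsD(2)[OF x'w] wordsD(2)[OF z'w]
    by (auto simp: z'_def)
  have w'lens: "w' \<in> lens n x' z'"
    using w w'w dtr[OF x zw(1)] dtr[OF x zw(2)] dtr[OF zw(2,1)] px by (simp add: lens_def z'_def w'_def)
  have lw': "length w' \<le> s" using lens_ball[OF x'w z'w lx' lz' hxz w'lens] .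
  have wback: "w = foldr push p w'" using pback zw by (simp add: w'_def)
  have wb: "w = wdiff (winv p) w'" using wback by (simp add: wdiff_def)
  have lw: "length w \<le> (r - s) + length w'"
    using length_wdiff_le[of "winv p" w'] pw w'w lp wb by (auto dest: wordsD)
  have lwr: "length w \<le> r" using lw lw' sr by simp
  have le: "length (wdiff w y) \<le> length w + r"
    using length_wdiff_le[of w y] zw y r by (auto dest: wordsD)
  show ?thesis
  proof (cases "length (wdiff w y) < 2 * r")
    case True
    then show ?thesis using x y zw sxy by (intro wdist_less_length) auto
  next
    case False
    then have lwr': "length w = r" "length (wdiff w y) = length w + length y" using lwr le r by auto
    have r0: "r \<noteq> 0" using s0 sr by simp
    have hwy: "hd w \<noteq> hd y" using length_wdiff_eqD[of w y] wordsD(2)[OF zw(2)] wordsD(2)[OF y] lwr' r r0 by auto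
    have lw's: "length w' = s" using lw lw' lwr' sr by simp
    have "length (wdiff (winv p) w') = length (winv p) + length w'" using wb lwr' lp lw's sr by simp
    then have nb: "p = [] \<or> hd (winv p) \<noteq> hd w'"
      using length_wdiff_eqD[of "winv p" w'] wordsD(2)[OF pw] wordsD(2)[OF w'w] lw's s0 by auto
    have wp: "w = p @ w'"
      using wb wdiff_branch[of "winv p" w'] nb wordsD(2)[OF pw] wordsD(2)[OF w'w] by auto
    have cless: "code n (winv a) < code n (winv b) \<longleftrightarrow> code n (winv (p @ a)) < code n (winv (p @ b))"
      for a b by (simp add: code_append)
    have "code n (winv w') < code n (winv x')"
    proof (cases "hd w' = hd z'")
      case False
      then show ?thesis using lens_sphere_less[OF x'w z'w lx' lz' hxz w'lens lw's] by simp
    next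
      case True
      have zp: "z = p @ z'"
      proof -
        have "z = wdiff (winv p) z'" using pback[OF zw(1)] by (simp add: wdiff_def z'_def)
        moreover have "wdiff (winv p) z' = p @ z'"
          using wdiff_branch[of "winv p" z'] nb wordsD(2)[OF pw] wordsD(2)[OF z'w] True by auto
        ultimately show ?thesis by simp
      qed
      have "hd z = hd w" using zp wp True by (cases p) auto
      then have "code n (winv z) < code n (winv x)"
        using lens_sphere_less[OF x y r h z] hwy zp lp lz' sr by simp
      then have zx: "code n (winv z') < code n (winv x')" using cless xp zp by blast
      have "hd w' \<noteq> hd x'" "hd z' \<noteq> hd x'" using True hxz by auto
      moreover have "w' \<in> lens n z' x'" using w'lens lens_commute[OF x'w z'w] by simp
      ultimately have "code n (winv w') < code n (winv z')"
        using lens_sphere_less[OF z'w x'w lz' lx' _ _ lw's] by simp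
      then show ?thesis using zx by simp
    qed
    then have "code n (winv w) < code n (winv x)" using cless xp wp by blast
    then show ?thesis using sphere_less[OF x y zw(2) r lwr'(1) h hwy] by simp
  qed
qed

text \<open>Left translations preserve \<open>wdiff\<close>, so the midpoint can be moved to the origin. It is a vertex of
  the tree only if the distance is even.\<close>

lemma midpoint_translation:
  assumes x: "x \<in> words n" and y: "y \<in> words n" and ev: "even (length (wdiff x y))" and ne: "wdiff x y \<noteq> []"
  obtains g r where "g \<in> words n"
    "length (wdiff g x) = r" "length (wdiff g y) = r" "hd (wdiff g x) \<noteq> hd (wdiff g y)"
    "\<And>a b. a \<in> words n \<Longrightarrow> b \<in> words n \<Longrightarrow> wdiff (wdiff g a) (wdiff g b) = wdiff a b"
proof -
  interpret W: group "free_group {1..n}" by (rule group_free_group)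
  let ?t = "wdiff x y"
  have t: "?t \<in> words n" using x y by (rule wdiff_words)
  obtain r where r: "length ?t = 2 * r" using ev by blast
  define p where "p = take r ?t"
  define q where "q = drop r ?t"
  have pq: "?t = p @ q" by (simp add: p_def q_def)
  then have pqw: "p \<in> words n" "q \<in> words n" using t by (auto simp: words_iff reduced_append)
  have lpq: "length p = r" "length q = r" using r by (auto simp: p_def q_def)
  define g where "g = x \<otimes>\<^bsub>free_group {1..n}\<^esub> p"
  have g: "g \<in> words n" using x pqw by (simp add: g_def)
  have ga: "wdiff g a = wdiff p (wdiff x a)" if "a \<in> words n" for a
    using that x pqw g by (simp add: wdiff_group[of _ "{1..n}"] g_def W.inv_mult_group W.m_assoc)
  have xx: "wdiff x x = []" using x W.l_inv[OF x] by (simp add: wdiff_group[of _ "{1..n}"]) (simp add: free_group_def)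
  have gx: "wdiff g x = winv p"
    using ga[OF x] xx pqw foldr_push_Nil[of "winv p"] by (simp add: wdiff_def words_iff)
  have gy: "wdiff g y = q"
    using ga[OF y] pq wdiff_prefix[of p q "[]"] t by (simp add: words_iff) (simp add: wdiff_def)
  have "p \<noteq> []" "q \<noteq> []" using ne r lpq by auto
  then have "hd q \<noteq> hd (winv p)" using t pq by (auto simp: words_iff reduced_append hd_winv)
  then have hne: "hd (wdiff g x) \<noteq> hd (wdiff g y)" using gx gy by simp
  show ?thesis by (rule that[OF g _ _ hne wdiff_translate[OF g]]) (use gx gy lpq in auto)
qed

lemma lens_dist:
  assumes "x \<in> words n" "y \<in> words n" "even (length (wdiff x y))" "z \<in> lens n x y" "w \<in> lens n x y"
  shows "wdist n z w < wdist n x y"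
proof -
  obtain g r where g: "g \<in> words n"
    "length (wdiff g x) = r" "length (wdiff g y) = r" "hd (wdiff g x) \<noteq> hd (wdiff g y)"
    "\<And>a b. a \<in> words n \<Longrightarrow> b \<in> words n \<Longrightarrow> wdiff (wdiff g a) (wdiff g b) = wdiff a b"
    using midpoint_translation[OF assms(1-3) lens_nonempty[OF assms(4)]] by blast
  have zw: "z \<in> words n" "w \<in> words n" using assms by (auto simp: lens_def)
  have d: "wdist n (wdiff g a) (wdiff g b) = wdist n a b" if "a \<in> words n" "b \<in> words n" for a b
    using g(5)[OF that] by (simp add: wdist_def)
  have l: "wdiff g a \<in> lens n (wdiff g x) (wdiff g y)" if "a \<in> lens n x y" for a
    using that assms(1,2) g(1) by (auto simp: lens_def d wdiff_words)
  have "wdist n (wdiff g z) (wdiff g w) < wdist n (wdiff g x) (wdiff g y)"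
    by (rule lens_dist_centred[OF _ _ g(2-4) l l]) (use assms g in \<open>auto simp: wdiff_words\<close>)
  then show ?thesis using d zw assms by simp
qed

lemma lens_trans:
  assumes "x \<in> words n" "y \<in> words n" "even (length (wdiff x y))" "z \<in> lens n x y"
    "even (length (wdiff x z))" "w \<in> lens n x z"
  shows "wdist n w y < wdist n x y"
proof -
  obtain g r where g: "g \<in> words n"
    "length (wdiff g x) = r" "length (wdiff g y) = r" "hd (wdiff g x) \<noteq> hd (wdiff g y)"
    "\<And>a b. a \<in> words n \<Longrightarrow> b \<in> words n \<Longrightarrow> wdiff (wdiff g a) (wdiff g b) = wdiff a b"
    using midpoint_translation[OF assms(1-3) lens_nonempty[OF assms(4)]] by blast
  have zw: "z \<in> words n" "w \<in> words n" using assms by (auto simp: lens_def)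
  have d: "wdist n (wdiff g a) (wdiff g b) = wdist n a b" if "a \<in> words n" "b \<in> words n" for a b
    using g(5)[OF that] by (simp add: wdist_def)
  have l: "wdiff g a \<in> lens n (wdiff g u) (wdiff g v)" if "a \<in> lens n u v" "u \<in> words n" "v \<in> words n" for a u v
    using that g(1) by (auto simp: lens_def d wdiff_words)
  have "wdist n (wdiff g w) (wdiff g y) < wdist n (wdiff g x) (wdiff g y)"
    by (rule lens_trans_centred[OF _ _ g(2-4) l[OF assms(4)] _ l[OF assms(6)]])
      (use assms g zw in \<open>auto simp: wdiff_words\<close>)
  then show ?thesis using d zw assms by simp
qed

section \<open>Ranks\<close>

text \<open>Doubling all letters subdivides the edges of the Cayley tree: the midpoints of words of odd length become
  vertices, and all distances between doubled words are even.\<close>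

definition dbl :: "'s sword \<Rightarrow> 's sword" where
  "dbl w = concat (map (\<lambda>x. [x, x]) w)"

lemma dbl_simps [simp]: "dbl [] = []" "dbl (x # w) = x # x # dbl w" "dbl (u @ v) = dbl u @ dbl v"
  by (simp_all add: dbl_def)

lemma length_dbl [simp]: "length (dbl w) = 2 * length w"
  by (induction w) auto

lemma set_dbl [simp]: "set (dbl w) = set w"
  by (induction w) auto

lemma reduced_dbl: "reduced w \<Longrightarrow> reduced (dbl w)"
proof (induction w)
  case (Cons x w)
  then show ?case by (cases w) (auto simp: reduced_Cons opp_neq[symmetric])
qed simp

lemma winv_dbl: "winv (dbl w) = dbl (winv w)"
  by (induction w) (simp_all add: winv_def)

lemma dbl_inject: "dbl u = dbl v \<longleftrightarrow> u = v"
proof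
  show "dbl u = dbl v \<Longrightarrow> u = v"
  proof (induction u arbitrary: v)
    case Nil
    then show ?case by (cases v) auto
  next
    case (Cons x u)
    then show ?case by (cases v) auto
  qed
qed simp

lemma dbl_push: "dbl (push x w) = push x (push x (dbl w))"
  by (cases w) (auto simp: opp_neq[symmetric])

lemma dbl_foldr_push: "dbl (foldr push u w) = foldr push (dbl u) (dbl w)"
  by (induction u) (auto simp: dbl_push)

lemma dbl_wdiff: "dbl (wdiff x y) = wdiff (dbl x) (dbl y)"
  by (simp add: wdiff_def dbl_foldr_push winv_dbl)

lemma dbl_words: "w \<in> words n \<Longrightarrow> dbl w \<in> words n"
  by (simp add: words_iff reduced_dbl)

definition rank :: "nat \<Rightarrow> nat sword \<Rightarrow> nat" where
  "rank n w = rk n (dbl w)"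

lemma rank_winv [simp]: "rank n (winv w) = rank n w"
  by (simp add: rank_def winv_dbl[symmetric])

lemma rank_inject:
  "u \<in> words n \<Longrightarrow> v \<in> words n \<Longrightarrow> rank n u = rank n v \<Longrightarrow> u = v \<or> u = winv v"
  using rk_inject[of "dbl u" n "dbl v"] dbl_words[of u n] dbl_words[of v n]
  by (simp add: rank_def winv_dbl dbl_inject)

lemma rank_less_length:
  "u \<in> words n \<Longrightarrow> length u < length v \<Longrightarrow> rank n u < rank n v"
  unfolding rank_def by (rule rk_less_length) (auto dest: wordsD(1))

lemma rank_less_lengthD:
  "v \<in> words n \<Longrightarrow> rank n u < rank n v \<Longrightarrow> length u \<le> length v"
  using rk_less_lengthD[of "dbl v" n "dbl u"] wordsD(1)[of v n] by (simp add: rank_def)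

lemma rank_lens_iff:
  assumes "x \<in> words n" "y \<in> words n" "z \<in> words n"
  shows "dbl z \<in> lens n (dbl x) (dbl y) \<longleftrightarrow>
    rank n (wdiff x z) < rank n (wdiff x y) \<and> rank n (wdiff z y) < rank n (wdiff x y)"
  using assms by (simp add: lens_def wdist_def dbl_words rank_def dbl_wdiff)

lemma rank_lens_dist:
  assumes "x \<in> words n" "y \<in> words n" "z \<in> words n" "w \<in> words n"
    and "rank n (wdiff x z) < rank n (wdiff x y)" "rank n (wdiff z y) < rank n (wdiff x y)"
    and "rank n (wdiff x w) < rank n (wdiff x y)" "rank n (wdiff w y) < rank n (wdiff x y)"
  shows "rank n (wdiff z w) < rank n (wdiff x y)"
proof -
  have "wdist n (dbl z) (dbl w) < wdist n (dbl x) (dbl y)"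
    using assms by (intro lens_dist) (auto simp: rank_lens_iff dbl_words dbl_wdiff[symmetric])
  then show ?thesis by (simp add: wdist_def rank_def dbl_wdiff)
qed

lemma rank_lens_trans:
  assumes "x \<in> words n" "y \<in> words n" "z \<in> words n" "w \<in> words n"
    and "rank n (wdiff x z) < rank n (wdiff x y)" "rank n (wdiff z y) < rank n (wdiff x y)"
    and "rank n (wdiff x w) < rank n (wdiff x z)" "rank n (wdiff w z) < rank n (wdiff x z)"
  shows "rank n (wdiff w y) < rank n (wdiff x y)"
proof -
  have "wdist n (dbl w) (dbl y) < wdist n (dbl x) (dbl y)"
    by (rule lens_trans[where z = "dbl z"])
      (use assms in \<open>auto simp: rank_lens_iff dbl_words dbl_wdiff[symmetric]\<close>)
  then show ?thesis by (simp add: wdist_def rank_def dbl_wdiff)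
qed

section \<open>Cancellation in products\<close>

lemma foldr_push_eq_wdiff: "foldr push u w = wdiff (winv u) w"
  by (simp add: wdiff_def)

text \<open>If \<open>y\<close> does not become longer when it is multiplied by the inverse of \<open>x\<close>, then at least half of \<open>x\<close> cancels.\<close>

lemma length_wdiff_le_prefix:
  assumes "reduced x" "reduced y" "length (wdiff x y) \<le> length y"
  shows "take ((length x + 1) div 2) x = take ((length x + 1) div 2) y"
proof -
  obtain p x' y' where p: "x = p @ x'" "y = p @ y'" "x' = [] \<or> y' = [] \<or> hd x' \<noteq> hd y'"
    by (rule common_prefix)
  then have "wdiff x y = winv x' @ y'"
    using assms wdiff_prefix[of p y' x'] by (simp add: reduced_append wdiff_branch)
  then have "(length x + 1) div 2 \<le> length p" using p assms(3) by simp
  then show ?thesis using p by simp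
qed

text \<open>Otherwise \<open>y\<close> and its inverse agree on their first halves, rounded up, since both agree there with \<open>x\<close>.
  Comparing the letters in the middle of \<open>y\<close> shows that a letter is its own inverse or that \<open>y\<close> is not reduced.\<close>

lemma no_double_shortening:
  assumes "reduced x" "reduced y"
    and "length (foldr push y x) \<le> length x" "length (foldr push (winv y) x) \<le> length x"
  shows "y = []"
proof (rule ccontr)
  assume ne: "y \<noteq> []"
  let ?k = "(length y + 1) div 2"
  have k: "?k - 1 < length y" "?k - 1 < ?k" using ne by (cases "length y"; simp)+
  have t: "take ?k y = take ?k (winv y)"
    using length_wdiff_le_prefix[of y x] length_wdiff_le_prefix[of "winv y" x] assms
    by (simp add: foldr_push_eq_wdiff)
  have "y ! (?k - 1) = take ?k y ! (?k - 1)" using k(2) by (rule nth_take[symmetric])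
  also have "\<dots> = winv y ! (?k - 1)" unfolding t using k(2) by (rule nth_take)
  also have "\<dots> = opp (y ! (length y - ?k))"
    using k ne by (simp add: winv_def rev_nth)
  finally have e: "y ! (?k - 1) = opp (y ! (length y - ?k))" .
  show False
  proof (cases "even (length y)")
    case True
    then obtain j where j: "length y = 2 * j" by blast
    then have "?k = j" "j \<ge> 1" using k by auto
    then have "y ! (j - 1) = opp (y ! Suc (j - 1))" "Suc (j - 1) < length y" using e j by auto
    moreover have "\<And>i. Suc i < length y \<Longrightarrow> y ! Suc i \<noteq> opp (y ! i)"
      using assms(2) by (simp add: reduced_def successively_conv_nth)
    ultimately show False by (metis opp_opp)
  next
    case False
    then obtain j where j: "length y = 2 * j + 1" by (blast elim: oddE)
    then have "?k - 1 = j" "length y - ?k = j" by auto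
    then have "opp (y ! j) = y ! j" using e by simp
    then show False by simp
  qed
qed

lemma length_push_cases: "length (push x w) = Suc (length w) \<or> (w \<noteq> [] \<and> hd w = opp x \<and> Suc (length (push x w)) = length w)"
  by (cases w) auto

text \<open>Both \<open>a\<close> and its product with the letter would have length at most one, and their lengths differ by one. So one
  of them is trivial and the other is the letter or its inverse, which has the same rank as the letter.\<close>

lemma letter_not_max:
  assumes "[x] \<in> words n" "a \<in> words n" "rank n (push x a) < rank n [x]" "rank n a < rank n [x]"
  shows False
proof -
  have px: "push x a \<in> words n"
    using assms reduced_push[of a x] set_push[of x "{1..n}" a] by (simp add: words_iff)
  have l: "length a \<le> 1" "length (push x a) \<le> 1"
    using rank_less_lengthD[OF assms(1,3)] rank_less_lengthD[OF assms(1,4)] by auto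
  show False
  proof (cases a)
    case Nil
    then show ?thesis using assms by simp
  next
    case (Cons y w)
    then have w: "a = [y]" using l by simp
    then have "y = opp x" using l by (auto split: if_splits)
    then have "a = winv [x]" using w by (simp add: winv_def)
    then show ?thesis using assms(4) by simp
  qed
qed

text \<open>A letter that does not lengthen \<open>a\<close> cancels against the first letter of \<open>a\<close>.\<close>

lemma letters_not_both_shorten:
  assumes "a \<in> words n" "rank n (push x a) < rank n a" "rank n (push y a) < rank n a"
  shows "x = y"
proof -
  have "length (push x a) \<le> length a" "length (push y a) \<le> length a"
    using rank_less_lengthD[OF assms(1)] assms by auto
  then have "hd a = opp x" "hd a = opp y" using length_push_cases[of x a] length_push_cases[of y a] by auto
  then show ?thesis by simp
qed

section \<open>Nielsen reduction\<close>

text \<open>The initial half of the doubled word consists of \<open>p\<close> or \<open>q\<close>, doubled, followed by the same letters; the initial half of the inverse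
  lies inside that of the doubled \<open>c\<close>, because \<open>p\<close> and \<open>q\<close> are not longer than \<open>c\<close>.\<close>

lemma rank_exchange:
  assumes "p @ c \<in> words n" "q @ c \<in> words n" "length p = length q" "length p \<le> length c"
    and "code n (dbl p) < code n (dbl q)"
  shows "rank n (p @ c) < rank n (q @ c)"
proof -
  have h: "half (dbl (r @ c)) = dbl r @ take (length c - length r) (dbl c)"
    "half (winv (dbl (r @ c))) = take (length c + length r) (winv (dbl c))"
    if "length r \<le> length c" for r
    using that by (simp_all add: half_def)
  have "rk n (dbl (p @ c)) < rk n (dbl (q @ c))"
    using h[of p] h[of q] assms(3-5) unfolding rk_def
    by (simp add: code_append del: dbl_simps)
  then show ?thesis by (simp add: rank_def)
qed

text \<open>Words of length one are exempt from irreducibility: among the images of the letters, the letters that an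
  automorphism is required to fix are such words, and they must not be moved.\<close>

locale nielsen_reduced =
  fixes n :: nat and A :: "nat sword set"
  assumes words: "A \<subseteq> words n" and winv_closed: "a \<in> A \<Longrightarrow> winv a \<in> A" and nonempty: "[] \<notin> A"
    and irreducible: "\<lbrakk>a \<in> A; b \<in> A; b \<noteq> a; b \<noteq> winv a; length a \<ge> 2\<rbrakk>
        \<Longrightarrow> rank n a \<le> rank n (foldr push b a)"
begin

lemma red: "a \<in> A \<Longrightarrow> reduced a"
  using words wordsD(2) by blast

lemma mult_words: "a \<in> A \<Longrightarrow> b \<in> A \<Longrightarrow> foldr push a b \<in> words n"
  unfolding foldr_push_eq_wdiff by (intro wdiff_words winv_words) (use words in auto)

lemma length_mult_ge:
  assumes "a \<in> A" "b \<in> A" "b \<noteq> winv a"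
  shows "length (foldr push b a) \<ge> length a"
proof (rule ccontr)
  assume less: "\<not> ?thesis"
  have rab: "reduced a" "reduced b" using assms red by auto
  consider "length a < 2" | "b = a" | "length a \<ge> 2" "b \<noteq> a" by linarith
  then show False
  proof cases
    case 1
    then have "length a = 1" using nonempty assms by (cases a) auto
    then have "length (foldr push b a) = 0" using less by linarith
    then have e: "foldr push b a = []" by simp
    then have "wdiff (winv b) a = []" by (simp add: wdiff_def)
    moreover obtain p x' y' where p: "winv b = p @ x'" "a = p @ y'" "x' = [] \<or> y' = [] \<or> hd x' \<noteq> hd y'"
      by (rule common_prefix)
    moreover have "wdiff (winv b) a = winv x' @ y'"
    proof -
      have "reduced (winv b)" using rab by simp
      then show ?thesis
        using p rab(1) wdiff_prefix[of p y' x'] by (simp add: reduced_append wdiff_branch)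
    qed
    ultimately have "winv b = a" by simp
    then show False using assms(3) by (metis winv_winv)
  next
    case 2
    have "foldr push (winv a) a = []"
      using foldr_push_inverse[of "[]" a] foldr_push_Nil[OF rab(1)] by (simp add: winv_def)
    then have "a = []" using no_double_shortening[OF rab(1,1)] less 2 by simp
    then show False using nonempty assms by simp
  next
    case 3
    then have "rank n a \<le> rank n (foldr push b a)" using irreducible assms by blast
    moreover have "rank n (foldr push b a) < rank n a"
      using less mult_words[OF assms(2,1)] by (intro rank_less_length) auto
    ultimately show False by simp
  qed
qed

text \<open>In the product of \<open>a\<close> and \<open>b\<close>, exactly \<open>k\<close> letters of each factor cancel.\<close>

definition cancels :: "nat sword \<Rightarrow> nat sword \<Rightarrow> nat \<Rightarrow> bool" where
  "cancels a b k \<longleftrightarrow> (\<exists>a' p b'. a = a' @ winv p \<and> b = p @ b' \<and> length p = k \<and>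
     (a' = [] \<or> b' = [] \<or> hd b' \<noteq> opp (last a')) \<and> foldr push a b = a' @ b')"

lemma cancels_ex:
  assumes "a \<in> A" "b \<in> A"
  shows "\<exists>k. cancels a b k"
proof -
  obtain p x' y' where p: "winv a = p @ x'" "b = p @ y'" "x' = [] \<or> y' = [] \<or> hd x' \<noteq> hd y'"
    by (rule common_prefix)
  have a: "a = winv x' @ winv p" using p(1) by (metis winv_append winv_winv)
  have rab: "reduced (winv a)" "reduced b" using assms red by auto
  have "foldr push a b = winv x' @ y'"
    using p rab wdiff_prefix[of p y' x'] unfolding foldr_push_eq_wdiff
    by (simp add: reduced_append wdiff_branch)
  then have "cancels a b (length p)"
    unfolding cancels_def using p a by (intro exI[of _ "winv x'"] exI[of _ p] exI[of _ y']) (auto simp: last_winv)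
  then show ?thesis by blast
qed

lemma cancels_half:
  assumes "a \<in> A" "b \<in> A" "b \<noteq> winv a" "cancels a b k"
  shows "2 * k \<le> length a" "2 * k \<le> length b"
proof -
  obtain a' p b' where c: "a = a' @ winv p" "b = p @ b'" "length p = k" "foldr push a b = a' @ b'"
    using assms(4) by (auto simp: cancels_def)
  have "a \<noteq> winv b" using assms(3) by auto
  then have "length (foldr push a b) \<ge> length b" using length_mult_ge[OF assms(2,1)] by simp
  then show "2 * k \<le> length a" using c by simp
  have "length (foldr push (winv b) (winv a)) \<ge> length (winv a)"
    using assms winv_closed by (intro length_mult_ge) auto
  moreover have "foldr push (winv b) (winv a) = winv (foldr push a b)"
    using winv_wdiff[of "winv a" b] assms(1,2) red by (simp add: foldr_push_eq_wdiff)
  ultimately show "2 * k \<le> length b" using c by simp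
qed

text \<open>If \<open>b\<close> were consumed by its neighbours, each of them would cancel half of it, so \<open>b\<close> would be \<open>p\<close> times the inverse
  of \<open>q\<close>, where \<open>p\<close> and \<open>q\<close> have the same length, the left neighbour ends with the inverse of \<open>p\<close> and the right neighbour
  starts with \<open>q\<close>. Multiplication by \<open>b\<close> exchanges \<open>p\<close> and \<open>q\<close> in a neighbour; it lowers the rank of the right
  neighbour if \<open>p\<close> has the smaller code, and that of the left neighbour otherwise.\<close>

lemma cancels_middle:
  assumes abc: "a \<in> A" "b \<in> A" "c \<in> A" and ne: "b \<noteq> winv a" "c \<noteq> winv b"
    and k: "cancels a b k" "cancels b c k'"
  shows "k + k' < length b"
proof (rule ccontr)
  assume "\<not> ?thesis"
  moreover have hk: "2 * k \<le> length a" "2 * k \<le> length b" "2 * k' \<le> length b" "2 * k' \<le> length c"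
    using cancels_half[OF abc(1,2) ne(1) k(1)] cancels_half[OF abc(2,3) ne(2) k(2)] by auto
  ultimately have kk: "k' = k" "length b = 2 * k" by auto
  obtain a' p b1 where c1: "a = a' @ winv p" "b = p @ b1" "length p = k" "foldr push a b = a' @ b1"
    using k(1) by (auto simp: cancels_def)
  obtain b2 q c' where c2: "b = b2 @ winv q" "c = q @ c'" "length q = k" "foldr push b c = b2 @ c'"
    using k(2) kk by (auto simp: cancels_def)
  have b: "b = p @ winv q" "b1 = winv q" "b2 = p"
    using c1 c2 kk by auto
  have k0: "k > 0" using kk nonempty abc by (cases b) auto
  have pq: "p \<noteq> q"
  proof
    assume "p = q"
    then have "hd (winv p) \<noteq> opp (last p)"
      using red[OF abc(2)] b(1) c1(3) k0 by (auto simp: reduced_append)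
    moreover have "p \<noteq> []" using c1(3) k0 by auto
    ultimately show False by (simp add: hd_winv)
  qed
  have "set p \<subseteq> {1..n} \<times> UNIV" "set q \<subseteq> {1..n} \<times> UNIV"
    using abc words c1 c2 wordsD(1)[of b n] wordsD(1)[of c n] by auto
  then have "code n (dbl p) \<noteq> code n (dbl q)"
    using code_inject[of "dbl p" "dbl q" n] c1(3) c2(3) pq by (auto simp: dbl_inject)
  then consider "code n (dbl p) < code n (dbl q)" | "code n (dbl q) < code n (dbl p)" by linarith
  then show False
  proof cases
    case 1
    have "p @ c' \<in> words n" using mult_words[OF abc(2,3)] c2 b by simp
    then have "rank n (p @ c') < rank n (q @ c')"
      using 1 words abc(3) c1 c2 hk kk by (intro rank_exchange) auto
    moreover have "rank n c \<le> rank n (foldr push b c)"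
    proof (rule irreducible)
      show "b \<noteq> c" using b c2 c1 pq by auto
      show "b \<noteq> winv c" using ne by auto
    qed (use abc hk kk k0 in auto)
    ultimately show False using c2 b by simp
  next
    case 2
    let ?d = "winv a'"
    have m: "foldr push (winv b) (winv a) = winv (foldr push a b)"
      using winv_wdiff[of "winv a" b] abc red by (simp add: foldr_push_eq_wdiff)
    have "winv (a' @ winv q) \<in> words n" using mult_words[OF abc(1,2)] c1 b winv_words by metis
    then have "q @ ?d \<in> words n" by simp
    moreover have "p @ ?d \<in> words n" using winv_words[of a n] words abc(1) c1 by auto
    ultimately have "rank n (q @ ?d) < rank n (p @ ?d)"
      using 2 c1 c2 hk by (intro rank_exchange) auto
    moreover have "rank n (winv a) \<le> rank n (foldr push (winv b) (winv a))"
    proof (rule irreducible)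
      show "winv b \<noteq> winv a"
      proof
        assume "winv b = winv a"
        then have "b = a" by (metis winv_winv)
        then have "winv q = winv p" using b c1 c2 by (metis append_eq_append_conv length_winv)
        then show False using pq by (metis winv_winv)
      qed
      show "winv b \<noteq> winv (winv a)" using ne by (metis winv_winv)
    qed (use abc hk kk k0 winv_closed in auto)
    moreover have "winv a = p @ ?d" using c1 by simp
    moreover have "foldr push (winv b) (winv a) = q @ ?d" using m c1 b by simp
    ultimately show False by simp
  qed
qed

text \<open>Every factor keeps at least one letter in the reduced product. The induction carries along the part \<open>s\<close>
  of the first factor that cancels against the second one.\<close>

lemma length_product:
  assumes "set us \<subseteq> A" "successively (\<lambda>u v. v \<noteq> winv u) us" "us \<noteq> []"
  shows "length (foldr (foldr push) us []) \<ge> length us"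
proof -
  have "\<exists>t s z. foldr (foldr push) us [] = t @ z \<and> reduced (t @ z) \<and> hd us = t @ s \<and> t \<noteq> [] \<and>
      length us \<le> Suc (length z) \<and> (case tl us of [] \<Rightarrow> s = [] | v # _ \<Rightarrow> cancels (hd us) v (length s))"
    using assms
  proof (induction us)
    case (Cons a us)
    show ?case
    proof (cases us)
      case Nil
      then show ?thesis using Cons.prems red nonempty by (intro exI[of _ a] exI[of _ "[]"]) (auto simp: foldr_push_Nil)
    next
      case us: (Cons b vs)
      obtain t s z where t: "foldr (foldr push) us [] = t @ z" "reduced (t @ z)" "hd us = t @ s" "t \<noteq> []"
        "length us \<le> Suc (length z)" "case tl us of [] \<Rightarrow> s = [] | v # _ \<Rightarrow> cancels (hd us) v (length s)"
        using Cons.IH Cons.prems us by (auto simp: successively_Cons)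
      have ab: "a \<in> A" "b \<in> A" "b \<noteq> winv a" using Cons.prems us by auto
      obtain k where k: "cancels a b k" using cancels_ex ab by blast
      have bts: "b = t @ s" using t us by simp
      have ks: "k + length s < length b"
      proof (cases vs)
        case Nil
        then show ?thesis using t us cancels_half(2)[OF ab k] nonempty ab by (cases b) auto
      next
        case (Cons c ws)
        then have "cancels b c (length s)" "c \<in> A" "c \<noteq> winv b" using t us Cons.prems by auto
        then show ?thesis using cancels_middle[OF ab(1,2) _ ab(3) _ k] by blast
      qed
      obtain a' p b' where c: "a = a' @ winv p" "b = p @ b'" "length p = k"
        "a' = [] \<or> b' = [] \<or> hd b' \<noteq> opp (last a')" "foldr push a b = a' @ b'"
        using k by (auto simp: cancels_def)
      have "length p < length t" using ks c(3) arg_cong[OF bts, of length] by simp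
      moreover have "take (length p) (t @ s) = p" using c(2) bts append_eq_conv_conj[of p b' b] by simp
      ultimately have pt: "p = take (length p) t" by simp
      define t' where "t' = drop (length p) t"
      have "t = take (length p) t @ t'" by (simp add: t'_def)
      then have t': "t = p @ t'" using pt by simp
      have t'ne: "t' \<noteq> []" using \<open>length p < length t\<close> by (simp add: t'_def)
      have b': "b' = t' @ s" using c(2) bts t' by simp
      have ra: "reduced a'" using red[OF ab(1)] c(1) by (simp add: reduced_append)
      have rt: "reduced (t' @ z)" using t(2) t' by (simp add: reduced_append)
      have r: "reduced (a' @ t' @ z)" using ra rt c(4) b' t'ne by (auto simp: reduced_append)
      have "foldr push a (t @ z) = foldr push a' (foldr push (winv p) (p @ t' @ z))"
        using c(1) t' by simp
      also have "foldr push (winv p) (p @ t' @ z) = t' @ z"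
        using wdiff_prefix[of p "t' @ z" "[]"] t(2) t' by (simp add: wdiff_def)
      also have "foldr push a' (t' @ z) = a' @ t' @ z" by (rule foldr_push_append[OF r])
      finally have e: "foldr (foldr push) (a # us) [] = a' @ t' @ z" using t(1) by simp
      have "a' \<noteq> []" using cancels_half(1)[OF ab k] c nonempty ab(1) by (cases a) auto
      moreover have "length (a # us) \<le> Suc (length (t' @ z))" using t(5) t'ne by (cases t') auto
      moreover have "cancels a b (length (winv p))" using k c(3) by simp
      ultimately show ?thesis using e r c(1) us
        by (intro exI[of _ a'] exI[of _ "winv p"] exI[of _ "t' @ z"]) simp
    qed
  qed simp
  then obtain t z where "foldr (foldr push) us [] = t @ z" "t \<noteq> []" "length us \<le> Suc (length z)" by blast
  then show ?thesis by (cases t) auto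
qed

lemma letter_product:
  assumes "set us \<subseteq> A" "successively (\<lambda>u v. v \<noteq> winv u) us" "foldr (foldr push) us [] = [x]"
  shows "[x] \<in> A"
proof -
  have "us \<noteq> []" using assms(3) by auto
  then have "length us \<le> 1" using length_product[OF assms(1,2)] assms(3) by simp
  then obtain u where u: "us = [u]" using \<open>us \<noteq> []\<close> by (cases us) auto
  then have "foldr push u [] = u" using assms(1) red by (simp add: foldr_push_Nil)
  then show ?thesis using u assms by simp
qed

end

section \<open>Conjugation\<close>

context group
begin

definition cj :: "'a \<Rightarrow> 'a \<Rightarrow> 'a" where
  "cj g x = g \<otimes> x \<otimes> inv g"

lemma inv_cancel_left:
  "x \<in> carrier G \<Longrightarrow> z \<in> carrier G \<Longrightarrow> inv x \<otimes> (x \<otimes> z) = z"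
  "x \<in> carrier G \<Longrightarrow> z \<in> carrier G \<Longrightarrow> x \<otimes> (inv x \<otimes> z) = z"
  by (simp_all add: m_assoc[symmetric])

lemma cj_closed [simp]: "g \<in> carrier G \<Longrightarrow> x \<in> carrier G \<Longrightarrow> cj g x \<in> carrier G"
  by (simp add: cj_def)

lemma cj_mult:
  "g \<in> carrier G \<Longrightarrow> x \<in> carrier G \<Longrightarrow> y \<in> carrier G \<Longrightarrow> cj g (x \<otimes> y) = cj g x \<otimes> cj g y"
  by (simp add: cj_def m_assoc inv_cancel_left)

lemma cj_inv: "g \<in> carrier G \<Longrightarrow> x \<in> carrier G \<Longrightarrow> cj g (inv x) = inv (cj g x)"
  by (simp add: cj_def m_assoc inv_mult_group)

lemma cj_comp:
  "g \<in> carrier G \<Longrightarrow> h \<in> carrier G \<Longrightarrow> x \<in> carrier G \<Longrightarrow> cj (g \<otimes> h) x = cj g (cj h x)"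
  by (simp add: cj_def m_assoc inv_mult_group)

lemma cj_eq_iff:
  "g \<in> carrier G \<Longrightarrow> x \<in> carrier G \<Longrightarrow> y \<in> carrier G \<Longrightarrow> cj g x = y \<longleftrightarrow> g \<otimes> x = y \<otimes> g"
  by (metis cj_def inv_solve_right m_closed)

lemma cj_inv_eq:
  "g \<in> carrier G \<Longrightarrow> x \<in> carrier G \<Longrightarrow> cj g x = y \<Longrightarrow> cj (inv g) y = x"
  by (auto simp add: cj_def m_assoc inv_cancel_left)

end

section \<open>Consequences of the relations\<close>

text \<open>Letters with their inversion \<open>i\<close>. The predicate \<open>adm\<close> says for which letters there is a symbol \<open>M\<close>, and \<open>sw a b\<close>
  is the effect of \<open>w a b\<close> on letters.\<close>

locale signed_letters =
  fixes L L' :: "'a set" and i :: "'a \<Rightarrow> 'a"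
  assumes L'_sub: "L' \<subseteq> L" and i_L: "a \<in> L \<Longrightarrow> i a \<in> L" and i_L': "a \<in> L' \<Longrightarrow> i a \<in> L'"
    and i_i: "a \<in> L \<Longrightarrow> i (i a) = a" and i_neq: "a \<in> L \<Longrightarrow> i a \<noteq> a"
begin

definition adm :: "'a \<Rightarrow> 'a \<Rightarrow> bool" where
  "adm a b \<longleftrightarrow> a \<in> L' \<and> b \<in> L \<and> a \<noteq> b \<and> a \<noteq> i b"

definition sw :: "'a \<Rightarrow> 'a \<Rightarrow> 'a \<Rightarrow> 'a" where
  "sw a b x = (if x = a then i b else if x = i a then b else if x = b then a
     else if x = i b then i a else x)"

lemma i_eq_iff: "a \<in> L \<Longrightarrow> b \<in> L \<Longrightarrow> i a = b \<longleftrightarrow> a = i b"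
  using i_i by auto

lemma i_inject: "a \<in> L \<Longrightarrow> b \<in> L \<Longrightarrow> i a = i b \<longleftrightarrow> a = b"
  using i_i by metis

lemma adm_i: "adm a b \<Longrightarrow> adm a (i b)" "adm a b \<Longrightarrow> adm (i a) b"
  using L'_sub by (auto simp: adm_def i_L i_L' i_i i_eq_iff i_inject)

lemma adm_sym: "adm a b \<Longrightarrow> b \<in> L' \<Longrightarrow> adm b a"
  using L'_sub by (auto simp: adm_def i_i)

lemma sw_i: "adm a b \<Longrightarrow> b \<in> L' \<Longrightarrow> x \<in> L \<Longrightarrow> sw a b (i x) = i (sw a b x)"
  using L'_sub i_neq by (auto simp: sw_def adm_def i_i i_inject i_eq_iff i_L)

lemma sw_L: "adm a b \<Longrightarrow> b \<in> L' \<Longrightarrow> x \<in> L \<Longrightarrow> sw a b x \<in> L"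
  using L'_sub by (auto simp: sw_def adm_def i_L)

lemma sw_L': "adm a b \<Longrightarrow> b \<in> L' \<Longrightarrow> x \<in> L' \<Longrightarrow> sw a b x \<in> L'"
  using L'_sub by (auto simp: sw_def adm_def i_L')

lemma sw_other: "x \<notin> {a, i a, b, i b} \<Longrightarrow> sw a b x = x"
  by (simp add: sw_def)

lemma sw_values:
  assumes "adm a b" "b \<in> L'"
  shows "sw a b a = i b" "sw a b (i a) = b" "sw a b b = a" "sw a b (i b) = i a"
  using assms L'_sub i_neq by (auto simp: sw_def adm_def i_i i_inject i_eq_iff)

lemma sw_inverse:
  assumes "adm a b" "b \<in> L'" "x \<in> L"
  shows "sw a (i b) (sw a b x) = x" "sw a b (sw a (i b) x) = x"
  using assms L'_sub i_neq by (auto simp: sw_def adm_def i_i i_inject i_eq_iff)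

lemma sw_inject: "adm a b \<Longrightarrow> b \<in> L' \<Longrightarrow> x \<in> L \<Longrightarrow> y \<in> L \<Longrightarrow> sw a b x = sw a b y \<longleftrightarrow> x = y"
  using sw_inverse(1) by metis

lemma adm_sw: "adm a b \<Longrightarrow> b \<in> L' \<Longrightarrow> adm c d \<Longrightarrow> adm (sw a b c) (sw a b d)"
  using L'_sub unfolding adm_def[of c d] adm_def[of "sw a b c"]
  by (metis sw_L sw_L' sw_i sw_inject i_L subsetD)

end

text \<open>The relations of the presentation, in an arbitrary group. The results of this part will be used
  in the group that the presentation defines.\<close>

locale gersten = signed_letters L L' i + group Q
  for L L' :: "'a set" and i and Q :: "('q, 'm) monoid_scheme" (structure) +
  fixes m w :: "'a \<Rightarrow> 'a \<Rightarrow> 'q"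
  assumes third: "a \<in> L' \<Longrightarrow> b \<in> L' \<Longrightarrow> \<exists>e \<in> L'. e \<notin> {a, i a, b, i b}"
    and m_closed': "adm a b \<Longrightarrow> m a b \<in> carrier Q"
    and w_closed': "adm a b \<Longrightarrow> b \<in> L' \<Longrightarrow> w a b \<in> carrier Q"
    and rel_inv: "adm a b \<Longrightarrow> m a b \<otimes> m a (i b) = \<one>"
    and rel_comm: "adm a b \<Longrightarrow> adm c d \<Longrightarrow> b \<noteq> c \<Longrightarrow> b \<noteq> i c \<Longrightarrow> a \<noteq> d \<Longrightarrow> a \<noteq> i d \<Longrightarrow> a \<noteq> c
        \<Longrightarrow> commutator Q (m a b) (m c d) = \<one>"
    and rel_triangle: "adm b (i a) \<Longrightarrow> adm c (i b) \<Longrightarrow> adm c a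
        \<Longrightarrow> commutator Q (m b (i a)) (m c (i b)) = m c a"
    and rel_w: "adm a b \<Longrightarrow> b \<in> L' \<Longrightarrow> w a b = m (i b) (i a) \<otimes> m (i a) b \<otimes> m b a"
    and rel_w_i: "adm a b \<Longrightarrow> b \<in> L' \<Longrightarrow> w a b = w (i a) (i b)"
    and rel_w4: "adm a b \<Longrightarrow> b \<in> L' \<Longrightarrow> w a b [^] (4::nat) = \<one>"
begin

lemma m_inv: "adm a b \<Longrightarrow> inv (m a b) = m a (i b)"
  using rel_inv m_closed' adm_i by (metis inv_equality inv_inv inv_closed)

lemma m_comm:
  assumes "adm a b" "adm c d" "b \<noteq> c" "b \<noteq> i c" "a \<noteq> d" "a \<noteq> i d" "a \<noteq> c"
  shows "m a b \<otimes> m c d = m c d \<otimes> m a b"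
proof -
  have c: "m a b \<in> carrier Q" "m c d \<in> carrier Q" using assms m_closed' by auto
  have "m a b \<otimes> m c d \<otimes> inv (m a b) \<otimes> inv (m c d) = \<one>"
    using rel_comm[OF assms] by (simp add: commutator_def)
  then show ?thesis using c by (metis inv_closed inv_inv inv_equality inv_solve_right m_closed l_one)
qed

lemma cj_m_comm:
  assumes "adm a b" "adm c d" "b \<noteq> c" "b \<noteq> i c" "a \<noteq> d" "a \<noteq> i d" "a \<noteq> c"
  shows "cj (m a b) (m c d) = m c d"
  using m_comm[OF assms] assms(1,2) m_closed' by (simp add: cj_eq_iff)

lemma letter_classes:
  assumes "b \<in> L'" "a \<in> L" "c \<in> L'" "b \<noteq> a" "b \<noteq> i a" "c \<noteq> b" "c \<noteq> i b" "c \<noteq> a" "c \<noteq> i a"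
  shows "adm b a" "adm b (i a)" "adm c b" "adm c (i b)" "adm c a" "adm c (i a)"
    "adm (i b) a" "adm (i b) (i a)"
  using assms L'_sub by (auto simp: adm_def i_i i_L i_L' i_eq_iff i_inject)

text \<open>The triangle relation computes the conjugate of one of its two factors by the other. The conjugates of
  \<open>m c b\<close> by \<open>m b a\<close> and of \<open>m b a\<close> by the inverse of \<open>m c b\<close> are short products, whereas that of \<open>m b a\<close> by \<open>m c b\<close>
  itself is not; computations with \<open>w\<close> have to avoid it.\<close>

lemma cj_triangle:
  assumes "b \<in> L'" "a \<in> L" "c \<in> L'" "b \<noteq> a" "b \<noteq> i a" "c \<noteq> b" "c \<noteq> i b" "c \<noteq> a" "c \<noteq> i a"
  shows "cj (m b a) (m c (i b)) = m c (i a) \<otimes> m c (i b)"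
    and "cj (m b a) (m c b) = m c b \<otimes> m c a"
    and "cj (m c (i b)) (m b a) = m c a \<otimes> m b a"
    and "cj (m c b) (m (i b) a) = m c a \<otimes> m (i b) a"
proof -
  have gen: "cj (m b a) (m c (i b)) = m c (i a) \<otimes> m c (i b) \<and> cj (m c (i b)) (m b a) = m c a \<otimes> m b a"
    if h: "b \<in> L'" "a \<in> L" "c \<in> L'" "b \<noteq> a" "b \<noteq> i a" "c \<noteq> b" "c \<noteq> i b" "c \<noteq> a" "c \<noteq> i a" for b
  proof -
    note adms = letter_classes[OF h]
    have cl: "m b a \<in> carrier Q" "m c (i b) \<in> carrier Q" "m c (i a) \<in> carrier Q" "m c a \<in> carrier Q"
      using adms m_closed' by auto
    have iia: "i (i a) = a" using h i_i by simp
    have t: "m b a \<otimes> m c (i b) \<otimes> inv (m b a) \<otimes> inv (m c (i b)) = m c (i a)"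
      using rel_triangle[of b "i a" c] adms iia by (simp add: commutator_def)
    then have 1: "cj (m b a) (m c (i b)) = m c (i a) \<otimes> m c (i b)"
      using cl by (simp add: cj_def) (metis inv_closed inv_solve_right m_closed)
    moreover have "cj (m c (i b)) (m b a) = m c a \<otimes> m b a"
    proof -
      have "m b a \<otimes> m c (i b) = m c (i a) \<otimes> m c (i b) \<otimes> m b a"
        using 1 cl by (simp add: cj_eq_iff)
      moreover have "m c a = inv (m c (i a))" using m_inv[of c "i a"] adms iia by simp
      ultimately have "m c a \<otimes> m b a \<otimes> m c (i b) = m c (i b) \<otimes> m b a"
        using cl by (simp add: m_assoc inv_cancel_left)
      then show ?thesis using cl by (simp add: cj_eq_iff)
    qed
    ultimately show ?thesis by blast
  qed
  show "cj (m b a) (m c (i b)) = m c (i a) \<otimes> m c (i b)"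
    and "cj (m c (i b)) (m b a) = m c a \<otimes> m b a"
    using gen[OF assms] by auto
  note adms = letter_classes[OF assms]
  have bL: "b \<in> L" using assms L'_sub by auto
  have "inv (m c (i b)) = m c b" "inv (m c (i a)) = m c a"
    using m_inv[of c "i b"] m_inv[of c "i a"] adms i_i bL assms(2) by auto
  then show "cj (m b a) (m c b) = m c b \<otimes> m c a"
    using cj_inv[of "m b a" "m c (i b)"] gen[OF assms] adms m_closed' by (simp add: inv_mult_group)
  show "cj (m c b) (m (i b) a) = m c a \<otimes> m (i b) a"
    using gen[of "i b"] assms bL i_i i_L' by (auto simp: i_eq_iff i_inject i_L)
qed

text \<open>The defining relation for the inverted letters. This second expression for the same element is the
  one whose factors conjugate \<open>m a d\<close> conveniently in \<open>cj_w_source\<close>.\<close>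

lemma w_alt: "adm a b \<Longrightarrow> b \<in> L' \<Longrightarrow> w a b = m b a \<otimes> m a (i b) \<otimes> m (i b) (i a)"
proof -
  assume ab: "adm a b" "b \<in> L'"
  have "i (i a) = a" "i (i b) = b" using ab L'_sub by (auto simp: adm_def i_i)
  then show ?thesis using rel_w_i[OF ab] rel_w[of "i a" "i b"] ab by (simp add: adm_i i_L')
qed

lemma w_inv: "adm a b \<Longrightarrow> b \<in> L' \<Longrightarrow> inv (w a b) = w a (i b)"
proof -
  assume a: "adm a b" and b: "b \<in> L'"
  have l: "a \<in> L" "b \<in> L" "a \<in> L'" using a b L'_sub by (auto simp: adm_def)
  have adms: "adm (i b) (i a)" "adm (i a) b" "adm b a" "adm a (i b)" "adm (i a) (i b)"
    using a b by (auto simp: adm_i adm_sym)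
  have "inv (w a b) = inv (m b a) \<otimes> (inv (m (i a) b) \<otimes> inv (m (i b) (i a)))"
    using rel_w[OF a b] adms m_closed' by (simp add: inv_mult_group)
  also have "\<dots> = m b (i a) \<otimes> (m (i a) (i b) \<otimes> m (i b) a)"
    using adms l by (simp add: m_inv i_i)
  also have "\<dots> = w a (i b)"
    using rel_w[OF adms(4)] adms b l m_closed' by (simp add: i_L' i_i m_assoc adm_i)
  finally show ?thesis .
qed

text \<open>The letter \<open>c\<close> is not moved by \<open>sw a b\<close>, so that each of the three factors of \<open>w a b\<close> either commutes
  with the symbols in question or acts on them by the triangle relation.\<close>

lemma cj_w_target:
  assumes ab: "adm a b" "b \<in> L'" and c: "c \<in> L'" "c \<notin> {a, i a, b, i b}" and d: "adm c d"
  shows "cj (w a b) (m c d) = m c (sw a b d)"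
proof -
  have l: "a \<in> L" "b \<in> L" "a \<in> L'" "c \<in> L" using ab c L'_sub by (auto simp: adm_def)
  have adms: "adm (i b) (i a)" "adm (i a) b" "adm b a"
    using ab by (auto simp: adm_i adm_sym)
  have cad: "adm c a" "adm c b" "adm c (i a)" "adm c (i b)"
    using c l by (auto simp: adm_def i_L i_i)
  have mcl: "m (i b) (i a) \<in> carrier Q" "m (i a) b \<in> carrier Q" "m b a \<in> carrier Q"
     "m c a \<in> carrier Q" "m c b \<in> carrier Q" "m c (i a) \<in> carrier Q" "m c (i b) \<in> carrier Q" "m c d \<in> carrier Q"
    using adms cad d m_closed' by auto
  have wcl: "w a b \<in> carrier Q" using ab w_closed' by simp
  have cw: "cj (w a b) x = cj (m (i b) (i a)) (cj (m (i a) b) (cj (m b a) x))" if "x \<in> carrier Q" for x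
    using rel_w[OF ab] mcl that by (simp add: cj_comp)
  have neq: "b \<noteq> a" "b \<noteq> i a" "a \<noteq> b" "a \<noteq> i b" "i a \<noteq> i b" "i a \<noteq> b" "i b \<noteq> a" "i b \<noteq> i a"
    "c \<noteq> a" "c \<noteq> i a" "c \<noteq> b" "c \<noteq> i b" "a \<noteq> c" "i a \<noteq> c" "b \<noteq> c" "i b \<noteq> c"
    "a \<noteq> i c" "b \<noteq> i c" "i a \<noteq> i c" "i b \<noteq> i c"
    "i a \<noteq> a" "i b \<noteq> b" "a \<noteq> i a" "b \<noteq> i b" 
    using ab c l i_neq[of a] i_neq[of b] by (auto simp: adm_def i_eq_iff i_inject i_i)
  have ii: "i (i a) = a" "i (i b) = b" using l i_i by auto
  have f1: "cj (m b a) (m c a) = m c a" using adms cad neq ii by (intro cj_m_comm) auto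
  have f2: "cj (m (i a) b) (m c a) = m c (i b) \<otimes> m c a"
    using cj_triangle(1)[of "i a" b c] l ab c neq ii by (simp add: i_L')
  have f3: "cj (m (i b) (i a)) (m c a) = m c a" using adms cad neq ii by (intro cj_m_comm) auto
  have f4: "cj (m (i b) (i a)) (m c (i b)) = m c (i b) \<otimes> m c (i a)"
    using cj_triangle(2)[of "i b" "i a" c] l ab c neq ii by (simp add: i_L' i_L)
  have f5: "cj (m b a) (m c b) = m c b \<otimes> m c a"
    using cj_triangle(2)[of b a c] l ab c neq ii by simp
  have f6: "cj (m (i a) b) (m c b) = m c b" using adms cad neq ii by (intro cj_m_comm) auto
  have inva: "m c (i a) \<otimes> m c a = \<one>" using rel_inv[OF cad(3)] ii by simp
  have invb: "m c b \<otimes> m c (i b) = \<one>" using rel_inv[OF cad(2)] .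
  have Wa: "cj (w a b) (m c a) = m c (i b)"
    using f1 f2 f3 f4 inva mcl by (simp add: cw cj_mult m_assoc)
  have Wb: "cj (w a b) (m c b) = m c a"
  proof -
    have "cj (m (i a) b) (m c b \<otimes> m c a) = m c b \<otimes> m c (i b) \<otimes> m c a"
      using f6 f2 mcl by (simp add: cj_mult m_assoc)
    also have "\<dots> = m c a" using invb mcl by simp
    finally show ?thesis using f5 f3 mcl by (simp add: cw)
  qed
  have Wi: "cj (w a b) (m c (i x)) = m c (i y)" if "adm c x" "adm c y" "cj (w a b) (m c x) = m c y" for x y
    using cj_inv[OF wcl, of "m c x"] that m_closed' by (simp add: m_inv)
  consider "d = a" | "d = i a" | "d = b" | "d = i b" | "d \<notin> {a, i a, b, i b}" by blast
  then show ?thesis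
  proof cases
    case 2
    then show ?thesis using Wi[OF cad(1,4) Wa] ii ab by (simp add: sw_values)
  next
    case 4
    then show ?thesis using Wi[OF cad(2,1) Wb] ii ab by (simp add: sw_values)
  next
    case 5
    have dL: "d \<in> L" using d by (simp add: adm_def)
    have "cj (m b a) (m c d) = m c d" "cj (m (i a) b) (m c d) = m c d" "cj (m (i b) (i a)) (m c d) = m c d"
      using adms d 5 neq ii l dL by (auto intro!: cj_m_comm simp: i_i i_inject)
    then show ?thesis using 5 mcl by (simp add: cw sw_other)
  qed (use Wa Wb ab in \<open>auto simp: sw_values\<close>)
qed

text \<open>Here only the target \<open>d\<close> is not moved. It suffices to treat the source \<open>a\<close>: the source \<open>i a\<close> follows by inverting both
  letters of \<open>w\<close>, and the other two by conjugating back with the inverse \<open>w a (i b)\<close>.\<close>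

lemma cj_w_source:
  assumes ab: "adm a b" "b \<in> L'" and d: "d \<in> L" "d \<notin> {a, i a, b, i b}" and c: "c \<in> {a, i a, b, i b}"
  shows "cj (w a b) (m c d) = m (sw a b c) d"
proof -
  have A: "cj (w a b) (m a d) = m (i b) d"
    if ab: "adm a b" "b \<in> L'" and d: "d \<in> L" "d \<notin> {a, i a, b, i b}" for a b
  proof -
    have l: "a \<in> L" "b \<in> L" "a \<in> L'" using ab L'_sub by (auto simp: adm_def)
    have adms: "adm (i b) (i a)" "adm a (i b)" "adm b a" "adm a b"
      using ab by (auto simp: adm_i adm_sym)
    have ii: "i (i a) = a" "i (i b) = b" "i (i d) = d" using l d i_i by auto
    have neq: "b \<noteq> a" "b \<noteq> i a" "a \<noteq> b" "a \<noteq> i b" "i a \<noteq> i b" "i a \<noteq> b" "i b \<noteq> a" "i b \<noteq> i a"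
      "d \<noteq> a" "d \<noteq> i a" "d \<noteq> b" "d \<noteq> i b" "a \<noteq> d" "i a \<noteq> d" "b \<noteq> d" "i b \<noteq> d"
      "a \<noteq> i d" "b \<noteq> i d" "i a \<noteq> i d" "i b \<noteq> i d"
      "i a \<noteq> a" "i b \<noteq> b" "a \<noteq> i a" "b \<noteq> i b" 
      using ab d l i_neq[of a] i_neq[of b] by (auto simp: adm_def i_eq_iff i_inject i_i)
    have dad: "adm a d" "adm (i b) d" using l ab neq ii d by (auto simp: adm_def i_L')
    have mcl: "m (i b) (i a) \<in> carrier Q" "m a (i b) \<in> carrier Q" "m a b \<in> carrier Q" "m b a \<in> carrier Q"
       "m a d \<in> carrier Q" "m (i b) d \<in> carrier Q"
      using adms dad m_closed' by auto
    have cw: "cj (w a b) x = cj (m b a) (cj (m a (i b)) (cj (m (i b) (i a)) x))" if "x \<in> carrier Q" for x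
      using w_alt[OF ab] mcl that by (simp add: cj_comp)
    have "cj (m (i b) (i a)) (m a d) = m (i b) d \<otimes> m a d"
      using cj_triangle(3)[of a d "i b"] l ab d neq ii by (simp add: i_L')
    also have "\<dots> = m a d \<otimes> m (i b) d"
      using dad neq ii by (intro m_comm) auto
    also have "\<dots> = cj (m a b) (m (i b) d)"
      using cj_triangle(4)[of b d a] l ab d neq ii by simp
    finally have "cj (m a (i b)) (cj (m (i b) (i a)) (m a d)) = cj (m a (i b)) (cj (m a b) (m (i b) d))" by simp
    also have "\<dots> = m (i b) d"
    proof -
      have "m a (i b) = inv (m a b)" using m_inv[OF adms(4)] by simp
      then show ?thesis using cj_inv_eq[of "m a b" "m (i b) d"] mcl by simp
    qed
    finally show ?thesis
      using mcl adms dad neq ii by (simp add: cw) (intro cj_m_comm, auto)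
  qed
  have l: "a \<in> L" "b \<in> L" "a \<in> L'" using ab L'_sub by (auto simp: adm_def)
  have ii: "i (i a) = a" "i (i b) = b" using l i_i by auto
  have B: "cj (w a b) (m (i a) d) = m b d"
    if ab: "adm a b" "b \<in> L'" and d: "d \<in> L" "d \<notin> {a, i a, b, i b}" for a b
  proof -
    have "i (i a) = a" "i (i b) = b" using ab L'_sub by (auto simp: adm_def i_i)
    then show ?thesis using A[of "i a" "i b"] that rel_w_i[OF ab] by (auto simp: adm_i i_L')
  qed
  have inv_w: "inv (w a (i b)) = w a b" using w_inv[of a "i b"] ab ii by (simp add: adm_i i_L')
  have d': "d \<notin> {a, i a, i b, i (i b)}" using d ii by auto
  have da: "adm a d" "adm (i a) d" using d l i_i by (auto simp: adm_def i_L' i_eq_iff i_inject)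
  have wcl: "w a (i b) \<in> carrier Q" using ab by (simp add: adm_i i_L' w_closed')
  have Cb: "cj (w a b) (m b d) = m a d"
    using cj_inv_eq[OF wcl _ A[of a "i b"]] ab d d' ii inv_w da m_closed' by (simp add: adm_i i_L')
  have D: "cj (w a b) (m (i b) d) = m (i a) d"
    using cj_inv_eq[OF wcl _ B[of a "i b"]] ab d d' ii inv_w da m_closed' by (simp add: adm_i i_L')
  show ?thesis using c A[OF ab d] B[OF ab d] Cb D ab by (auto simp: sw_values)
qed

lemma commutator_m:
  assumes "e \<in> L'" "adm c d" "e \<notin> {c, i c, d, i d}"
  shows "m c d = commutator Q (m e (i d)) (m c (i e))"
proof -
  have l: "c \<in> L" "d \<in> L" "e \<in> L" using assms L'_sub by (auto simp: adm_def)
  show ?thesis using assms l by (intro rel_triangle[symmetric]) (auto simp: adm_def i_i i_L i_eq_iff i_inject)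
qed

lemma cj_commutator:
  "g \<in> carrier Q \<Longrightarrow> x \<in> carrier Q \<Longrightarrow> y \<in> carrier Q \<Longrightarrow>
    cj g (commutator Q x y) = commutator Q (cj g x) (cj g y)"
  by (simp add: commutator_def cj_mult cj_inv)

text \<open>If both letters of the symbol are moved, a third letter \<open>e\<close> is used to write \<open>m c d\<close> as a commutator of two
  symbols to which \<open>cj_w_target\<close> and \<open>cj_w_source\<close> apply.\<close>

theorem cj_w_m:
  assumes ab: "adm a b" "b \<in> L'" and cd: "adm c d"
  shows "cj (w a b) (m c d) = m (sw a b c) (sw a b d)"
proof -
  have l: "a \<in> L" "b \<in> L" "a \<in> L'" using ab L'_sub by (auto simp: adm_def)
  have lcd: "c \<in> L'" "d \<in> L" "c \<in> L" using cd L'_sub by (auto simp: adm_def)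
  consider "c \<notin> {a, i a, b, i b}" | "c \<in> {a, i a, b, i b}" "d \<notin> {a, i a, b, i b}"
    | "c \<in> {a, i a, b, i b}" "d \<in> {a, i a, b, i b}" by blast
  then show ?thesis
  proof cases
    case 1
    then show ?thesis using cj_w_target[OF ab lcd(1) 1 cd] by (simp add: sw_other)
  next
    case 2
    then show ?thesis using cj_w_source[OF ab lcd(2) 2(2,1)] by (simp add: sw_other)
  next
    case 3
    obtain e where e: "e \<in> L'" "e \<notin> {a, i a, b, i b}" using third l(3) ab(2) by blast
    have eL: "e \<in> L" using e L'_sub by auto
    have e': "e \<notin> {c, i c, d, i d}" using 3 e l lcd eL by (auto simp: i_i)
    have ei: "i e \<notin> {a, i a, b, i b}" using e eL l by (auto simp: i_eq_iff i_inject)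
    have ad: "adm e (i d)" "adm c (i e)"
      using e e' lcd eL by (auto simp: adm_def i_L i_i i_eq_iff i_inject)
    have s: "sw a b e = e" using e by (simp add: sw_other)
    have se: "e \<notin> {sw a b c, i (sw a b c), sw a b d, i (sw a b d)}"
      using e' s sw_inject[OF ab eL] lcd sw_i[OF ab] by (metis empty_iff i_L insert_iff)
    have 1: "cj (w a b) (m e (i d)) = m e (i (sw a b d))"
      using cj_w_target[OF ab e ad(1)] sw_i[OF ab lcd(2)] by simp
    have 2: "cj (w a b) (m c (i e)) = m (sw a b c) (i e)"
      using cj_w_source[OF ab i_L[OF eL] ei 3(1)] .
    have "cj (w a b) (m c d) = commutator Q (cj (w a b) (m e (i d))) (cj (w a b) (m c (i e)))"
      using commutator_m[OF e(1) cd e'] cj_commutator ad ab m_closed' w_closed' by simp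
    also have "\<dots> = m (sw a b c) (sw a b d)"
      using commutator_m[OF e(1) adm_sw[OF ab cd] se] 1 2 by simp
    finally show ?thesis .
  qed
qed

theorem cj_w_w:
  assumes ab: "adm a b" "b \<in> L'" and cd: "adm c d" "d \<in> L'"
  shows "cj (w a b) (w c d) = w (sw a b c) (sw a b d)"
proof -
  have lcd: "d \<in> L" "c \<in> L" using cd L'_sub by (auto simp: adm_def)
  have adms: "adm (i d) (i c)" "adm (i c) d" "adm d c" using cd by (auto simp: adm_i adm_sym)
  show ?thesis
    using adms lcd cd rel_w[OF cd] rel_w[OF adm_sw[OF ab cd(1)] sw_L'[OF ab cd(2)]]
    by (simp add: cj_mult w_closed'[OF ab] m_closed' cj_w_m[OF ab] sw_i[OF ab])
qed

section \<open>The relations used to join two paths\<close>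

text \<open>In peak reduction these relations close up the paths between two moves. Here \<open>a\<close> is moved along \<open>c\<close> before or after \<open>c\<close> is
  moved along \<open>d\<close>.\<close>

lemma join_path:
  assumes "a \<in> L'" "c \<in> L'" "d \<in> L" "c \<noteq> d" "c \<noteq> i d" "a \<noteq> c" "a \<noteq> i c" "a \<noteq> d" "a \<noteq> i d"
  shows "m a c \<otimes> m c d = m c d \<otimes> m a c \<otimes> m a (i d)"
    and "m a (i c) \<otimes> m c d = m c d \<otimes> m a d \<otimes> m a (i c)"
proof -
  note adms = letter_classes[of c d a, OF assms(2,3,1,4-9)]
  have l: "d \<in> L" "a \<in> L" "c \<in> L" using assms L'_sub by auto
  have mcl: "m a c \<in> carrier Q" "m c d \<in> carrier Q" "m a d \<in> carrier Q" "m a (i d) \<in> carrier Q" "m a (i c) \<in> carrier Q"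
    using adms m_closed' by auto
  have comm: "m c d \<otimes> m a d = m a d \<otimes> m c d"
    using adms assms l i_i[OF l(1)] i_i[OF l(2)] i_i[OF l(3)] by (intro m_comm) (auto simp: i_eq_iff i_inject)
  have mid: "m a (i d) = inv (m a d)" using m_inv adms by simp
  have e1: "m c d \<otimes> m a c = m a c \<otimes> m a d \<otimes> m c d"
    using cj_triangle(2)[of c d a, OF assms(2,3,1,4-9)] mcl by (simp add: cj_eq_iff)
  have "m c d \<otimes> m a c \<otimes> m a (i d) = m a c \<otimes> (m a d \<otimes> m c d) \<otimes> m a (i d)"
    using e1 mcl by (simp add: m_assoc)
  also have "\<dots> = m a c \<otimes> m c d" using comm[symmetric] mid mcl by (simp add: m_assoc)
  finally show "m a c \<otimes> m c d = m c d \<otimes> m a c \<otimes> m a (i d)" by simp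
  have e2: "m c d \<otimes> m a (i c) = m a (i d) \<otimes> m a (i c) \<otimes> m c d"
    using cj_triangle(1)[of c d a, OF assms(2,3,1,4-9)] mcl by (simp add: cj_eq_iff)
  have "m c d \<otimes> m a d \<otimes> m a (i c) = m a d \<otimes> (m c d \<otimes> m a (i c))"
    using comm mcl by (simp add: m_assoc)
  also have "\<dots> = m a (i c) \<otimes> m c d" using e2 mid mcl by (simp add: m_assoc inv_cancel_left)
  finally show "m a (i c) \<otimes> m c d = m c d \<otimes> m a d \<otimes> m a (i c)" by simp
qed

lemma join_star:
  assumes "a \<in> L'" "d \<in> L'" "b \<in> L" "d \<noteq> b" "d \<noteq> i b" "a \<noteq> d" "a \<noteq> i d" "a \<noteq> b" "a \<noteq> i b"
  shows "m a b \<otimes> m (i d) b \<otimes> m a d \<otimes> m (i d) (i b) = m a d"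
proof -
  have l: "d \<in> L" "a \<in> L" "b \<in> L" using assms L'_sub by auto
  note adms = letter_classes[of d b a, OF assms(2,3,1,4-9)]
  have mcl: "m a b \<in> carrier Q" "m (i d) b \<in> carrier Q" "m a d \<in> carrier Q" "m (i d) (i b) \<in> carrier Q" "m a (i b) \<in> carrier Q"
    using adms m_closed' by auto
  have "cj (m (i d) b) (m a d) = m a (i b) \<otimes> m a d"
    using cj_triangle(1)[of "i d" b a] assms l by (simp add: i_L' i_i i_eq_iff i_inject)
  then have "m (i d) b \<otimes> m a d = m a (i b) \<otimes> m a d \<otimes> m (i d) b"
    using mcl by (simp add: cj_eq_iff)
  then have "m a b \<otimes> (m (i d) b \<otimes> m a d) \<otimes> m (i d) (i b) = m a b \<otimes> (m a (i b) \<otimes> (m a d \<otimes> (m (i d) b \<otimes> m (i d) (i b))))"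
    using mcl by (simp add: m_assoc)
  also have "\<dots> = m a d"
    using rel_inv[OF adms(5)] rel_inv[of "i d" b] adms mcl by (simp add: m_assoc[symmetric])
  finally show ?thesis using mcl by (simp add: m_assoc)
qed

text \<open>Both sides replace \<open>a\<close> and \<open>b\<close> by the inverse of \<open>b\<close> and the product of \<open>b\<close> and \<open>a\<close>: on the left with one move,
  up to a signed permutation, and on the right with two.\<close>

lemma join_swap:
  assumes "adm a b" "b \<in> L'"
  shows "m a b \<otimes> w a b = m (i b) (i a) \<otimes> m (i a) b"
proof -
  have l: "a \<in> L" "b \<in> L" "a \<in> L'" using assms L'_sub by (auto simp: adm_def)
  have ii: "i (i a) = a" "i (i b) = b" using l i_i by auto
  have adms: "adm (i b) (i a)" "adm (i a) b" "adm b a" "adm b (i a)" "adm a (i b)"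
    using assms by (auto simp: adm_i adm_sym)
  have mcl: "m (i b) (i a) \<in> carrier Q" "m (i a) b \<in> carrier Q" "m b a \<in> carrier Q" "m b (i a) \<in> carrier Q" "m a b \<in> carrier Q"
    using adms assms m_closed' by auto
  have wcl: "w a b \<in> carrier Q" using assms w_closed' by simp
  have "sw a b b = a" "sw a b (i a) = b" using assms by (auto simp: sw_values)
  then have "cj (w a b) (m b (i a)) = m a b" using cj_w_m[OF assms adms(4)] by simp
  then have "m a b \<otimes> w a b = w a b \<otimes> m b (i a)" using mcl wcl by (simp add: cj_eq_iff)
  also have "\<dots> = m (i b) (i a) \<otimes> (m (i a) b \<otimes> (m b a \<otimes> m b (i a)))"
    using rel_w[OF assms] mcl by (simp add: m_assoc)
  also have "\<dots> = m (i b) (i a) \<otimes> m (i a) b" using rel_inv[OF adms(3)] mcl by simp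
  finally show ?thesis .
qed

end

section \<open>The subgroup of signed permutations\<close>

context gersten
begin

text \<open>Multiplication by generators from one side suffices for a subgroup, because the inverse of a generator
  is again a generator.\<close>

inductive_set wgroup :: "'a set \<Rightarrow> 'q set" for K where
  wgroup_one: "\<one> \<in> wgroup K"
| wgroup_step: "a \<in> K \<Longrightarrow> b \<in> K \<Longrightarrow> adm a b \<Longrightarrow> h \<in> wgroup K \<Longrightarrow> w a b \<otimes> h \<in> wgroup K"

lemma wgroup_closed:
  assumes "K \<subseteq> L'" "h \<in> wgroup K"
  shows "h \<in> carrier Q"
  using assms(2,1) by (induction rule: wgroup.induct) (auto simp: w_closed' subsetD)

lemma wgroup_w: "K \<subseteq> L' \<Longrightarrow> a \<in> K \<Longrightarrow> b \<in> K \<Longrightarrow> adm a b \<Longrightarrow> w a b \<in> wgroup K"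
  using wgroup_step[OF _ _ _ wgroup_one, of a K b] w_closed' by (auto simp: subsetD)

lemma wgroup_mult:
  assumes "K \<subseteq> L'" "h \<in> wgroup K" "k \<in> wgroup K"
  shows "h \<otimes> k \<in> wgroup K"
  using assms(2)
proof (induction rule: wgroup.induct)
  case wgroup_one
  then show ?case using assms wgroup_closed by simp
next
  case (wgroup_step a b h)
  have "w a b \<otimes> h \<otimes> k = w a b \<otimes> (h \<otimes> k)"
    using wgroup_step assms wgroup_closed[OF assms(1)] w_closed' by (intro m_assoc) auto
  then show ?case using wgroup_step by (simp add: wgroup.wgroup_step)
qed

lemma wgroup_inv:
  assumes "K \<subseteq> L'" "\<And>a. a \<in> K \<Longrightarrow> i a \<in> K" "h \<in> wgroup K"
  shows "inv h \<in> wgroup K"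
  using assms(3)
proof (induction rule: wgroup.induct)
  case wgroup_one
  then show ?case by (simp add: wgroup.wgroup_one)
next
  case (wgroup_step a b h)
  have b: "b \<in> L'" using wgroup_step assms by auto
  have "inv (w a b \<otimes> h) = inv h \<otimes> w a (i b)"
    using wgroup_step b wgroup_closed[OF assms(1)] w_closed' by (simp add: inv_mult_group w_inv)
  then show ?case
    using wgroup_step assms b by (simp add: wgroup_mult wgroup_w adm_i)
qed

lemma w_turn: "adm a b \<Longrightarrow> b \<in> L' \<Longrightarrow> w a b = w (i b) a"
proof -
  assume a: "adm a b" "b \<in> L'"
  have "a \<in> L'" using a by (simp add: adm_def)
  then have "cj (w a b) (w a b) = w (i b) a" using cj_w_w[OF a a] a by (simp add: sw_values)
  moreover have "cj (w a b) (w a b) = w a b" using w_closed'[OF a] by (simp add: cj_eq_iff)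
  ultimately show ?thesis by simp
qed

lemma w_square:
  assumes "adm a b" "b \<in> L'"
  shows "w a (i b) \<otimes> w a (i b) = w a b \<otimes> w a b" "w a b \<otimes> (w a b \<otimes> w a b) = w a (i b)"
proof -
  have c: "w a b \<in> carrier Q" using w_closed'[OF assms] .
  have "w a b \<otimes> w a b \<otimes> (w a b \<otimes> w a b) = \<one>"
    using rel_w4[OF assms] c by (simp add: numeral_eq_Suc m_assoc)
  then have 1: "w a b \<otimes> w a b = inv (w a b \<otimes> w a b)" using c by (simp add: inv_equality)
  then show "w a (i b) \<otimes> w a (i b) = w a b \<otimes> w a b" using c w_inv[OF assms] by (simp add: inv_mult_group)
  then have "w a b \<otimes> (w a b \<otimes> w a b) = w a b \<otimes> (w a (i b) \<otimes> w a (i b))" by simp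
  also have "\<dots> = w a (i b)" using c w_inv[OF assms, symmetric] by (simp add: inv_cancel_left)
  finally show "w a b \<otimes> (w a b \<otimes> w a b) = w a (i b)" .
qed

end

text \<open>One step in a chain of point stabilisers. The letters in \<open>K\<close> are extended by a new letter \<open>e\<close> and its inverse, and
  the elements \<open>T y\<close> represent the cosets of \<open>wgroup K\<close>: they send \<open>e\<close> to \<open>y\<close>. The letter \<open>x\<close> serves only
  to choose an element that inverts \<open>e\<close>.\<close>

locale gersten_extension = gersten L L' i Q m w
  for L L' :: "'a set" and i and Q :: "('q, 'm) monoid_scheme" (structure) and m w +
  fixes K :: "'a set" and e x :: 'a
  assumes K_sub: "K \<subseteq> L'" and K_i: "a \<in> K \<Longrightarrow> i a \<in> K" and e_L': "e \<in> L'" and e_K: "e \<notin> K" and x_K: "x \<in> K"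
begin

lemma KL: "a \<in> K \<Longrightarrow> a \<in> L'" "a \<in> K \<Longrightarrow> a \<in> L" "e \<in> L"
  using K_sub L'_sub e_L' by auto

lemma e_neq: "a \<in> K \<Longrightarrow> a \<noteq> e" "a \<in> K \<Longrightarrow> a \<noteq> i e" "a \<in> K \<Longrightarrow> i a \<noteq> e" "i e \<notin> K" "i e \<noteq> e"
  using e_K K_i[of "i e"] K_i[of a] i_i[of e] i_i[of a] KL i_neq by auto

lemma adm_e: "a \<in> K \<Longrightarrow> adm e a" "a \<in> K \<Longrightarrow> adm a e"
  using e_neq KL e_L' i_i by (auto simp: adm_def)

definition T :: "'a \<Rightarrow> 'q" where
  "T y = (if y = e then \<one> else if y = i e then w e x \<otimes> w e x else w e (i y))"

lemma w_e_closed: "a \<in> K \<Longrightarrow> w e a \<in> carrier Q"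
  using w_closed' adm_e KL by blast

lemma T_closed: "y \<in> insert e (insert (i e) K) \<Longrightarrow> T y \<in> carrier Q"
  using w_e_closed K_i x_K by (auto simp: T_def)

text \<open>The square of \<open>w e z\<close> inverts \<open>e\<close> and \<open>z\<close>, so the quotient of two such squares should invert two letters of \<open>K\<close>. It does:
  conjugation by \<open>w x z\<close> turns \<open>w e x\<close> into the inverse of \<open>w e z\<close>, conjugation by the square of \<open>w e x\<close> inverts
  \<open>w x z\<close>, and fourth powers are trivial.\<close>

lemma w_e_square:
  assumes "z \<in> K"
  shows "\<exists>k\<in>wgroup K. w e z \<otimes> w e z = w e x \<otimes> w e x \<otimes> k"
proof -
  have c: "w e x \<in> carrier Q" "w e z \<in> carrier Q" using w_e_closed assms x_K by auto
  consider "z = x" | "z = i x" | "z \<noteq> x" "z \<noteq> i x" by blast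
  then show ?thesis
  proof cases
    case 1
    then show ?thesis using c by (intro bexI[of _ \<one>] wgroup_one) simp
  next
    case 2
    then show ?thesis using c w_square(1)[of e x] adm_e KL x_K by (intro bexI[of _ \<one>] wgroup_one) simp
  next
    case 3
    let ?u = "w x z" and ?s = "w e x \<otimes> w e x"
    have xz: "adm x z" "z \<in> L'" "x \<in> L'" using 3 assms x_K KL i_i[of z] by (auto simp: adm_def)
    have u: "?u \<in> carrier Q" using xz w_closed' by blast
    have ez: "z \<notin> {e, i e, x, i x}" "e \<notin> {x, i x, z, i z}"
      using 3 assms x_K e_neq(1,2,3)[of x] e_neq(1,2,3)[of z] KL i_i by auto
    have 1: "cj ?u (w e x) = w e (i z)"
      using cj_w_w[OF xz(1,2) adm_e(1)[OF x_K] xz(3)] ez xz by (simp add: sw_other sw_values)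
    have "cj ?u ?s = w e (i z) \<otimes> w e (i z)" using 1 u c by (simp add: cj_mult)
    also have "\<dots> = w e z \<otimes> w e z" using w_square(1)[of e z] adm_e assms xz by simp
    finally have A: "cj ?u ?s = w e z \<otimes> w e z" .
    have 2: "cj (w e x) ?u = w e z"
      using cj_w_w[OF adm_e(1)[OF x_K] xz(3,1,2)] ez adm_e(1)[OF x_K] xz by (simp add: sw_other sw_values)
    have "cj (w e x) (w e z) = w (i x) z"
      using cj_w_w[OF adm_e(1)[OF x_K] xz(3) adm_e(1)[OF assms] xz(2)] ez adm_e(1)[OF x_K] xz
      by (simp add: sw_other sw_values)
    moreover have "w (i x) z = inv ?u"
      using rel_w_i[of x "i z"] w_inv[OF xz(1,2)] xz adm_i KL assms by (simp add: i_i i_L')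
    ultimately have "cj ?s ?u = inv ?u" using 2 c u by (simp add: cj_comp)
    then have "cj ?s (inv ?u) = ?u" using c u by (simp add: cj_inv)
    then have "?s \<otimes> inv ?u = ?u \<otimes> ?s" using c u cj_eq_iff[of ?s "inv ?u" ?u] by simp
    then have "cj ?u ?s = ?s \<otimes> inv ?u \<otimes> inv ?u" by (simp add: cj_def)
    then have "w e z \<otimes> w e z = ?s \<otimes> (inv ?u \<otimes> inv ?u)" using A c u by (simp add: m_assoc)
    moreover have "inv ?u \<otimes> inv ?u \<in> wgroup K"
      using wgroup_w[OF K_sub x_K assms xz(1)] K_i K_sub by (intro wgroup_mult wgroup_inv) auto
    ultimately show ?thesis by blast
  qed
qed

lemma inner_coset:
  assumes "a \<in> K" "b \<in> K" "adm a b" "y \<in> insert e (insert (i e) K)"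
  shows "\<exists>k\<in>wgroup K. w a b \<otimes> T y = T (sw a b y) \<otimes> k"
proof -
  have b: "b \<in> L'" using assms KL by auto
  have W: "w a b \<in> wgroup K" "w a b \<in> carrier Q" using assms wgroup_w[OF K_sub] w_closed' b by auto
  have ab_e: "e \<notin> {a, i a, b, i b}" "i e \<notin> {a, i a, b, i b}"
    using assms e_neq KL K_i[of a] K_i[of b] by auto
  have se: "sw a b e = e" "sw a b (i e) = i e" using ab_e by (simp_all add: sw_other)
  have swK: "sw a b z \<in> K" if "z \<in> K" for z
    using that assms K_i by (simp add: sw_def)
  consider "y = e" | "y = i e" | "y \<in> K" using assms by blast
  then show ?thesis
  proof cases
    case 1
    then show ?thesis using W se by (intro bexI[of _ "w a b"]) (simp_all add: T_def)
  next
    case 2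
    have c: "w e x \<in> carrier Q" using w_e_closed x_K by auto
    have "cj (w a b) (w e x) = w e (sw a b x)"
      using cj_w_w[OF assms(3) b adm_e(1)[OF x_K]] se x_K KL by simp
    moreover obtain k where k: "k \<in> wgroup K" "w e (sw a b x) \<otimes> w e (sw a b x) = w e x \<otimes> w e x \<otimes> k"
      using w_e_square[OF swK[OF x_K]] by blast
    ultimately have "cj (w a b) (w e x \<otimes> w e x) = w e x \<otimes> w e x \<otimes> k"
      using W c by (simp add: cj_mult)
    moreover have kc: "k \<in> carrier Q" using k wgroup_closed K_sub by blast
    ultimately have "w a b \<otimes> (w e x \<otimes> w e x) = w e x \<otimes> w e x \<otimes> (k \<otimes> w a b)"
      using W c by (simp add: cj_eq_iff m_assoc)
    then show ?thesis using 2 se e_neq W k wgroup_mult[OF K_sub k(1) W(1)]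
      by (intro bexI[of _ "k \<otimes> w a b"]) (simp_all add: T_def)
  next
    case 3
    have c: "w e (i y) \<in> carrier Q" "w e (i (sw a b y)) \<in> carrier Q" using w_e_closed K_i swK 3 by auto
    have "cj (w a b) (w e (i y)) = w e (i (sw a b y))"
      using cj_w_w[OF assms(3) b adm_e(1)[OF K_i[OF 3]]] se 3 KL K_i sw_i[OF assms(3) b] by simp
    then have "w a b \<otimes> w e (i y) = w e (i (sw a b y)) \<otimes> w a b" using W c by (simp add: cj_eq_iff)
    moreover have "T y = w e (i y)" "T (sw a b y) = w e (i (sw a b y))"
      using 3 swK[OF 3] e_neq by (auto simp: T_def)
    ultimately show ?thesis using W by (intro bexI[of _ "w a b"]) simp_all
  qed
qed

text \<open>The product of \<open>w e b\<close> and \<open>T y\<close> sends \<open>e\<close> to \<open>sw e b y\<close>. If \<open>y\<close> is unrelated to \<open>e\<close> and \<open>b\<close>, passing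
  \<open>T y\<close> to the left conjugates \<open>w e b\<close> into \<open>wgroup K\<close>; otherwise the product is a power of \<open>w e b\<close>, up to \<open>w_e_square\<close>.\<close>

lemma outer_coset:
  assumes "b \<in> K" "y \<in> insert e (insert (i e) K)"
  shows "\<exists>k\<in>wgroup K. w e b \<otimes> T y = T (sw e b y) \<otimes> k"
proof -
  have b: "b \<in> L'" "b \<in> L" using assms KL by auto
  have eb: "adm e b" using adm_e assms by simp
  have W: "w e b \<in> carrier Q" using w_e_closed assms by auto
  have ib: "i b \<in> K" "i (i b) = b" "i (i e) = e" using assms K_i b i_i KL by auto
  have neq: "b \<noteq> e" "b \<noteq> i e" "i b \<noteq> e" "i b \<noteq> i e" "i b \<noteq> b" "i e \<noteq> e"
    using e_neq assms(1) ib(1) i_neq b by auto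
  obtain k where k: "k \<in> wgroup K" "w e b \<otimes> w e b = w e x \<otimes> w e x \<otimes> k"
    using w_e_square[OF assms(1)] by blast
  have kc: "k \<in> carrier Q" using k wgroup_closed K_sub by blast
  have xc: "w e x \<in> carrier Q" using w_e_closed x_K by auto
  consider "y = e" | "y = i e" | "y = b" | "y = i b" | "y \<in> K" "y \<noteq> b" "y \<noteq> i b" using assms by blast
  then show ?thesis
  proof cases
    case 1
    then show ?thesis using W eb b neq ib by (intro bexI[of _ \<one>] wgroup_one) (simp add: T_def sw_values)
  next
    case 2
    have "w e x \<otimes> w e x = w e b \<otimes> w e b \<otimes> inv k" using k kc xc W by (simp add: m_assoc)
    then have "w e b \<otimes> (w e x \<otimes> w e x) = w e b \<otimes> (w e b \<otimes> w e b) \<otimes> inv k"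
      using W kc by (simp add: m_assoc)
    then have "w e b \<otimes> (w e x \<otimes> w e x) = w e (i b) \<otimes> inv k"
      using w_square(2)[OF eb b(1)] by simp
    then show ?thesis using 2 eb b neq wgroup_inv[OF K_sub K_i k(1)]
      by (intro bexI[of _ "inv k"]) (simp_all add: T_def sw_values)
  next
    case 3
    have "w e b \<otimes> w e (i b) = \<one>" using w_inv[OF eb b(1)] W by (metis r_inv)
    then show ?thesis using 3 neq eb b by (intro bexI[of _ \<one>] wgroup_one) (simp add: T_def sw_values)
  next
    case 4
    then show ?thesis using k neq ib eb b by (intro bexI[of _ k]) (simp_all add: T_def sw_values)
  next
    case 5
    have yL: "y \<in> L'" "y \<in> L" "i y \<in> K" "i y \<in> L'" using 5 KL K_i by auto
    have ey: "adm e y" "adm e (i y)" using adm_e 5 K_i by auto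
    have c: "w e y \<in> carrier Q" "w e (i y) \<in> carrier Q" using w_e_closed 5 K_i by auto
    have be: "b \<notin> {e, i e, y, i y}" "y \<notin> {e, i e, b, i b}" using neq 5 e_neq ib(2) yL i_i by auto
    have "cj (w e y) (w e b) = w (i y) b"
      using cj_w_w[OF ey(1) yL(1) eb b(1)] ey yL be by (simp add: sw_other sw_values)
    moreover have "w e y = inv (w e (i y))" using w_inv[OF ey(1) yL(1)] c by (metis inv_inv)
    ultimately have "inv (w e (i y)) \<otimes> w e b \<otimes> w e (i y) = w (i y) b" using c by (simp add: cj_def)
    moreover have "w e b \<otimes> w e (i y) = w e (i y) \<otimes> (inv (w e (i y)) \<otimes> w e b \<otimes> w e (i y))"
      using c W by (simp add: m_assoc inv_cancel_left)
    ultimately have "w e b \<otimes> w e (i y) = w e (i y) \<otimes> w (i y) b" by simp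
    moreover have "w (i y) b \<in> wgroup K"
      using yL assms be b 5 by (intro wgroup_w[OF K_sub]) (auto simp: adm_def i_inject)
    ultimately show ?thesis using 5 e_neq be by (intro bexI[of _ "w (i y) b"]) (auto simp: T_def sw_other)
  qed
qed

text \<open>Up to the relations, a generator that involves \<open>e\<close> has the form \<open>w e b\<close> with \<open>b\<close> in \<open>K\<close>.\<close>

lemma coset_step:
  assumes ab: "a \<in> insert e (insert (i e) K)" "b \<in> insert e (insert (i e) K)" "adm a b"
    and y: "y \<in> insert e (insert (i e) K)"
  shows "\<exists>y'\<in>insert e (insert (i e) K). \<exists>k\<in>wgroup K. w a b \<otimes> T y = T y' \<otimes> k"
proof -
  have closed: "sw a b y \<in> insert e (insert (i e) K)"
    if "a \<in> insert e (insert (i e) K)" "b \<in> insert e (insert (i e) K)" for a b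
    using that y K_i i_i[OF KL(3)] by (auto simp: sw_def)
  have ie: "i (i e) = e" using i_i KL by auto
  have outer: ?thesis if "w a b = w e b0" "b0 \<in> K" for b0
    using outer_coset[OF that(2) y] closed[of e b0] that by auto
  have aL: "a \<in> L'" "b \<in> L" "b \<in> L'" using ab KL e_L' i_L' by (auto simp: adm_def)
  consider "a \<in> K" "b \<in> K" | "a = e" "b \<in> K" | "a = i e" "b \<in> K" | "a \<in> K" "b = e" | "a \<in> K" "b = i e"
    using ab ie by (auto simp: adm_def)
  then show ?thesis
  proof cases
    case 1
    then show ?thesis using inner_coset[OF 1 ab(3) y] closed[OF ab(1,2)] by blast
  next
    case 2
    then show ?thesis using outer by simp
  next
    case 3
    then show ?thesis using outer[of "i b"] rel_w_i[OF ab(3) aL(3)] ie K_i by simp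
  next
    case 4
    have "w a b = w (i e) a" using w_turn[OF ab(3) aL(3)] 4 by simp
    also have "\<dots> = w e (i a)" using rel_w_i[of "i e" a] ie 4 adm_e KL by (simp add: adm_i)
    finally show ?thesis using outer[of "i a"] 4 K_i by simp
  next
    case 5
    then show ?thesis using outer[of a] w_turn[OF ab(3) aL(3)] ie by simp
  qed
qed

lemma coset_decomposition:
  assumes "h \<in> wgroup (insert e (insert (i e) K))"
  shows "\<exists>y\<in>insert e (insert (i e) K). \<exists>k\<in>wgroup K. h = T y \<otimes> k"
  using assms
proof (induction rule: wgroup.induct)
  case wgroup_one
  then show ?case by (intro bexI[of _ e] bexI[of _ \<one>]) (auto simp: T_def wgroup.wgroup_one)
next
  case (wgroup_step a b h)
  then obtain y k where y: "y \<in> insert e (insert (i e) K)" "k \<in> wgroup K" "h = T y \<otimes> k" by blast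
  obtain y' k' where y': "y' \<in> insert e (insert (i e) K)" "k' \<in> wgroup K" "w a b \<otimes> T y = T y' \<otimes> k'"
    using coset_step[OF wgroup_step.hyps(1-3) y(1)] by blast
  have "b \<in> L'" using wgroup_step KL e_L' i_L' by auto
  then have c: "w a b \<in> carrier Q" "T y \<in> carrier Q" "T y' \<in> carrier Q" "k \<in> carrier Q" "k' \<in> carrier Q"
    using wgroup_step w_closed' T_closed y y' wgroup_closed[OF K_sub] by auto
  then have "w a b \<otimes> h = (w a b \<otimes> T y) \<otimes> k" using y by (simp add: m_assoc)
  also have "\<dots> = T y' \<otimes> (k' \<otimes> k)" using y' c by (simp add: m_assoc)
  finally show ?case using y' wgroup_mult[OF K_sub y'(2) y(2)] by blast
qed

lemma T_in: "y \<in> insert e (insert (i e) K) \<Longrightarrow> T y \<in> wgroup (insert e (insert (i e) K))"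
proof -
  assume y: "y \<in> insert e (insert (i e) K)"
  have s: "insert e (insert (i e) K) \<subseteq> L'" using K_sub e_L' i_L' by auto
  show ?thesis unfolding T_def
    using y wgroup_mult[OF s] wgroup_w[OF s] wgroup_one adm_e x_K K_i by auto
qed

end

locale gersten_action = gersten L L' i Q m w
  for L L' :: "'a set" and i and Q :: "('q, 'm) monoid_scheme" (structure) and m w +
  fixes C :: "'a set" and act :: "'q \<Rightarrow> 'a \<Rightarrow> 'a"
  assumes L_C: "L \<subseteq> C" and act_closed: "g \<in> carrier Q \<Longrightarrow> c \<in> C \<Longrightarrow> act g c \<in> C"
    and act_mult: "g \<in> carrier Q \<Longrightarrow> h \<in> carrier Q \<Longrightarrow> c \<in> C \<Longrightarrow> act (g \<otimes> h) c = act g (act h c)"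
    and act_one: "c \<in> C \<Longrightarrow> act \<one> c = c"
    and act_w: "adm a b \<Longrightarrow> b \<in> L' \<Longrightarrow> c \<in> L \<Longrightarrow> act (w a b) c = sw a b c"
    and finite_L: "finite L"
begin

lemma act_wgroup_other:
  assumes "K \<subseteq> L'" "\<And>a. a \<in> K \<Longrightarrow> i a \<in> K" "h \<in> wgroup K" "c \<in> L" "c \<notin> K"
  shows "act h c = c"
  using assms(3)
proof (induction rule: wgroup.induct)
  case (wgroup_step a b h)
  have "b \<in> L'" "h \<in> carrier Q" using wgroup_step assms(1) wgroup_closed by auto
  moreover have "sw a b c = c" using wgroup_step assms by (intro sw_other) auto
  ultimately show ?case using wgroup_step assms L_C by (simp add: act_mult w_closed' act_w subsetD)
qed (use assms L_C act_one in auto)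

lemma act_wgroup_K:
  assumes "K \<subseteq> L'" "\<And>a. a \<in> K \<Longrightarrow> i a \<in> K" "h \<in> wgroup K" "c \<in> K"
  shows "act h c \<in> K"
  using assms(3)
proof (induction rule: wgroup.induct)
  case wgroup_one
  have "c \<in> C" using assms(1,4) L_C L'_sub by auto
  then show ?case using assms(4) act_one by simp
next
  case (wgroup_step a b h)
  have c: "b \<in> L'" "h \<in> carrier Q" "c \<in> C" "act h c \<in> L"
    using wgroup_step assms L_C L'_sub wgroup_closed[OF assms(1)] by auto
  moreover have "sw a b (act h c) \<in> K" using wgroup_step assms by (simp add: sw_def)
  ultimately show ?case using wgroup_step by (simp add: act_mult w_closed' act_w)
qed

lemma act_T:
  assumes "gersten_extension L L' i Q m w K e x" "y \<in> insert e (insert (i e) K)"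
  shows "act (gersten_extension.T i Q w e x y) e = y"
proof -
  interpret E: gersten_extension L L' i Q m w K e x by fact
  have eL: "e \<in> L" "e \<in> C" "i (i e) = e" using E.KL L_C i_i by auto
  have a: "act (w e z) c = sw e z c" if "z \<in> K" "c \<in> L" for z c
    using act_w E.adm_e E.KL that by simp
  consider "y = e" | "y = i e" | "y \<in> K" using assms by blast
  then show ?thesis
  proof cases
    case 1
    then show ?thesis using act_one eL by (simp add: E.T_def)
  next
    case 2
    have x: "x \<in> L'" "adm e x" "i x \<in> L" using E.x_K E.KL E.adm_e i_L by auto
    have "act (w e x \<otimes> w e x) e = sw e x (sw e x e)"
      using a[OF E.x_K] eL E.w_e_closed[OF E.x_K] x by (simp add: act_mult sw_values)
    also have "\<dots> = i e" using x by (simp add: sw_values)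
    finally show ?thesis using 2 E.e_neq by (simp add: E.T_def)
  next
    case 3
    have "i (i y) = y" using 3 E.KL i_i by auto
    then show ?thesis using 3 E.e_neq a[OF E.K_i[OF 3] eL(1)] sw_values(1)[OF E.adm_e(1)[OF E.K_i[OF 3]]] E.KL E.K_i
      by (auto simp: E.T_def)
  qed
qed

lemma extensionI:
  assumes "K \<subseteq> L'" "\<And>a. a \<in> K \<Longrightarrow> i a \<in> K" "e \<in> K" "x \<in> K - {e, i e}"
  shows "gersten_extension L L' i Q m w (K - {e, i e}) e x" "insert e (insert (i e) (K - {e, i e})) = K"
proof -
  have "e \<in> L" using assms L'_sub by auto
  then show "gersten_extension L L' i Q m w (K - {e, i e}) e x"
    using assms L'_sub by unfold_locales (auto simp: i_eq_iff i_inject i_i subset_iff)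
  show "insert e (insert (i e) (K - {e, i e})) = K" using assms by auto
qed

lemma wgroup_trivial:
  assumes "K \<subseteq> {e, i e}" "e \<in> L" "h \<in> wgroup K"
  shows "h = \<one>"
  using assms(3)
proof (induction rule: wgroup.induct)
  case (wgroup_step a b h)
  then have "a \<in> {e, i e}" "b \<in> {e, i e}" using assms(1) by auto
  then have False using wgroup_step.hyps(3) i_i[OF assms(2)] by (auto simp: adm_def)
  then show ?case ..
qed simp

text \<open>By induction on \<open>K\<close>: an element that acts trivially fixes \<open>e\<close>, hence lies in the coset of \<open>T e = \<one>\<close>, that is, in the
  group of the smaller set. So the relations present the group of signed permutations generated by the \<open>w a b\<close>.\<close>

theorem wgroup_faithful:
  assumes "K \<subseteq> L'" "\<And>a. a \<in> K \<Longrightarrow> i a \<in> K" "h \<in> wgroup K" "\<And>c. c \<in> K \<Longrightarrow> act h c = c"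
  shows "h = \<one>"
proof -
  have "finite K" using assms(1) L'_sub finite_L by (meson finite_subset)
  then show ?thesis using assms
  proof (induction K arbitrary: h rule: finite_psubset_induct)
    case (psubset K)
    show ?case
    proof (cases "\<exists>e x. e \<in> K \<and> x \<in> K - {e, i e}")
      case False
      show ?thesis
      proof (cases "K = {}")
        case True
        show ?thesis using psubset.prems(3) True by (cases rule: wgroup.cases) auto
      next
        case ne: False
        then obtain e where e: "e \<in> K" by blast
        then have "K \<subseteq> {e, i e}" using False by blast
        then show ?thesis using wgroup_trivial[of K e h] psubset.prems(1,3) e L'_sub by blast
      qed
    next
      case True
      then obtain e x where ex: "e \<in> K" "x \<in> K - {e, i e}" by blast
      let ?K = "K - {e, i e}"
      interpret E: gersten_extension L L' i Q m w ?K e x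
        using extensionI psubset.prems(1,2) ex by blast
      have KK: "insert e (insert (i e) ?K) = K" using extensionI(2) psubset.prems(1,2) ex by blast
      obtain y k where y: "y \<in> K" "k \<in> wgroup ?K" "h = E.T y \<otimes> k"
        using E.coset_decomposition[of h] psubset.prems(3) unfolding KK by blast
      have kc: "k \<in> carrier Q" "E.T y \<in> carrier Q" "e \<in> C"
        using wgroup_closed[OF E.K_sub y(2)] E.T_closed y KK E.KL L_C by auto
      have "act k e = e" using act_wgroup_other[OF E.K_sub E.K_i y(2)] E.KL by auto
      then have "act h e = y"
        using y kc act_T[OF E.gersten_extension_axioms] KK by (simp add: act_mult)
      then have "y = e" using psubset.prems(4)[OF ex(1)] by simp
      then have hk: "h = k" using y kc by (simp add: E.T_def)
      show ?thesis
      proof (rule psubset.IH)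
        show "?K \<subset> K" using ex by auto
      qed (use hk y E.K_sub E.K_i psubset.prems(4) in auto)
    qed
  qed
qed

text \<open>The same chain of stabilisers moves all letters to their places one after the other. Only the sign
  of the last letter cannot be corrected; the determinant will decide it.\<close>

theorem wgroup_almost_transitive:
  assumes "K \<subseteq> L'" "K \<noteq> {}" "\<And>a. a \<in> K \<Longrightarrow> i a \<in> K" "\<And>a. a \<in> K \<Longrightarrow> f a \<in> K" "inj_on f K"
    "\<And>a. a \<in> K \<Longrightarrow> f (i a) = i (f a)"
  shows "\<exists>h\<in>wgroup K. \<exists>c\<in>K. (\<forall>a\<in>K - {c, i c}. act h (f a) = a) \<and> act h (f c) \<in> {c, i c}"
proof -
  have "finite K" using assms(1) L'_sub finite_L by (meson finite_subset)
  then show ?thesis using assms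
  proof (induction K arbitrary: f rule: finite_psubset_induct)
    case (psubset K)
    show ?case
    proof (cases "\<exists>e x. e \<in> K \<and> x \<in> K - {e, i e}")
      case False
      then obtain e where e: "e \<in> K" "K \<subseteq> {e, i e}" using psubset.prems(2) by auto
      then have "e \<in> L" using psubset.prems(1) L'_sub by blast
      then have "e \<in> C" "i e \<in> C" using L_C i_L by blast+
      then show ?thesis using e psubset.prems(4)[OF e(1)]
        by (intro bexI[of _ \<one>] bexI[of _ e] wgroup_one) (auto simp: act_one)
    next
      case True
      then obtain e x where ex: "e \<in> K" "x \<in> K - {e, i e}" by blast
      let ?K = "K - {e, i e}"
      interpret E: gersten_extension L L' i Q m w ?K e x
        using extensionI psubset.prems(1,3) ex by blast
      have KK: "insert e (insert (i e) ?K) = K" using extensionI(2) psubset.prems(1,3) ex by blast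
      define y where "y = f e"
      have y: "y \<in> K" using psubset.prems(4) ex by (simp add: y_def)
      have KL: "K \<subseteq> L" "K \<subseteq> C" "e \<in> L" using psubset.prems(1) L'_sub L_C ex by auto
      have T: "E.T y \<in> carrier Q" "E.T y \<in> wgroup K" using E.T_closed E.T_in y KK by auto
      have Ti: "inv (E.T y) \<in> wgroup K" using wgroup_inv T psubset.prems by blast
      define f' where "f' a = act (inv (E.T y)) (f a)" for a
      have cancel: "act (E.T y) (f' a) = f a" if "a \<in> K" for a
      proof -
        have "f a \<in> C" using that psubset.prems(4) KL by auto
        then show ?thesis using T by (simp add: f'_def act_mult[symmetric] act_one)
      qed
      have f'K: "f' a \<in> K" if "a \<in> K" for a
        unfolding f'_def using act_wgroup_K[OF psubset.prems(1,3) Ti] psubset.prems(4) that by blast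
      have f'inj: "inj_on f' K" using cancel psubset.prems(5) by (metis inj_on_def)
      have f'e: "f' e = e"
      proof -
        have "act (inv (E.T y)) (act (E.T y) e) = e"
          using T KL by (simp add: act_mult[symmetric] act_one subsetD[OF KL(2) ex(1)])
        then show ?thesis using act_T[OF E.gersten_extension_axioms, of y] KK y by (simp add: f'_def y_def)
      qed
      have equi: "act h (i c) = i (act h c)" if "h \<in> wgroup K" "c \<in> K" for h c
        using that(1)
      proof (induction rule: wgroup.induct)
        case wgroup_one
        have "c \<in> C" "i c \<in> C" using that KL L_C i_L by auto
        then show ?case by (simp add: act_one)
      next
        case (wgroup_step a b h)
        have "b \<in> L'" "h \<in> carrier Q" "act h c \<in> L" "c \<in> C" "i c \<in> C"
          using wgroup_step that KL L_C i_L psubset.prems(1) wgroup_closed[OF psubset.prems(1)]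
            act_wgroup_K[OF psubset.prems(1,3)] by auto
        then show ?case using wgroup_step by (simp add: act_mult w_closed' act_w i_L sw_i)
      qed
      have f'i: "f' (i a) = i (f' a)" if "a \<in> K" for a
        using that equi[OF Ti] psubset.prems(4,6) by (simp add: f'_def)
      have ieK: "i e \<in> K" using psubset.prems(3) ex by auto
      have f'ie: "f' (i e) = i e" using f'i ex f'e by simp
      have f'K': "f' a \<in> ?K" if "a \<in> ?K" for a
        using that f'K inj_on_eq_iff[OF f'inj, of a e] inj_on_eq_iff[OF f'inj, of a "i e"] f'e f'ie ex(1) ieK
        by auto
      have "\<exists>h\<in>wgroup ?K. \<exists>c\<in>?K. (\<forall>a\<in>?K - {c, i c}. act h (f' a) = a) \<and> act h (f' c) \<in> {c, i c}"
      proof (rule psubset.IH)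
        show "?K \<subset> K" using ex by auto
        show "inj_on f' ?K" using f'inj by (rule inj_on_subset) auto
      qed (use ex f'K' f'i E.K_sub E.K_i in auto)
      then obtain h c where h: "h \<in> wgroup ?K" "c \<in> ?K" "\<forall>a\<in>?K - {c, i c}. act h (f' a) = a" "act h (f' c) \<in> {c, i c}"
        by blast
      have hK: "h \<in> wgroup K" using h(1)
        by (induction rule: wgroup.induct) (auto intro: wgroup.intros)
      have hc: "h \<in> carrier Q" using wgroup_closed[OF E.K_sub h(1)] .
      have e1: "act (h \<otimes> inv (E.T y)) (f a) = act h (f' a)" if "a \<in> K" for a
      proof -
        have "f a \<in> C" using that psubset.prems(4) KL by auto
        then show ?thesis using T hc by (simp add: act_mult f'_def)
      qed
      have "act h e = e" "act h (i e) = i e"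
        using act_wgroup_other[OF E.K_sub E.K_i h(1)] KL i_L by auto
      then have "\<forall>a\<in>K - {c, i c}. act (h \<otimes> inv (E.T y)) (f a) = a"
        using e1 h(3) f'e f'ie by auto
      moreover have "h \<otimes> inv (E.T y) \<in> wgroup K" using wgroup_mult[OF psubset.prems(1) hK Ti] .
      ultimately show ?thesis using e1 h(2,4) by (intro bexI[of _ "h \<otimes> inv (E.T y)"] bexI[of _ c]) auto
    qed
  qed
qed

end

section \<open>Peak reduction\<close>

text \<open>The setting of peak reduction: \<open>Q\<close> is a group in which the relations hold, \<open>G\<close> a group of automorphisms of \<open>F\<close>,
  and \<open>pr\<close> interprets the symbols as automorphisms. The assumptions on \<open>R\<close> collect what is needed
  about ranks; \<open>nielsen\<close> and \<open>orientation\<close> identify the automorphisms that cannot be reduced.\<close>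

locale nielsen_action = F: group F + G: group G + gersten L L' "m_inv F" Q m w
  for F :: "('a, 'f) monoid_scheme" and G :: "('a \<Rightarrow> 'a, 'g) monoid_scheme" and L L' :: "'a set"
    and Q :: "('q, 'm) monoid_scheme" (structure) and m w +
  fixes pr :: "'q \<Rightarrow> 'a \<Rightarrow> 'a" and R :: "'a \<Rightarrow> nat"
  assumes finite_L: "finite L" and L_F: "L \<subseteq> carrier F"
    and pr_hom: "pr \<in> hom Q G"
    and G_hom: "\<phi> \<in> carrier G \<Longrightarrow> \<phi> \<in> hom F F"
    and G_inj: "\<phi> \<in> carrier G \<Longrightarrow> inj_on \<phi> (carrier F)"
    and G_mult: "\<phi> \<in> carrier G \<Longrightarrow> \<psi> \<in> carrier G \<Longrightarrow> x \<in> carrier F \<Longrightarrow> (\<phi> \<otimes>\<^bsub>G\<^esub> \<psi>) x = \<phi> (\<psi> x)"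
    and G_one: "x \<in> carrier F \<Longrightarrow> \<one>\<^bsub>G\<^esub> x = x"
    and G_ext: "\<phi> \<in> carrier G \<Longrightarrow> \<psi> \<in> carrier G \<Longrightarrow> (\<And>c. c \<in> L \<Longrightarrow> \<phi> c = \<psi> c) \<Longrightarrow> \<phi> = \<psi>"
    and G_fix: "\<phi> \<in> carrier G \<Longrightarrow> c \<in> L \<Longrightarrow> c \<notin> L' \<Longrightarrow> \<phi> c = c"
    and pr_m: "adm a b \<Longrightarrow> pr (m a b) a = b \<otimes>\<^bsub>F\<^esub> a"
    and pr_m_other: "adm a b \<Longrightarrow> c \<in> L \<Longrightarrow> c \<noteq> a \<Longrightarrow> c \<noteq> inv\<^bsub>F\<^esub> a \<Longrightarrow> pr (m a b) c = c"
    and pr_w: "adm a b \<Longrightarrow> b \<in> L' \<Longrightarrow> c \<in> L \<Longrightarrow> pr (w a b) c = sw a b c"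
    and not_square: "adm a b \<Longrightarrow> b \<noteq> inv\<^bsub>F\<^esub> a \<otimes>\<^bsub>F\<^esub> inv\<^bsub>F\<^esub> a"
    and R_inv: "x \<in> carrier F \<Longrightarrow> R (inv\<^bsub>F\<^esub> x) = R x"
    and R_inject: "x \<in> carrier F \<Longrightarrow> y \<in> carrier F \<Longrightarrow> R x = R y \<Longrightarrow> x = y \<or> x = inv\<^bsub>F\<^esub> y"
    and R_lens_dist: "\<lbrakk>x \<in> carrier F; y \<in> carrier F; z \<in> carrier F; t \<in> carrier F;
        R (inv\<^bsub>F\<^esub> x \<otimes>\<^bsub>F\<^esub> z) < R (inv\<^bsub>F\<^esub> x \<otimes>\<^bsub>F\<^esub> y); R (inv\<^bsub>F\<^esub> z \<otimes>\<^bsub>F\<^esub> y) < R (inv\<^bsub>F\<^esub> x \<otimes>\<^bsub>F\<^esub> y);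
        R (inv\<^bsub>F\<^esub> x \<otimes>\<^bsub>F\<^esub> t) < R (inv\<^bsub>F\<^esub> x \<otimes>\<^bsub>F\<^esub> y); R (inv\<^bsub>F\<^esub> t \<otimes>\<^bsub>F\<^esub> y) < R (inv\<^bsub>F\<^esub> x \<otimes>\<^bsub>F\<^esub> y)\<rbrakk>
        \<Longrightarrow> R (inv\<^bsub>F\<^esub> z \<otimes>\<^bsub>F\<^esub> t) < R (inv\<^bsub>F\<^esub> x \<otimes>\<^bsub>F\<^esub> y)"
    and R_lens_trans: "\<lbrakk>x \<in> carrier F; y \<in> carrier F; z \<in> carrier F; t \<in> carrier F;
        R (inv\<^bsub>F\<^esub> x \<otimes>\<^bsub>F\<^esub> z) < R (inv\<^bsub>F\<^esub> x \<otimes>\<^bsub>F\<^esub> y); R (inv\<^bsub>F\<^esub> z \<otimes>\<^bsub>F\<^esub> y) < R (inv\<^bsub>F\<^esub> x \<otimes>\<^bsub>F\<^esub> y);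
        R (inv\<^bsub>F\<^esub> x \<otimes>\<^bsub>F\<^esub> t) < R (inv\<^bsub>F\<^esub> x \<otimes>\<^bsub>F\<^esub> z); R (inv\<^bsub>F\<^esub> t \<otimes>\<^bsub>F\<^esub> z) < R (inv\<^bsub>F\<^esub> x \<otimes>\<^bsub>F\<^esub> z)\<rbrakk>
        \<Longrightarrow> R (inv\<^bsub>F\<^esub> t \<otimes>\<^bsub>F\<^esub> y) < R (inv\<^bsub>F\<^esub> x \<otimes>\<^bsub>F\<^esub> y)"
    and R_not_double: "\<lbrakk>x \<in> carrier F; y \<in> carrier F; y \<noteq> \<one>\<^bsub>F\<^esub>; R (y \<otimes>\<^bsub>F\<^esub> x) < R x\<rbrakk>
        \<Longrightarrow> \<not> R (inv\<^bsub>F\<^esub> y \<otimes>\<^bsub>F\<^esub> x) < R x"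
    and R_letter_not_max: "\<lbrakk>b \<in> L; x \<in> carrier F; R (b \<otimes>\<^bsub>F\<^esub> x) < R b\<rbrakk> \<Longrightarrow> \<not> R x < R b"
    and R_letters_not_both: "\<lbrakk>b \<in> L; d \<in> L; x \<in> carrier F; R (b \<otimes>\<^bsub>F\<^esub> x) < R x; R (d \<otimes>\<^bsub>F\<^esub> x) < R x\<rbrakk> \<Longrightarrow> b = d"
    and R_two_letters: "\<lbrakk>a \<in> L; b \<in> L; b \<noteq> inv\<^bsub>F\<^esub> a\<rbrakk> \<Longrightarrow> R a \<le> R (b \<otimes>\<^bsub>F\<^esub> a)"
    and nielsen: "\<lbrakk>\<phi> \<in> carrier G; \<And>a b. adm a b \<Longrightarrow> \<not> R (\<phi> b \<otimes>\<^bsub>F\<^esub> \<phi> a) < R (\<phi> a); c \<in> L\<rbrakk> \<Longrightarrow> \<phi> c \<in> L"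
    and orientation: "\<lbrakk>\<phi> \<in> carrier G; c \<in> L'; \<And>a. a \<in> L \<Longrightarrow> a \<noteq> c \<Longrightarrow> a \<noteq> inv\<^bsub>F\<^esub> c \<Longrightarrow> \<phi> a = a;
        \<phi> c \<in> {c, inv\<^bsub>F\<^esub> c}\<rbrakk> \<Longrightarrow> \<phi> c = c"
begin

abbreviation fmult (infixl "\<cdot>" 70) where "x \<cdot> y \<equiv> x \<otimes>\<^bsub>F\<^esub> y"
abbreviation finv ("J") where "J \<equiv> m_inv F"

lemma J_mult: "x \<in> carrier F \<Longrightarrow> y \<in> carrier F \<Longrightarrow> J (x \<cdot> y) = J y \<cdot> J x"
  by (rule F.inv_mult_group)

lemma F_cancel:
  "x \<in> carrier F \<Longrightarrow> z \<in> carrier F \<Longrightarrow> J x \<cdot> (x \<cdot> z) = z"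
  "x \<in> carrier F \<Longrightarrow> z \<in> carrier F \<Longrightarrow> x \<cdot> (J x \<cdot> z) = z"
  by (simp_all add: F.m_assoc[symmetric])

text \<open>The members of a basis can be drawn as edges between points of the Cayley tree, and a move slides an end of the
  edge \<open>a\<close> along an adjacent edge \<open>b\<close>. The next lemmas bound the third sides that appear when two
  reducing moves meet: at the same end of one edge, at both ends of an edge, or along a chain of edges.\<close>

lemma R_fan:
  assumes "a \<in> carrier F" "b \<in> carrier F" "d \<in> carrier F"
    and "R (b \<cdot> a) < R a" "R b < R a" "R (d \<cdot> a) < R a" "R d < R a"
  shows "R (b \<cdot> J d) < R a"
  using R_lens_dist[of "\<one>\<^bsub>F\<^esub>" a "J b" "J d"] assms by (simp add: R_inv)

lemma R_both_ends:
  assumes "a \<in> carrier F" "b \<in> carrier F" "d \<in> carrier F"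
    and "R (b \<cdot> a) < R a" "R b < R a" "R (a \<cdot> J d) < R a" "R d < R a"
  shows "R (b \<cdot> (a \<cdot> J d)) < R a"
  using R_lens_dist[of "\<one>\<^bsub>F\<^esub>" a "J b" "a \<cdot> J d"] assms by (simp add: R_inv J_mult F.m_assoc)

lemma R_chain:
  assumes "a \<in> carrier F" "c \<in> carrier F" "d \<in> carrier F"
    and "R (c \<cdot> a) < R a" "R c < R a" "R (d \<cdot> c) < R c" "R d < R c"
  shows "R (d \<cdot> (c \<cdot> a)) < R a"
proof -
  have "J c \<cdot> J d = J (d \<cdot> c)" using assms by (simp add: J_mult)
  then have "R (J c \<cdot> J d) = R (d \<cdot> c)" using assms by (simp add: R_inv)
  then show ?thesis
    using R_lens_trans[of "\<one>\<^bsub>F\<^esub>" a "J c" "J c \<cdot> J d"] assms by (simp add: R_inv J_mult F.m_assoc)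
qed

lemma R_chain':
  assumes "a \<in> carrier F" "c \<in> carrier F" "d \<in> carrier F"
    and "R (J c \<cdot> a) < R a" "R c < R a" "R (d \<cdot> c) < R c" "R d < R c"
  shows "R (d \<cdot> a) < R a"
  using R_lens_trans[of "\<one>\<^bsub>F\<^esub>" a c "J d"] assms by (simp add: R_inv)

subsection \<open>The action of the generators\<close>

lemma L_carrier: "a \<in> L \<Longrightarrow> a \<in> carrier F" "a \<in> L' \<Longrightarrow> a \<in> carrier F"
  using L_F L'_sub by auto

lemma G_eval_closed: "\<phi> \<in> carrier G \<Longrightarrow> x \<in> carrier F \<Longrightarrow> \<phi> x \<in> carrier F"
  using G_hom hom_in_carrier by metis

lemma G_eval_mult: "\<phi> \<in> carrier G \<Longrightarrow> x \<in> carrier F \<Longrightarrow> y \<in> carrier F \<Longrightarrow> \<phi> (x \<cdot> y) = \<phi> x \<cdot> \<phi> y"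
  using G_hom hom_mult by metis

lemma G_eval_one: "\<phi> \<in> carrier G \<Longrightarrow> \<phi> \<one>\<^bsub>F\<^esub> = \<one>\<^bsub>F\<^esub>"
  using G_hom hom_one F.is_group by metis

lemma G_eval_inv: "\<phi> \<in> carrier G \<Longrightarrow> x \<in> carrier F \<Longrightarrow> \<phi> (J x) = J (\<phi> x)"
  using group_hom.hom_inv[of F F \<phi> x] G_hom F.is_group
  by (simp add: group_hom_def group_hom_axioms_def)

lemma one_not_L: "\<one>\<^bsub>F\<^esub> \<notin> L"
  using i_neq[of "\<one>\<^bsub>F\<^esub>"] by auto

lemma pr_closed [simp]: "g \<in> carrier Q \<Longrightarrow> pr g \<in> carrier G"
  using pr_hom by (rule hom_in_carrier)

lemma pr_mult: "g \<in> carrier Q \<Longrightarrow> h \<in> carrier Q \<Longrightarrow> pr (g \<otimes> h) = pr g \<otimes>\<^bsub>G\<^esub> pr h"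
  using pr_hom by (simp add: hom_mult)

lemma pr_one: "pr \<one> = \<one>\<^bsub>G\<^esub>"
  using pr_hom hom_one is_group G.is_group by blast

lemma pr_inv: "g \<in> carrier Q \<Longrightarrow> pr (inv g) = inv\<^bsub>G\<^esub> pr g"
  using group_hom.hom_inv[of Q G pr g] pr_hom is_group G.is_group
  by (simp add: group_hom_def group_hom_axioms_def)

definition move :: "('a \<Rightarrow> 'a) \<Rightarrow> 'a \<Rightarrow> 'a \<Rightarrow> 'a \<Rightarrow> 'a" where
  "move \<phi> a b = \<phi> \<otimes>\<^bsub>G\<^esub> pr (m a b)"

definition turn :: "('a \<Rightarrow> 'a) \<Rightarrow> 'a \<Rightarrow> 'a \<Rightarrow> 'a \<Rightarrow> 'a" where
  "turn \<phi> a b = \<phi> \<otimes>\<^bsub>G\<^esub> pr (w a b)"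

lemma move_closed: "\<phi> \<in> carrier G \<Longrightarrow> adm a b \<Longrightarrow> move \<phi> a b \<in> carrier G"
  by (simp add: move_def m_closed')

lemma turn_closed: "\<phi> \<in> carrier G \<Longrightarrow> adm a b \<Longrightarrow> b \<in> L' \<Longrightarrow> turn \<phi> a b \<in> carrier G"
  by (simp add: turn_def w_closed')

lemma adm_letters: "adm a b \<Longrightarrow> a \<in> L" "adm a b \<Longrightarrow> b \<in> L" "adm a b \<Longrightarrow> a \<in> L'"
  using L'_sub by (auto simp: adm_def)

lemma move_eval:
  assumes "\<phi> \<in> carrier G" "adm a b" "c \<in> L"
  shows "move \<phi> a b c = (if c = a then \<phi> b \<cdot> \<phi> a else if c = J a then \<phi> (J a) \<cdot> \<phi> (J b) else \<phi> c)"
proof -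
  have c: "a \<in> carrier F" "b \<in> carrier F" "c \<in> carrier F" "pr (m a b) \<in> carrier G"
    using assms adm_letters L_carrier m_closed' by auto
  have "pr (m a b) (J a) = J a \<cdot> J b"
    using c pr_m[OF assms(2)] by (simp add: G_eval_inv J_mult)
  then show ?thesis
    using c assms pr_m[OF assms(2)] pr_m_other[OF assms(2,3)] by (simp add: move_def G_mult G_eval_mult)
qed

lemma turn_eval:
  assumes "\<phi> \<in> carrier G" "adm a b" "b \<in> L'" "c \<in> L"
  shows "turn \<phi> a b c = \<phi> (sw a b c)"
  using assms by (simp add: turn_def G_mult w_closed' pr_w L_carrier)

lemma move_inverse: "\<phi> \<in> carrier G \<Longrightarrow> adm a b \<Longrightarrow> move (move \<phi> a b) a (J b) = \<phi>"
  using rel_inv[of a b] m_closed'[of a b] m_closed'[of a "J b"] adm_i(1)[of a b]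
  by (simp add: move_def G.m_assoc pr_mult[symmetric] pr_one)

lemma turn_inverse: "\<phi> \<in> carrier G \<Longrightarrow> adm a b \<Longrightarrow> b \<in> L' \<Longrightarrow> turn (turn \<phi> a b) a (J b) = \<phi>"
  by (simp add: turn_def w_inv[symmetric] pr_inv w_closed' G.m_assoc)

text \<open>Powers of 2 let the largest rank dominate: lowering it pays for changing another member of the basis to anything
  of smaller rank.\<close>

definition height :: "('a \<Rightarrow> 'a) \<Rightarrow> nat" where
  "height \<phi> = (\<Sum>c\<in>L. 2 ^ R (\<phi> c))"

lemma height_move:
  assumes "\<phi> \<in> carrier G" "adm a b"
  shows "height (move \<phi> a b) + 2 * 2 ^ R (\<phi> a) = height \<phi> + 2 * 2 ^ R (\<phi> b \<cdot> \<phi> a)"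
proof -
  let ?L = "L - {a, J a}"
  have a: "a \<in> L" "b \<in> L" "J a \<in> L" "J a \<noteq> a" "a \<in> carrier F" "b \<in> carrier F" "J b \<in> carrier F"
    using assms adm_letters i_neq i_L L_carrier by auto
  have L: "L = insert a (insert (J a) ?L)" using a by auto
  have s: "(\<Sum>c\<in>L. f c) = f a + (f (J a) + (\<Sum>c\<in>?L. f c))" for f :: "'a \<Rightarrow> nat"
    by (subst L) (use finite_L a in simp)
  have "\<phi> (J a) \<cdot> \<phi> (J b) = J (\<phi> b \<cdot> \<phi> a)" "\<phi> (J a) = J (\<phi> a)"
    using assms a by (simp_all add: G_eval_inv J_mult G_eval_closed)
  then have "R (\<phi> (J a) \<cdot> \<phi> (J b)) = R (\<phi> b \<cdot> \<phi> a)" "R (\<phi> (J a)) = R (\<phi> a)"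
    using assms a by (simp_all add: R_inv G_eval_closed)
  moreover have "(\<Sum>c\<in>?L. 2 ^ R (move \<phi> a b c)) = (\<Sum>c\<in>?L. (2::nat) ^ R (\<phi> c))"
    using assms by (intro sum.cong) (auto simp: move_eval)
  ultimately show ?thesis
    using a unfolding height_def s[of "\<lambda>c. 2 ^ R (move \<phi> a b c)"] s[of "\<lambda>c. 2 ^ R (\<phi> c)"]
    by (simp add: move_eval[OF assms])
qed

definition desc :: "('a \<Rightarrow> 'a) \<Rightarrow> 'a \<Rightarrow> 'a \<Rightarrow> bool" where
  "desc \<phi> a b \<longleftrightarrow> adm a b \<and> R (\<phi> b \<cdot> \<phi> a) < R (\<phi> a)"

lemma pow2_less: "x < y \<Longrightarrow> 2 * (2::nat) ^ x \<le> 2 ^ y"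
  using power_increasing[of "Suc x" y "2::nat"] by simp

lemma desc_height: "\<phi> \<in> carrier G \<Longrightarrow> desc \<phi> a b \<Longrightarrow> height (move \<phi> a b) < height \<phi>"
proof -
  assume d: "\<phi> \<in> carrier G" "desc \<phi> a b"
  then have "(2::nat) ^ R (\<phi> b \<cdot> \<phi> a) < 2 ^ R (\<phi> a)"
    by (intro power_strict_increasing) (auto simp: desc_def)
  moreover have "height (move \<phi> a b) + 2 * 2 ^ R (\<phi> a) = height \<phi> + 2 * 2 ^ R (\<phi> b \<cdot> \<phi> a)"
    using height_move d by (simp add: desc_def)
  ultimately show ?thesis by linarith
qed

text \<open>A move never preserves the rank, since elements of equal rank are equal or inverse and neither is possible in a
  basis. Hence a move or its inverse descends.\<close>

lemma not_desc_inverse: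
  assumes "\<phi> \<in> carrier G" "adm a b" "\<not> desc \<phi> a b"
  shows "desc (move \<phi> a b) a (J b)"
proof -
  have a: "a \<in> L" "b \<in> L" "J b \<in> L" "a \<in> carrier F" "b \<in> carrier F" "J b \<in> carrier F"
    using assms adm_letters i_L L_carrier by auto
  have c: "\<phi> a \<in> carrier F" "\<phi> b \<in> carrier F" using a assms G_eval_closed by auto
  have inj: "\<And>x y. x \<in> carrier F \<Longrightarrow> y \<in> carrier F \<Longrightarrow> \<phi> x = \<phi> y \<Longrightarrow> x = y"
    using G_inj[OF assms(1)] by (auto dest: inj_onD)
  have "R (\<phi> b \<cdot> \<phi> a) \<noteq> R (\<phi> a)"
  proof
    assume "R (\<phi> b \<cdot> \<phi> a) = R (\<phi> a)"
    then have "\<phi> b \<cdot> \<phi> a = \<phi> a \<or> \<phi> b \<cdot> \<phi> a = J (\<phi> a)"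
      using R_inject[OF F.m_closed[OF c(2,1)] c(1)] by blast
    then have "\<phi> (b \<cdot> a) = \<phi> a \<or> \<phi> (b \<cdot> a) = \<phi> (J a)" using a assms by (simp add: G_eval_mult G_eval_inv)
    then have "b \<cdot> a = a \<or> b \<cdot> a = J a"
      using inj[OF F.m_closed[OF a(5,4)] a(4)] inj[OF F.m_closed[OF a(5,4)] F.inv_closed[OF a(4)]] by blast
    then have "b = \<one>\<^bsub>F\<^esub> \<or> b = J a \<cdot> J a" using a by (metis F.inv_closed F.inv_solve_right F.r_inv F.m_closed)
    then show False using not_square[OF assms(2)] one_not_L a by auto
  qed
  then have less: "R (\<phi> a) < R (\<phi> b \<cdot> \<phi> a)" using assms by (auto simp: desc_def)
  have "b \<noteq> a" "b \<noteq> J a" "J b \<noteq> a" "J b \<noteq> J a" using assms a by (auto simp: adm_def i_eq_iff i_inject i_i)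
  then have "move \<phi> a b (J b) \<cdot> move \<phi> a b a = \<phi> a" "move \<phi> a b a = \<phi> b \<cdot> \<phi> a"
    using a assms c by (simp_all add: move_eval G_eval_inv F_cancel)
  then show ?thesis using less assms by (simp add: desc_def adm_i)
qed

subsection \<open>The values of an automorphism\<close>

text \<open>The values of \<open>\<phi>\<close> are the preimages in \<open>Q\<close> that are found by descending to a signed permutation
  and reading the moves backwards. Peak reduction shows that there is only one, whichever way is taken.\<close>

inductive V :: "('a \<Rightarrow> 'a) \<Rightarrow> 'q \<Rightarrow> bool" where
  V_perm: "h \<in> wgroup L' \<Longrightarrow> V (pr h) h"
| V_desc: "\<phi> \<in> carrier G \<Longrightarrow> desc \<phi> a b \<Longrightarrow> V (move \<phi> a b) \<rho> \<Longrightarrow> V \<phi> (\<rho> \<otimes> inv (m a b))"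

lemma V_closed: "V \<phi> \<rho> \<Longrightarrow> \<phi> \<in> carrier G" "V \<phi> \<rho> \<Longrightarrow> \<rho> \<in> carrier Q"
proof -
  have "\<phi> \<in> carrier G \<and> \<rho> \<in> carrier Q" if "V \<phi> \<rho>"
    using that by (induction rule: V.induct) (auto simp: wgroup_closed[OF subset_refl] desc_def m_closed')
  then show "V \<phi> \<rho> \<Longrightarrow> \<phi> \<in> carrier G" "V \<phi> \<rho> \<Longrightarrow> \<rho> \<in> carrier Q" by auto
qed

sublocale act: gersten_action L L' "m_inv F" Q m w "carrier F" pr
  by unfold_locales
    (auto simp: L_carrier G_eval_closed pr_mult G_mult pr_one G_one pr_w finite_L)

lemma wgroup_letters:
  assumes "h \<in> wgroup L'" "c \<in> L"
  shows "pr h c \<in> L"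
  using act.act_wgroup_other[of L' h c] act.act_wgroup_K[of L' h c] assms i_L' L'_sub by fastforce

lemma wgroup_no_desc: "h \<in> wgroup L' \<Longrightarrow> \<not> desc (pr h) a b"
proof
  assume h: "h \<in> wgroup L'" and d: "desc (pr h) a b"
  have ab: "adm a b" and hG: "pr h \<in> carrier G" using d wgroup_closed[OF subset_refl h] by (auto simp: desc_def)
  have l: "a \<in> L" "b \<in> L" "J a \<in> L" using adm_letters[OF ab] i_L by auto
  have "b \<noteq> J a" using ab l by (auto simp: adm_def i_i)
  then have "pr h b \<noteq> J (pr h a)"
    using G_inj[OF hG] l L_carrier G_eval_inv[OF hG] by (metis inj_onD)
  then show False
    using R_two_letters[OF wgroup_letters[OF h l(1)] wgroup_letters[OF h l(2)]] d by (simp add: desc_def)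
qed

text \<open>Signed permutations carry descending moves to descending moves, by the conjugation formula for \<open>w a b\<close>.\<close>

lemma V_turn:
  assumes "V \<phi> \<rho>" "adm a b" "b \<in> L'"
  shows "V (turn \<phi> a b) (\<rho> \<otimes> w a b)"
  using assms(1)
proof (induction rule: V.induct)
  case (V_perm h)
  have wg: "w a b \<in> wgroup L'" using assms wgroup_w[of L' a b] by (simp add: adm_def)
  have hc: "h \<in> carrier Q" using V_perm wgroup_closed[OF subset_refl] by blast
  have "turn (pr h) a b = pr (h \<otimes> w a b)"
    using hc w_closed'[OF assms(2,3)] by (simp add: turn_def pr_mult)
  then show ?case using V.V_perm[OF wgroup_mult[OF subset_refl V_perm wg]] by simp
next
  case (V_desc \<phi> c d \<rho>)
  have cd: "adm c d" using V_desc by (simp add: desc_def)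
  have ab': "adm a (J b)" "J b \<in> L'" using assms by (auto simp: adm_i i_L')
  define c' where "c' = sw a (J b) c"
  define d' where "d' = sw a (J b) d"
  have cd': "adm c' d'" unfolding c'_def d'_def by (rule adm_sw[OF ab' cd])
  have l: "c \<in> L" "d \<in> L" "c' \<in> L" "d' \<in> L" using adm_letters cd cd' by auto
  have undo: "sw a b c' = c" "sw a b d' = d"
    using sw_inverse(2)[OF assms(2,3)] l by (auto simp: c'_def d'_def)
  have cl: "m c d \<in> carrier Q" "m c' d' \<in> carrier Q" "w a b \<in> carrier Q" "\<rho> \<in> carrier Q"
    using cd cd' assms m_closed' w_closed' V_closed(2)[OF V_desc.hyps(3)] by auto
  have conj: "w a b \<otimes> m c' d' = m c d \<otimes> w a b"
    using cj_w_m[OF assms(2,3) cd'] undo cl by (simp add: cj_eq_iff)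
  have e: "move (turn \<phi> a b) c' d' = turn (move \<phi> c d) a b"
    using V_desc.hyps(1) cl conj by (simp add: move_def turn_def G.m_assoc pr_mult[symmetric])
  have "desc (turn \<phi> a b) c' d'"
    using V_desc.hyps(1,2) cd' undo l assms by (simp add: desc_def turn_eval)
  moreover have "V (move (turn \<phi> a b) c' d') (\<rho> \<otimes> w a b)" using V_desc.IH e by simp
  ultimately have "V (turn \<phi> a b) (\<rho> \<otimes> w a b \<otimes> inv (m c' d'))"
    using V_desc.hyps(1) assms by (intro V.V_desc) (auto simp: turn_closed)
  moreover have "\<rho> \<otimes> w a b \<otimes> inv (m c' d') = \<rho> \<otimes> inv (m c d) \<otimes> w a b"
  proof -
    have "w a b \<otimes> inv (m c' d') = inv (m c d) \<otimes> w a b"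
      using conj cl by (metis inv_closed inv_solve_left inv_solve_right m_assoc m_closed)
    then show ?thesis using cl by (simp add: m_assoc)
  qed
  ultimately show ?case by simp
qed

text \<open>A descending move lowers the height. Where none is left, the automorphism permutes the letters, and it is a product of
  elements \<open>w a b\<close> because the sign that these cannot correct is positive.\<close>

lemma V_exists: "\<phi> \<in> carrier G \<Longrightarrow> \<exists>\<rho>. V \<phi> \<rho>"
proof (induction "height \<phi>" arbitrary: \<phi> rule: less_induct)
  case less
  show ?case
  proof (cases "\<exists>a b. desc \<phi> a b")
    case True
    then obtain a b where d: "desc \<phi> a b" by blast
    then have "adm a b" by (simp add: desc_def)
    then obtain \<rho> where "V (move \<phi> a b) \<rho>"
      using less.hyps[OF desc_height[OF less.prems d]] move_closed less.prems by blast
    then show ?thesis using V_desc[OF less.prems d] by blast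
  next
    case False
    then have lett: "\<phi> c \<in> L" if "c \<in> L" for c
      using nielsen[OF less.prems _ that] by (auto simp: desc_def)
    have inj: "inj_on \<phi> L" using G_inj[OF less.prems] L_F by (rule inj_on_subset)
    have perm: "\<phi> c \<in> L'" if "c \<in> L'" for c
    proof (rule ccontr)
      assume n: "\<phi> c \<notin> L'"
      have "\<phi> c \<in> L" using lett that L'_sub by auto
      then have "\<phi> (\<phi> c) = \<phi> c" using G_fix[OF less.prems] n by blast
      then have "\<phi> c = c" using inj that L'_sub \<open>\<phi> c \<in> L\<close> by (metis inj_onD subsetD)
      then show False using n that by simp
    qed
    show ?thesis
    proof (cases "L' = {}")
      case True
      then have "\<phi> = pr \<one>"
        using less.prems G_fix by (intro G_ext) (auto simp: pr_one G_one L_carrier)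
      then show ?thesis using V_perm[OF wgroup_one] by metis
    next
      case ne: False
      have "\<exists>h\<in>wgroup L'. \<exists>c\<in>L'. (\<forall>a\<in>L' - {c, J c}. pr h (\<phi> a) = a) \<and> pr h (\<phi> c) \<in> {c, J c}"
        using ne i_L' perm inj_on_subset[OF inj L'_sub] G_eval_inv[OF less.prems] L_carrier
        by (intro act.wgroup_almost_transitive) auto
      then obtain h c where h: "h \<in> wgroup L'" "c \<in> L'" "\<forall>a\<in>L' - {c, J c}. pr h (\<phi> a) = a" "pr h (\<phi> c) \<in> {c, J c}"
        by blast
      have hc: "h \<in> carrier Q" using wgroup_closed[OF subset_refl h(1)] .
      define \<psi> where "\<psi> = pr h \<otimes>\<^bsub>G\<^esub> \<phi>"
      have \<psi>: "\<psi> \<in> carrier G" using hc less.prems by (simp add: \<psi>_def)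
      have ev: "\<psi> a = pr h (\<phi> a)" if "a \<in> L" for a
        using that hc less.prems by (simp add: \<psi>_def G_mult L_carrier)
      have other: "\<psi> a = a" if "a \<in> L" "a \<noteq> c" "a \<noteq> J c" for a
      proof (cases "a \<in> L'")
        case True
        then show ?thesis using ev h that by auto
      next
        case False
        then show ?thesis using G_fix[OF \<psi>] that by blast
      qed
      have c: "\<psi> c = c"
        using orientation[OF \<psi> h(2) other] ev[of c] h(2,4) L'_sub by auto
      then have "\<psi> (J c) = J c" using G_eval_inv[OF \<psi>] h(2) L_carrier by simp
      then have "\<psi> = \<one>\<^bsub>G\<^esub>" using c other \<psi> L_carrier by (intro G_ext) (auto simp: G_one)
      then have "\<phi> = pr (inv h)"
        using hc less.prems G.inv_equality[of \<phi> "pr h"] by (metis G.inv_equality G.inv_inv \<psi>_def pr_closed pr_inv)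
      moreover have "inv h \<in> wgroup L'" using h(1) i_L' by (intro wgroup_inv) auto
      ultimately show ?thesis using V_perm by metis
    qed
  qed
qed

subsection \<open>Uniqueness of values\<close>

text \<open>The hypothesis of the induction on the height.\<close>

definition unique_below :: "nat \<Rightarrow> bool" where
  "unique_below k \<longleftrightarrow> (\<forall>\<phi> \<rho> \<rho>'. height \<phi> < k \<longrightarrow> V \<phi> \<rho> \<longrightarrow> V \<phi> \<rho>' \<longrightarrow> \<rho> = \<rho>')"

text \<open>Below height \<open>k\<close>, values follow moves in both directions: upwards by definition, downwards by uniqueness.\<close>

lemma V_move:
  assumes u: "unique_below k" and h: "height \<phi> < k" and ab: "adm a b" and v: "V \<phi> \<rho>"
  shows "V (move \<phi> a b) (\<rho> \<otimes> m a b)"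
proof (cases "desc \<phi> a b")
  case True
  have c: "\<phi> \<in> carrier G" "\<rho> \<in> carrier Q" using V_closed[OF v] by auto
  obtain \<rho>' where r: "V (move \<phi> a b) \<rho>'" using V_exists move_closed c ab by blast
  have "V \<phi> (\<rho>' \<otimes> inv (m a b))" using V_desc[OF c(1) True r] .
  then have "\<rho> = \<rho>' \<otimes> inv (m a b)" using u h v by (auto simp: unique_below_def)
  then have "\<rho> \<otimes> m a b = \<rho>'" using V_closed(2)[OF r] m_closed'[OF ab] by (simp add: m_assoc)
  then show ?thesis using r by simp
next
  case False
  have c: "\<phi> \<in> carrier G" "\<rho> \<in> carrier Q" using V_closed[OF v] by auto
  have "V (move \<phi> a b) (\<rho> \<otimes> inv (m a (J b)))"
    using not_desc_inverse[OF c(1) ab False] c ab v by (intro V_desc) (auto simp: move_closed move_inverse)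
  moreover have "inv (m a (J b)) = m a b"
    using m_inv[of a "J b"] ab adm_letters[OF ab] by (simp add: adm_i i_i)
  ultimately show ?thesis by simp
qed

text \<open>The values that \<open>\<phi>\<close> inherits along its two moves agree. For descending moves, uniqueness of values at \<open>\<phi>\<close> means that
  any two are joined.\<close>

definition joined :: "('a \<Rightarrow> 'a) \<Rightarrow> 'a \<Rightarrow> 'a \<Rightarrow> 'a \<Rightarrow> 'a \<Rightarrow> bool" where
  "joined \<phi> a b c d \<longleftrightarrow> (\<forall>\<rho>. V (move \<phi> a b) \<rho> \<longrightarrow> V (move \<phi> c d) (\<rho> \<otimes> inv (m a b) \<otimes> m c d))"

lemma joined_refl: "adm a b \<Longrightarrow> joined \<phi> a b a b"
  unfolding joined_def using V_closed(2) m_closed' by (simp add: m_assoc)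

lemma joined_trans:
  assumes "joined \<phi> a b c d" "joined \<phi> c d e f" "adm a b" "adm c d" "adm e f"
  shows "joined \<phi> a b e f"
  unfolding joined_def
proof (intro allI impI)
  fix \<rho> assume v: "V (move \<phi> a b) \<rho>"
  then have "V (move \<phi> e f) (\<rho> \<otimes> inv (m a b) \<otimes> m c d \<otimes> inv (m c d) \<otimes> m e f)"
    using assms by (auto simp: joined_def)
  then show "V (move \<phi> e f) (\<rho> \<otimes> inv (m a b) \<otimes> m e f)"
    using assms V_closed(2)[OF v] m_closed' by (simp add: m_assoc inv_cancel_left)
qed

lemma joined_sym:
  assumes "joined \<phi> a b c d" and u: "unique_below (height \<phi>)" and d: "desc \<phi> a b" "desc \<phi> c d"
    and \<phi>: "\<phi> \<in> carrier G"
  shows "joined \<phi> c d a b"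
  unfolding joined_def
proof (intro allI impI)
  fix \<rho> assume v: "V (move \<phi> c d) \<rho>"
  have ad: "adm a b" "adm c d" using d by (auto simp: desc_def)
  obtain \<rho>' where v': "V (move \<phi> a b) \<rho>'" using V_exists move_closed \<phi> ad by blast
  then have "V (move \<phi> c d) (\<rho>' \<otimes> inv (m a b) \<otimes> m c d)" using assms(1) by (auto simp: joined_def)
  then have "\<rho> = \<rho>' \<otimes> inv (m a b) \<otimes> m c d"
    using u desc_height[OF \<phi> d(2)] v unfolding unique_below_def by blast
  then have "\<rho>' = \<rho> \<otimes> inv (m c d) \<otimes> m a b"
    using ad m_closed' V_closed(2)[OF v'] by (simp add: m_assoc inv_cancel_left)
  then show "V (move \<phi> a b) (\<rho> \<otimes> inv (m c d) \<otimes> m a b)" using v' by simp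
qed

text \<open>Paths that start at an automorphism and stay below height \<open>k\<close>, except possibly at their last point.\<close>

fun low_path :: "nat \<Rightarrow> ('a \<Rightarrow> 'a) \<Rightarrow> ('a \<times> 'a) list \<Rightarrow> bool" where
  "low_path k \<phi> [] \<longleftrightarrow> True"
| "low_path k \<phi> (p # ps) \<longleftrightarrow>
     adm (fst p) (snd p) \<and> height \<phi> < k \<and> low_path k (move \<phi> (fst p) (snd p)) ps"

fun path_product :: "('a \<times> 'a) list \<Rightarrow> 'q" where
  "path_product [] = \<one>"
| "path_product (p # ps) = m (fst p) (snd p) \<otimes> path_product ps"

lemma V_low_path:
  assumes "unique_below k" "low_path k \<phi> ps" "V \<phi> \<rho>"
  shows "path_product ps \<in> carrier Q" "V (\<phi> \<otimes>\<^bsub>G\<^esub> pr (path_product ps)) (\<rho> \<otimes> path_product ps)"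
proof -
  have "path_product ps \<in> carrier Q \<and> V (\<phi> \<otimes>\<^bsub>G\<^esub> pr (path_product ps)) (\<rho> \<otimes> path_product ps)"
    using assms(2,3)
  proof (induction ps arbitrary: \<phi> \<rho>)
    case Nil
    then show ?case using V_closed[OF Nil(2)] by (simp add: pr_one)
  next
    case (Cons p ps)
    then have p: "adm (fst p) (snd p)" "height \<phi> < k" "low_path k (move \<phi> (fst p) (snd p)) ps" by auto
    have c: "\<phi> \<in> carrier G" "\<rho> \<in> carrier Q" "m (fst p) (snd p) \<in> carrier Q"
      using V_closed[OF Cons.prems(2)] m_closed' p by auto
    have IH: "path_product ps \<in> carrier Q"
      "V (move \<phi> (fst p) (snd p) \<otimes>\<^bsub>G\<^esub> pr (path_product ps)) (\<rho> \<otimes> m (fst p) (snd p) \<otimes> path_product ps)"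
      using Cons.IH[OF p(3) V_move[OF assms(1) p(2,1) Cons.prems(2)]] by auto
    then show ?case using c by (simp add: move_def pr_mult G.m_assoc m_assoc)
  qed
  then show "path_product ps \<in> carrier Q" "V (\<phi> \<otimes>\<^bsub>G\<^esub> pr (path_product ps)) (\<rho> \<otimes> path_product ps)" by auto
qed

text \<open>Two moves are joined if their ends are connected below the peak \<open>\<phi>\<close> by a path that closes up by a relation in \<open>Q\<close>.\<close>

lemma joinedI:
  assumes \<phi>: "\<phi> \<in> carrier G" and ad: "adm a b" "adm c d" and u: "unique_below (height \<phi>)"
    and low: "low_path (height \<phi>) (move \<phi> a b) ps" and rel: "m a b \<otimes> path_product ps = m c d"
  shows "joined \<phi> a b c d"
  unfolding joined_def
proof (intro allI impI)
  fix \<rho> assume v: "V (move \<phi> a b) \<rho>"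
  note p = V_low_path[OF u low v]
  have cl: "m a b \<in> carrier Q" "\<rho> \<in> carrier Q" using ad m_closed' V_closed(2)[OF v] by auto
  have "move \<phi> a b \<otimes>\<^bsub>G\<^esub> pr (path_product ps) = move \<phi> c d"
    using \<phi> cl p(1) rel by (simp add: move_def G.m_assoc pr_mult[symmetric])
  moreover have "\<rho> \<otimes> path_product ps = \<rho> \<otimes> inv (m a b) \<otimes> m c d"
    using cl p(1) by (simp add: rel[symmetric] m_assoc inv_cancel_left)
  ultimately show "V (move \<phi> c d) (\<rho> \<otimes> inv (m a b) \<otimes> m c d)" using p(2) by simp
qed

text \<open>The element moved has the largest rank among the three sides of the triangle formed by the images of \<open>a\<close>, \<open>b\<close> and their
  product. The properties of lenses apply to such moves.\<close>

definition good :: "('a \<Rightarrow> 'a) \<Rightarrow> 'a \<Rightarrow> 'a \<Rightarrow> bool" where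
  "good \<phi> a b \<longleftrightarrow> desc \<phi> a b \<and> R (\<phi> b) < R (\<phi> a)"

text \<open>If the image of \<open>b\<close> has the largest rank instead, then sliding \<open>b\<close> along \<open>a\<close> is a good move. Both moves replace a side of
  the triangle by the third one, and one more move below the peak leads from one end to the other, up to a turn.\<close>

lemma joined_swap:
  assumes \<phi>: "\<phi> \<in> carrier G" and u: "unique_below (height \<phi>)" and d: "desc \<phi> a b" and ng: "\<not> good \<phi> a b"
  shows "good \<phi> (J b) (J a)" "joined \<phi> (J b) (J a) a b"
proof -
  have ab: "adm a b" and less: "R (\<phi> b \<cdot> \<phi> a) < R (\<phi> a)" using d by (auto simp: desc_def)
  have l: "a \<in> L" "b \<in> L" "a \<in> L'" "J a \<in> L" "J b \<in> L" using adm_letters[OF ab] i_L by auto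
  have ca: "a \<in> carrier F" "b \<in> carrier F" "\<phi> a \<in> carrier F" "\<phi> b \<in> carrier F"
    using l L_carrier G_eval_closed[OF \<phi>] by auto
  have ne: "R (\<phi> a) \<noteq> R (\<phi> b)"
  proof
    assume "R (\<phi> a) = R (\<phi> b)"
    then have "\<phi> a = \<phi> b \<or> \<phi> a = \<phi> (J b)" using R_inject ca G_eval_inv[OF \<phi>] by auto
    then have "a = b \<or> a = J b" using G_inj[OF \<phi>] ca by (auto dest: inj_onD)
    then show False using ab by (auto simp: adm_def)
  qed
  then have ab_less: "R (\<phi> a) < R (\<phi> b)" using ng d by (auto simp: good_def)
  have bL': "b \<in> L'"
  proof (rule ccontr)
    assume "b \<notin> L'"
    then have "\<phi> b = b" using G_fix[OF \<phi> l(2)] by simp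
    then show False using R_letter_not_max[OF l(2) ca(3)] less ab_less by simp
  qed
  have adms: "adm (J b) (J a)" "adm (J a) b" "adm b a" using ab bL' by (auto simp: adm_i adm_sym)
  have ii: "J (J a) = a" "J (J b) = b" using ca by auto
  have e: "\<phi> (J a) \<cdot> \<phi> (J b) = J (\<phi> b \<cdot> \<phi> a)" "\<phi> (J a) = J (\<phi> a)" "\<phi> (J b) = J (\<phi> b)"
    using ca by (auto simp: G_eval_inv[OF \<phi>] J_mult)
  have re: "R (\<phi> (J a) \<cdot> \<phi> (J b)) = R (\<phi> b \<cdot> \<phi> a)" "R (\<phi> (J a)) = R (\<phi> a)" "R (\<phi> (J b)) = R (\<phi> b)"
    using e ca by (auto simp: R_inv)
  show g: "good \<phi> (J b) (J a)"
    using adms re less ab_less by (simp add: good_def desc_def)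
  then have d': "desc \<phi> (J b) (J a)" by (simp add: good_def)
  show "joined \<phi> (J b) (J a) a b"
    unfolding joined_def
  proof (intro allI impI)
    fix \<rho> assume v: "V (move \<phi> (J b) (J a)) \<rho>"
    have cl: "m a b \<in> carrier Q" "m (J b) (J a) \<in> carrier Q" "m (J a) b \<in> carrier Q" "w a b \<in> carrier Q" "\<rho> \<in> carrier Q"
      using ab adms bL' m_closed' w_closed' V_closed(2)[OF v] by auto
    let ?\<phi>1 = "move \<phi> (J b) (J a)"
    let ?\<phi>2 = "move ?\<phi>1 (J a) b"
    have v2: "V ?\<phi>2 (\<rho> \<otimes> m (J a) b)"
      using V_move[OF u desc_height[OF \<phi> d'] adms(2) v] .
    have "?\<phi>2 = turn (move \<phi> a b) a b"
      using join_swap[OF ab bL'] cl \<phi> by (simp add: move_def turn_def G.m_assoc pr_mult[symmetric])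
    then have "turn ?\<phi>2 a (J b) = move \<phi> a b"
      using turn_inverse[OF move_closed[OF \<phi> ab] ab bL'] by simp
    then have "V (move \<phi> a b) (\<rho> \<otimes> m (J a) b \<otimes> w a (J b))"
      using V_turn[OF v2, of a "J b"] ab bL' by (simp add: adm_i i_L')
    moreover have "\<rho> \<otimes> m (J a) b \<otimes> w a (J b) = \<rho> \<otimes> inv (m (J b) (J a)) \<otimes> m a b"
    proof -
      have "inv (m (J b) (J a)) \<otimes> (m a b \<otimes> w a b) = m (J a) b"
        using join_swap[OF ab bL'] cl by (simp add: inv_cancel_left)
      then have "m (J a) b \<otimes> inv (w a b) = inv (m (J b) (J a)) \<otimes> m a b"
        using cl by (metis inv_closed inv_solve_right m_assoc m_closed)
      then have "\<rho> \<otimes> m (J a) b \<otimes> inv (w a b) = \<rho> \<otimes> inv (m (J b) (J a)) \<otimes> m a b" using cl by (simp add: m_assoc)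
      then show ?thesis using w_inv[OF ab bL'] by simp
    qed
    ultimately show "V (move \<phi> a b) (\<rho> \<otimes> inv (m (J b) (J a)) \<otimes> m a b)" by simp
  qed
qed

text \<open>The move of \<open>a\<close> uses the edge \<open>c\<close>, which the other move changes. After \<open>c\<close> has moved, \<open>a\<close> needs two steps to reach
  the same place; the first of them descends by \<open>R_chain\<close> or \<open>R_chain'\<close>.\<close>

lemma joined_path:
  assumes \<phi>: "\<phi> \<in> carrier G" and u: "unique_below (height \<phi>)" and g: "good \<phi> a b" "good \<phi> c d"
    and bc: "b = c \<or> b = J c"
  shows "joined \<phi> a b c d"
proof -
  have ad: "adm a b" "adm c d" using g by (auto simp: good_def desc_def)
  have l: "a \<in> L'" "b \<in> L" "c \<in> L'" "d \<in> L" "a \<in> L" "c \<in> L" using adm_letters ad by auto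
  have ca: "\<phi> a \<in> carrier F" "\<phi> b \<in> carrier F" "\<phi> c \<in> carrier F" "\<phi> d \<in> carrier F"
    "a \<in> carrier F" "c \<in> carrier F" "d \<in> carrier F"
    using l L_carrier G_eval_closed[OF \<phi>] by auto
  have lt: "R (\<phi> b \<cdot> \<phi> a) < R (\<phi> a)" "R (\<phi> b) < R (\<phi> a)" "R (\<phi> d \<cdot> \<phi> c) < R (\<phi> c)" "R (\<phi> d) < R (\<phi> c)"
    using g by (auto simp: good_def desc_def)
  have Rj: "R (\<phi> (J x)) = R (\<phi> x)" if "x \<in> L" for x
    using that L_carrier G_eval_closed[OF \<phi>] by (simp add: G_eval_inv[OF \<phi>] R_inv)
  have Rbc: "R (\<phi> b) = R (\<phi> c)" using bc Rj l by auto
  have ne: "c \<noteq> d" "c \<noteq> J d" "a \<noteq> c" "a \<noteq> J c" "a \<noteq> d" "a \<noteq> J d"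
    using ad lt Rbc Rj l by (auto simp: adm_def)
  have ne': "d \<noteq> a" "d \<noteq> J a" "c \<noteq> a" "c \<noteq> J a" "d \<noteq> c" "d \<noteq> J c" "J c \<noteq> J a" "J c \<noteq> a" "J d \<noteq> a" "J d \<noteq> J a"
    using ne l i_i by (auto simp: i_inject)
  have ne'': "J c \<noteq> c" "a \<noteq> J a" "c \<noteq> J c" using l i_neq by metis+
  have adms: "adm a c" "adm a d" "adm a (J d)" "adm a (J c)"
    using ne l i_L ca by (auto simp: adm_def)
  have cl: "m a b \<in> carrier Q" "m c d \<in> carrier Q" "m a c \<in> carrier Q" "m a d \<in> carrier Q" "m a (J d) \<in> carrier Q"
    "m a (J c) \<in> carrier Q" using ad adms m_closed' by auto
  let ?h = "height \<phi>"
  let ?\<phi>1 = "move \<phi> a b"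
  let ?\<phi>2 = "move ?\<phi>1 c d"
  have G1: "?\<phi>1 \<in> carrier G" and G2: "?\<phi>2 \<in> carrier G" using ad \<phi> move_closed by auto
  have h1: "height ?\<phi>1 < ?h" using desc_height \<phi> g by (simp add: good_def)
  have "?\<phi>1 c = \<phi> c" "?\<phi>1 d = \<phi> d" using move_eval[OF \<phi> ad(1)] l ne' ne'' by auto
  then have "desc ?\<phi>1 c d" using ad lt by (simp add: desc_def)
  then have h2: "height ?\<phi>2 < ?h" using desc_height[OF G1] h1 by fastforce
  note J1 = join_path[OF l(1,3,4) ne]
  have hc: "height (move \<phi> c d) < ?h" using desc_height \<phi> g by (simp add: good_def)
  have Gc: "move \<phi> c d \<in> carrier G" using ad \<phi> move_closed by auto
  have evc: "move \<phi> c d a = \<phi> a" "move \<phi> c d c = \<phi> d \<cdot> \<phi> c" "move \<phi> c d d = \<phi> d"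
    using move_eval[OF \<phi> ad(2)] l ne' ne'' ne by auto
  from bc show ?thesis
  proof
    assume b: "b = c"
    let ?\<phi>3 = "move (move \<phi> c d) a c"
    have G3: "?\<phi>3 \<in> carrier G" using Gc adms move_closed by auto
    have "?\<phi>2 = move ?\<phi>3 a (J d)"
      using J1(1) b cl \<phi> by (simp add: move_def G.m_assoc pr_mult[symmetric])
    then have e3: "move ?\<phi>2 a d = ?\<phi>3"
      using move_inverse[OF G3 adms(3)] ca by simp
    have "R (\<phi> d \<cdot> (\<phi> c \<cdot> \<phi> a)) < R (\<phi> a)"
      using R_chain[of "\<phi> a" "\<phi> c" "\<phi> d"] ca lt b by simp
    then have "desc (move \<phi> c d) a c" using evc adms ca by (simp add: desc_def F.m_assoc)
    then have h3: "height ?\<phi>3 < ?h" using desc_height[OF Gc] hc by fastforce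
    have "m a c \<otimes> (m c d \<otimes> (m a d \<otimes> m a (J c))) = m c d \<otimes> (m a c \<otimes> (m a (J d) \<otimes> (m a d \<otimes> m a (J c))))"
      using J1(1) cl by (simp add: m_assoc[symmetric])
    also have "\<dots> = m c d"
      using cl by (simp add: m_inv[OF adms(1), symmetric] m_inv[OF adms(2), symmetric] inv_cancel_left)
    finally have "m a b \<otimes> path_product [(c, d), (a, d), (a, J c)] = m c d" using b cl by simp
    then show ?thesis
      by (rule joinedI[OF \<phi> ad u, rotated]) (use h1 h2 h3 e3 ad adms in simp)
  next
    assume b: "b = J c"
    let ?\<phi>3 = "move (move \<phi> c d) a d"
    have G3: "?\<phi>3 \<in> carrier G" using Gc adms move_closed by auto
    have "?\<phi>2 = move ?\<phi>3 a (J c)"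
      using J1(2) b cl \<phi> by (simp add: move_def G.m_assoc pr_mult[symmetric])
    then have e3: "move ?\<phi>2 a c = ?\<phi>3"
      using move_inverse[OF G3 adms(4)] ca by simp
    have "R (\<phi> d \<cdot> \<phi> a) < R (\<phi> a)"
      using R_chain'[of "\<phi> a" "\<phi> c" "\<phi> d"] ca lt b Rbc by (simp add: G_eval_inv[OF \<phi>])
    then have "desc (move \<phi> c d) a d" using evc adms by (simp add: desc_def)
    then have h3: "height ?\<phi>3 < ?h" using desc_height[OF Gc] hc by fastforce
    have "m a (J c) \<otimes> (m c d \<otimes> (m a c \<otimes> m a (J d))) = m c d \<otimes> (m a d \<otimes> (m a (J c) \<otimes> (m a c \<otimes> m a (J d))))"
      using J1(2) cl by (simp add: m_assoc[symmetric])
    also have "\<dots> = m c d"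
      using cl by (simp add: m_inv[OF adms(1), symmetric] m_inv[OF adms(2), symmetric] inv_cancel_left)
    finally have "m a b \<otimes> path_product [(c, d), (a, c), (a, J d)] = m c d" using b cl by simp
    then show ?thesis
      by (rule joinedI[OF \<phi> ad u, rotated]) (use h1 h2 h3 e3 ad adms in simp)
  qed
qed

text \<open>Two moves at the same end of \<open>a\<close>. The edge \<open>d\<close> is slid along \<open>b\<close>, used to move \<open>a\<close>, and slid back.
  In between \<open>d\<close> may become longer, but by \<open>R_fan\<close> it stays shorter than \<open>a\<close> was, so the height remains low.\<close>

lemma joined_star_movable:
  assumes \<phi>: "\<phi> \<in> carrier G" and u: "unique_below (height \<phi>)" and g: "good \<phi> a b" "good \<phi> a d"
    and ne: "d \<noteq> b" "d \<noteq> J b" and dL: "d \<in> L'"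
  shows "joined \<phi> a b a d"
proof -
  have ad: "adm a b" "adm a d" using g by (auto simp: good_def desc_def)
  have l: "a \<in> L'" "b \<in> L" "d \<in> L" "a \<in> L" "J d \<in> L" "J b \<in> L" using adm_letters ad i_L by auto
  have ca: "\<phi> a \<in> carrier F" "\<phi> b \<in> carrier F" "\<phi> d \<in> carrier F" "a \<in> carrier F" "b \<in> carrier F" "d \<in> carrier F"
    using l L_carrier G_eval_closed[OF \<phi>] by auto
  have lt: "R (\<phi> b \<cdot> \<phi> a) < R (\<phi> a)" "R (\<phi> b) < R (\<phi> a)" "R (\<phi> d \<cdot> \<phi> a) < R (\<phi> a)" "R (\<phi> d) < R (\<phi> a)"
    using g by (auto simp: good_def desc_def)
  have adms: "adm (J d) b" "adm (J d) (J b)" using dL l ne ca by (auto simp: adm_def i_L' i_eq_iff i_inject)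
  have neq: "a \<noteq> d" "a \<noteq> J d" "a \<noteq> b" "a \<noteq> J b" using ad by (auto simp: adm_def)
  have neq': "d \<noteq> a" "d \<noteq> J a" "b \<noteq> a" "b \<noteq> J a" "J d \<noteq> a" "J d \<noteq> J a" "J b \<noteq> a" "J b \<noteq> J a" "b \<noteq> J d" "b \<noteq> d" "J d \<noteq> d"
     "b \<noteq> J (J d)" "a \<noteq> J (J d)"
    using neq ne ca l i_neq by (auto simp: i_inject)
  have cl: "m a b \<in> carrier Q" "m a d \<in> carrier Q" "m (J d) b \<in> carrier Q" "m (J d) (J b) \<in> carrier Q"
    using ad adms m_closed' by auto
  let ?\<phi>1 = "move \<phi> a b"
  let ?\<phi>2 = "move ?\<phi>1 (J d) b"
  let ?\<phi>3 = "move ?\<phi>2 a d"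
  have G: "?\<phi>1 \<in> carrier G" "?\<phi>2 \<in> carrier G" "?\<phi>3 \<in> carrier G" using ad adms \<phi> move_closed by auto
  have e1: "?\<phi>1 a = \<phi> b \<cdot> \<phi> a" "?\<phi>1 b = \<phi> b" "?\<phi>1 d = \<phi> d" "?\<phi>1 (J d) = \<phi> (J d)"
    using move_eval[OF \<phi> ad(1)] l neq' by auto
  have e2: "?\<phi>2 a = \<phi> b \<cdot> \<phi> a" "?\<phi>2 d = \<phi> d \<cdot> \<phi> (J b)"
  proof -
    show "?\<phi>2 a = \<phi> b \<cdot> \<phi> a" using move_eval[OF G(1) adms(1) l(4)] e1 neq' neq by simp
    have "?\<phi>1 (J b) = \<phi> (J b)" using move_eval[OF \<phi> ad(1)] l neq' by auto
    then show "?\<phi>2 d = \<phi> d \<cdot> \<phi> (J b)"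
      using move_eval[OF G(1) adms(1) l(3)] e1 neq' neq ca by simp
  qed
  have e3: "?\<phi>2 d \<cdot> ?\<phi>2 a = \<phi> d \<cdot> \<phi> a"
    using e2 ca by (simp add: G_eval_inv[OF \<phi>] F.m_assoc F_cancel)
  have fan: "R (\<phi> b \<cdot> J (\<phi> d)) < R (\<phi> a)" using R_fan ca lt by simp
  have h1: "height ?\<phi>1 + 2 * 2 ^ R (\<phi> a) = height \<phi> + 2 * 2 ^ R (\<phi> b \<cdot> \<phi> a)"
    using height_move[OF \<phi> ad(1)] .
  have h2: "height ?\<phi>2 + 2 * 2 ^ R (\<phi> d) = height ?\<phi>1 + 2 * 2 ^ R (\<phi> b \<cdot> J (\<phi> d))"
    using height_move[OF G(1) adms(1)] e1 ca by (simp add: G_eval_inv[OF \<phi>] R_inv)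
  have h3: "height ?\<phi>3 + 2 * 2 ^ R (\<phi> b \<cdot> \<phi> a) = height ?\<phi>2 + 2 * 2 ^ R (\<phi> d \<cdot> \<phi> a)"
    using height_move[OF G(2) ad(2)] e2 e3 by simp
  have p: "2 * (2::nat) ^ R (\<phi> b \<cdot> \<phi> a) \<le> 2 ^ R (\<phi> a)" "2 * (2::nat) ^ R (\<phi> d \<cdot> \<phi> a) \<le> 2 ^ R (\<phi> a)"
    "2 * (2::nat) ^ R (\<phi> b \<cdot> J (\<phi> d)) \<le> 2 ^ R (\<phi> a)" "(1::nat) \<le> 2 ^ R (\<phi> d)"
    using lt fan by (auto intro: pow2_less)
  have H1: "height ?\<phi>1 < height \<phi>" using desc_height \<phi> g by (simp add: good_def)
  have H2: "height ?\<phi>2 < height \<phi>" and H3: "height ?\<phi>3 < height \<phi>" using h1 h2 h3 p by linarith+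
  have J: "m a b \<otimes> m (J d) b \<otimes> m a d \<otimes> m (J d) (J b) = m a d"
    using join_star[OF l(1) dL l(2)] ne neq by simp
  then have "m a b \<otimes> path_product [(J d, b), (a, d), (J d, J b)] = m a d" using cl by (simp add: m_assoc)
  then show ?thesis
    by (rule joinedI[OF \<phi> ad u, rotated]) (use H1 H2 H3 ad adms in simp)
qed

text \<open>If \<open>d\<close> is fixed, the roles of \<open>b\<close> and \<open>d\<close> are exchanged; two fixed letters cannot both reduce \<open>a\<close>.\<close>

lemma joined_star:
  assumes \<phi>: "\<phi> \<in> carrier G" and u: "unique_below (height \<phi>)" and g: "good \<phi> a b" "good \<phi> a d"
  shows "joined \<phi> a b a d"
proof -
  have ad: "adm a b" "adm a d" using g by (auto simp: good_def desc_def)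
  have l: "a \<in> L'" "b \<in> L" "d \<in> L" "a \<in> L" using adm_letters ad by auto
  have ca: "\<phi> a \<in> carrier F" "\<phi> b \<in> carrier F" "b \<in> carrier F" "d \<in> carrier F"
    using l L_carrier G_eval_closed[OF \<phi>] by auto
  have lt: "R (\<phi> b \<cdot> \<phi> a) < R (\<phi> a)" "R (\<phi> d \<cdot> \<phi> a) < R (\<phi> a)"
    using g by (auto simp: good_def desc_def)
  have dd: "desc \<phi> a b" "desc \<phi> a d" using g by (auto simp: good_def)
  consider "d = b" | "d = J b" | "d \<noteq> b" "d \<noteq> J b" "d \<in> L'" | "d \<noteq> b" "d \<noteq> J b" "b \<in> L'"
    | "d \<noteq> b" "d \<notin> L'" "b \<notin> L'" by blast
  then show ?thesis
  proof cases
    case 1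
    then show ?thesis using joined_refl ad by simp
  next
    case 2
    have "\<phi> b \<noteq> \<one>\<^bsub>F\<^esub>"
      using G_inj[OF \<phi>] one_not_L l ca G_eval_one[OF \<phi>] by (metis F.one_closed inj_onD)
    then show ?thesis using R_not_double[of "\<phi> a" "\<phi> b"] lt 2 ca by (simp add: G_eval_inv[OF \<phi>])
  next
    case 3
    then show ?thesis using joined_star_movable[OF \<phi> u g] by simp
  next
    case 4
    then have "b \<noteq> d" "b \<noteq> J d" using ca by auto
    then show ?thesis using joined_sym[OF joined_star_movable[OF \<phi> u g(2,1)] u dd(2,1) \<phi>] 4 by simp
  next
    case 5
    then have "\<phi> b = b" "\<phi> d = d" using G_fix[OF \<phi>] l by auto
    then show ?thesis using R_letters_not_both[OF l(2,3) ca(1)] lt 5 by simp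
  qed
qed

text \<open>The two moves commute and complete a square. Its fourth corner is low by the hypotheses if different edges are moved,
  and by \<open>R_both_ends\<close> if the two ends of one edge are moved.\<close>

lemma joined_disjoint:
  assumes \<phi>: "\<phi> \<in> carrier G" and u: "unique_below (height \<phi>)" and g: "good \<phi> a b" "good \<phi> c d"
    and ne: "a \<noteq> c" "b \<noteq> c" "b \<noteq> J c" "a \<noteq> d" "a \<noteq> J d"
  shows "joined \<phi> a b c d"
proof -
  have ad: "adm a b" "adm c d" using g by (auto simp: good_def desc_def)
  have l: "a \<in> L'" "b \<in> L" "c \<in> L'" "d \<in> L" "a \<in> L" "c \<in> L" using adm_letters ad by auto
  have ca: "\<phi> a \<in> carrier F" "\<phi> b \<in> carrier F" "\<phi> c \<in> carrier F" "\<phi> d \<in> carrier F"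
    "a \<in> carrier F" "b \<in> carrier F" "c \<in> carrier F" "d \<in> carrier F"
    using l L_carrier G_eval_closed[OF \<phi>] by auto
  have lt: "R (\<phi> b \<cdot> \<phi> a) < R (\<phi> a)" "R (\<phi> b) < R (\<phi> a)" "R (\<phi> d \<cdot> \<phi> c) < R (\<phi> c)" "R (\<phi> d) < R (\<phi> c)"
    using g by (auto simp: good_def desc_def)
  have dd: "desc \<phi> a b" "desc \<phi> c d" using g by (auto simp: good_def)
  have comm: "m a b \<otimes> m c d = m c d \<otimes> m a b" using m_comm[OF ad] ne by simp
  have G1: "move \<phi> a b \<in> carrier G" using \<phi> ad move_closed by simp
  have ed: "move \<phi> a b d = \<phi> d" using move_eval[OF \<phi> ad(1) l(4)] ne ca by (auto simp: i_eq_iff)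
  have h1: "height (move \<phi> a b) + 2 * 2 ^ R (\<phi> a) = height \<phi> + 2 * 2 ^ R (\<phi> b \<cdot> \<phi> a)"
    using height_move[OF \<phi> ad(1)] .
  have low: "height (move (move \<phi> a b) c d) < height \<phi>"
  proof (cases "c = J a")
    case False
    then have "move \<phi> a b c = \<phi> c" using move_eval[OF \<phi> ad(1) l(6)] ne by auto
    then have "desc (move \<phi> a b) c d" using ad lt ed by (simp add: desc_def)
    then show ?thesis using desc_height[OF G1] desc_height[OF \<phi> dd(1)] by fastforce
  next
    case True
    then have ec: "move \<phi> a b c = J (\<phi> a) \<cdot> J (\<phi> b)"
      using move_eval[OF \<phi> ad(1) l(6)] ne ca by (simp add: G_eval_inv[OF \<phi>])
    have c: "\<phi> c = J (\<phi> a)" using True ca by (simp add: G_eval_inv[OF \<phi>])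
    have "J (\<phi> d \<cdot> J (\<phi> a)) = \<phi> a \<cdot> J (\<phi> d)" using ca by (simp add: J_mult)
    then have "R (\<phi> a \<cdot> J (\<phi> d)) = R (\<phi> d \<cdot> J (\<phi> a))" using ca R_inv[of "\<phi> d \<cdot> J (\<phi> a)"] by simp
    then have both: "R (\<phi> b \<cdot> (\<phi> a \<cdot> J (\<phi> d))) < R (\<phi> a)"
      using R_both_ends[of "\<phi> a" "\<phi> b" "\<phi> d"] lt c ca by (simp add: R_inv)
    have "\<phi> d \<cdot> (J (\<phi> a) \<cdot> J (\<phi> b)) = J (\<phi> b \<cdot> (\<phi> a \<cdot> J (\<phi> d)))" using ca by (simp add: J_mult F.m_assoc)
    then have r: "R (\<phi> d \<cdot> (J (\<phi> a) \<cdot> J (\<phi> b))) < R (\<phi> a)" using both ca by (simp add: R_inv)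
    have "J (\<phi> a) \<cdot> J (\<phi> b) = J (\<phi> b \<cdot> \<phi> a)" using ca by (simp add: J_mult)
    then have "height (move (move \<phi> a b) c d) + 2 * 2 ^ R (\<phi> b \<cdot> \<phi> a) =
        height (move \<phi> a b) + 2 * 2 ^ R (\<phi> d \<cdot> (J (\<phi> a) \<cdot> J (\<phi> b)))"
      using height_move[OF G1 ad(2)] ec ed ca by (simp add: R_inv)
    moreover have "(2::nat) ^ R (\<phi> d \<cdot> (J (\<phi> a) \<cdot> J (\<phi> b))) < 2 ^ R (\<phi> a)"
      using r by (intro power_strict_increasing) auto
    ultimately show ?thesis using h1 by linarith
  qed
  have cl: "m a b \<in> carrier Q" "m c d \<in> carrier Q" using ad m_closed' by auto
  have "m a b \<otimes> (m c d \<otimes> inv (m a b)) = m c d" using comm cl by (simp add: m_assoc[symmetric]) (simp add: m_assoc)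
  then have "m a b \<otimes> path_product [(c, d), (a, J b)] = m c d"
    using cl m_closed'[OF adm_i(1)[OF ad(1)]] by (simp add: m_inv[OF ad(1)])
  then show ?thesis
    by (rule joinedI[OF \<phi> ad u, rotated]) (use low ad adm_i desc_height[OF \<phi> dd(1)] in simp)
qed

lemma joined_good:
  assumes \<phi>: "\<phi> \<in> carrier G" and u: "unique_below (height \<phi>)" and g: "good \<phi> a b" "good \<phi> c d"
  shows "joined \<phi> a b c d"
proof -
  have ad: "adm a b" "adm c d" using g by (auto simp: good_def desc_def)
  have dd: "desc \<phi> a b" "desc \<phi> c d" using g by (auto simp: good_def)
  have l: "a \<in> L" "b \<in> L" "c \<in> L" "d \<in> L" using adm_letters ad by auto
  consider "a = c" | "b = c \<or> b = J c" | "d = a \<or> d = J a"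
    | "a \<noteq> c" "b \<noteq> c" "b \<noteq> J c" "a \<noteq> d" "a \<noteq> J d" using l i_i by metis
  then show ?thesis
  proof cases
    case 1
    then show ?thesis using joined_star[OF \<phi> u] g by simp
  next
    case 2
    then show ?thesis using joined_path[OF \<phi> u g] by simp
  next
    case 3
    then show ?thesis using joined_sym[OF joined_path[OF \<phi> u g(2,1)] u dd(2,1) \<phi>] by simp
  next
    case 4
    then show ?thesis using joined_disjoint[OF \<phi> u g] by simp
  qed
qed

lemma joined_desc:
  assumes \<phi>: "\<phi> \<in> carrier G" and u: "unique_below (height \<phi>)" and d: "desc \<phi> a b" "desc \<phi> c d"
  shows "joined \<phi> a b c d"
proof -
  have ex: "\<exists>a' b'. good \<phi> a' b' \<and> joined \<phi> a' b' a b" if "desc \<phi> a b" for a b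
  proof (cases "good \<phi> a b")
    case True
    moreover have "adm a b" using that by (simp add: desc_def)
    ultimately show ?thesis using joined_refl by blast
  next
    case False
    then show ?thesis using joined_swap[OF \<phi> u that] by blast
  qed
  obtain a' b' where ab: "good \<phi> a' b'" "joined \<phi> a' b' a b" using ex d by blast
  obtain c' d' where cd: "good \<phi> c' d'" "joined \<phi> c' d' c d" using ex d by blast
  have adms: "adm a b" "adm c d" "adm a' b'" "adm c' d'" using ab cd d by (auto simp: good_def desc_def)
  have "joined \<phi> a b a' b'" using joined_sym[OF ab(2) u _ d(1) \<phi>] ab(1) by (simp add: good_def)
  then have "joined \<phi> a b c' d'" using joined_trans joined_good[OF \<phi> u ab(1) cd(1)] adms by blast
  then show ?thesis using joined_trans cd(2) adms by blast
qed

theorem V_unique: "unique_below k"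
proof (induction k rule: less_induct)
  case (less k)
  show ?case
    unfolding unique_below_def
  proof (intro allI impI)
    fix \<phi> \<rho> \<rho>' assume k: "height \<phi> < k" and v: "V \<phi> \<rho>" "V \<phi> \<rho>'"
    have u: "unique_below (height \<phi>)" using less k by blast
    have \<phi>: "\<phi> \<in> carrier G" using V_closed v by blast
    show "\<rho> = \<rho>'"
      using v(1)
    proof (cases rule: V.cases)
      case V_perm
      have nd: "\<not> desc \<phi> a b" for a b using wgroup_no_desc V_perm by simp
      show ?thesis
        using v(2)
      proof (cases rule: V.cases)
        case p2: V_perm
        have c: "\<rho> \<in> carrier Q" "\<rho>' \<in> carrier Q" using V_closed v by auto
        have "inv \<rho> \<otimes> \<rho>' \<in> wgroup L'"
          using V_perm p2 i_L' by (intro wgroup_mult wgroup_inv) auto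
        moreover have "pr (inv \<rho> \<otimes> \<rho>') x = x" if "x \<in> L'" for x
        proof -
          have "pr (inv \<rho> \<otimes> \<rho>') = \<one>\<^bsub>G\<^esub>" using c V_perm p2 \<phi> by (simp add: pr_mult pr_inv)
          then show ?thesis using that L_carrier G_one by simp
        qed
        ultimately have "inv \<rho> \<otimes> \<rho>' = \<one>" using act.wgroup_faithful[of L' "inv \<rho> \<otimes> \<rho>'"] i_L' by blast
        then show ?thesis using c by (metis inv_closed inv_equality inv_inv)
      next
        case V_desc
        then show ?thesis using nd by blast
      qed
    next
      case (V_desc a b \<sigma>)
      note d1 = V_desc
      show ?thesis
        using v(2)
      proof (cases rule: V.cases)
        case V_perm
        then show ?thesis using wgroup_no_desc d1 by blast
      next
        case (V_desc c d \<tau>)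
        have ad: "adm a b" "adm c d" using d1 V_desc by (auto simp: desc_def)
        have cl: "\<sigma> \<in> carrier Q" "\<tau> \<in> carrier Q" "m a b \<in> carrier Q" "m c d \<in> carrier Q"
          using V_closed d1 V_desc m_closed' ad by auto
        have "V (move \<phi> c d) (\<sigma> \<otimes> inv (m a b) \<otimes> m c d)"
          using joined_desc[OF \<phi> u d1(3) V_desc(3)] d1 by (simp add: joined_def)
        then have "\<tau> = \<sigma> \<otimes> inv (m a b) \<otimes> m c d"
          using u desc_height[OF \<phi> V_desc(3)] V_desc(4) unfolding unique_below_def by blast
        then show ?thesis using d1 V_desc cl by (simp add: m_assoc)
      qed
    qed
  qed
qed

lemma V_one: "V \<one>\<^bsub>G\<^esub> \<one>"
  using V_perm[OF wgroup_one] pr_one by simp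

theorem V_step: "V \<phi> \<rho> \<Longrightarrow> adm a b \<Longrightarrow> V (\<phi> \<otimes>\<^bsub>G\<^esub> pr (m a b)) (\<rho> \<otimes> m a b)"
  using V_move[OF V_unique lessI] by (simp add: move_def)

lemma V_one_unique: "V \<one>\<^bsub>G\<^esub> \<rho> \<Longrightarrow> \<rho> = \<one>"
  using V_unique[of "Suc (height \<one>\<^bsub>G\<^esub>)"] V_one by (auto simp: unique_below_def)

lemma V_pr: "V \<phi> \<rho> \<Longrightarrow> pr \<rho> = \<phi>"
proof (induction rule: V.induct)
  case (V_desc \<phi> a b \<rho>)
  have ab: "m a b \<in> carrier Q" "\<rho> \<in> carrier Q" using V_desc m_closed' V_closed by (auto simp: desc_def)
  then have "pr (\<rho> \<otimes> inv (m a b)) = \<phi> \<otimes>\<^bsub>G\<^esub> pr (m a b) \<otimes>\<^bsub>G\<^esub> inv\<^bsub>G\<^esub> pr (m a b)"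
    using V_desc by (simp add: pr_mult pr_inv move_def)
  then show ?case using ab V_desc.hyps(1) by (simp add: G.m_assoc)
qed simp

end

section \<open>Words in a free group\<close>

locale free_basis = group F for F :: "('a, 'm) monoid_scheme" (structure) +
  fixes n :: nat and v :: "nat \<Rightarrow> 'a"
  assumes basis: "free_with_basis F {1..n} v"
begin

abbreviation "ltrs \<equiv> {1..n} \<times> (UNIV :: bool set)"

lemma v_closed: "k \<in> {1..n} \<Longrightarrow> v k \<in> carrier F" "v \<in> {1..n} \<rightarrow> carrier F"
  using basis by (auto simp: free_with_basis_def)

lemma ev_iso: "word_eval F v \<in> hom (free_group {1..n}) F" "bij_betw (word_eval F v) (words n) (carrier F)"
  using basis by (auto simp: free_with_basis_def iso_def)

lemma ev_inj: "inj_on (word_eval F v) (words n)"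
  using ev_iso(2) by (simp add: bij_betw_def)

definition wd :: "'a \<Rightarrow> nat sword" where
  "wd = the_inv_into (words n) (word_eval F v)"

lemma wd_ev: "w \<in> words n \<Longrightarrow> wd (word_eval F v w) = w"
  unfolding wd_def by (rule the_inv_into_f_f[OF ev_inj])

lemma ev_surj: "g \<in> carrier F \<Longrightarrow> \<exists>w\<in>words n. g = word_eval F v w"
  using ev_iso(2) by (auto simp: bij_betw_def)

lemma wd_words: "g \<in> carrier F \<Longrightarrow> wd g \<in> words n"
  using ev_surj wd_ev by metis

lemma ev_wd: "g \<in> carrier F \<Longrightarrow> word_eval F v (wd g) = g"
  using ev_surj wd_ev by metis

lemma wd_mult: "g \<in> carrier F \<Longrightarrow> h \<in> carrier F \<Longrightarrow> wd (g \<otimes> h) = foldr push (wd g) (wd h)"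
proof -
  assume g: "g \<in> carrier F" "h \<in> carrier F"
  interpret W: group "free_group {1..n}" by (rule group_free_group)
  have "g \<otimes> h = word_eval F v (wd g \<otimes>\<^bsub>free_group {1..n}\<^esub> wd h)"
    using g hom_mult[OF ev_iso(1)] by (simp add: wd_words ev_wd)
  then have "wd (g \<otimes> h) = wd g \<otimes>\<^bsub>free_group {1..n}\<^esub> wd h"
    using g wd_ev wd_words by simp
  then show ?thesis by (simp add: free_group_def)
qed

lemma wd_inv: "g \<in> carrier F \<Longrightarrow> wd (inv g) = winv (wd g)"
proof -
  assume g: "g \<in> carrier F"
  interpret W: group "free_group {1..n}" by (rule group_free_group)
  interpret h: group_hom "free_group {1..n}" F "word_eval F v"
    using ev_iso(1) by unfold_locales
  have "inv g = word_eval F v (inv\<^bsub>free_group {1..n}\<^esub> wd g)"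
    using g by (simp add: wd_words ev_wd)
  then show ?thesis using g wd_ev wd_words inv_free_group[of "wd g"] winv_words by simp
qed

lemma wd_diff: "g \<in> carrier F \<Longrightarrow> h \<in> carrier F \<Longrightarrow> wd (inv g \<otimes> h) = wdiff (wd g) (wd h)"
  by (simp add: wd_mult wd_inv wdiff_def)

lemma wd_inject: "g \<in> carrier F \<Longrightarrow> h \<in> carrier F \<Longrightarrow> wd g = wd h \<longleftrightarrow> g = h"
  using ev_wd by metis

lemma wd_one: "wd \<one> = []"
  using wd_ev[of "[]"] by (simp add: words_iff)

definition lt :: "nat \<times> bool \<Rightarrow> 'a" where
  "lt x = (if snd x then v (fst x) else inv (v (fst x)))"

lemma lt_closed: "x \<in> ltrs \<Longrightarrow> lt x \<in> carrier F"
  using v_closed(1) by (auto simp: lt_def)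

lemma single_word: "x \<in> ltrs \<Longrightarrow> [x] \<in> words n"
  by (simp add: words_iff reduced_Cons)

lemma ev_Cons: "word_eval F v (x # w) = lt x \<otimes> word_eval F v w"
  by (simp add: word_eval_Cons lt_def)

lemma wd_lt: "x \<in> ltrs \<Longrightarrow> wd (lt x) = [x]"
  using wd_ev[OF single_word] lt_closed by (simp add: ev_Cons)

lemma lt_inject: "x \<in> ltrs \<Longrightarrow> y \<in> ltrs \<Longrightarrow> lt x = lt y \<longleftrightarrow> x = y"
  using wd_lt by (metis list.inject)

lemma inv_lt: "x \<in> ltrs \<Longrightarrow> inv (lt x) = lt (opp x)"
  using v_closed(1) by (auto simp: lt_def opp_def)

lemma letters_lt: "k \<le> n \<Longrightarrow> letters F v k = lt ` ({1..k} \<times> UNIV)"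
proof -
  have "lt ` ({1..k} \<times> UNIV) = (\<Union>i\<in>{1..k}. {lt (i, True), lt (i, False)})"
    by (force simp: UNIV_bool)
  then show ?thesis by (auto simp: letters_def lt_def)
qed

lemma length_wd_lt: "g \<in> carrier F \<Longrightarrow> length (wd g) = 1 \<longleftrightarrow> g \<in> lt ` ltrs"
proof
  assume g: "g \<in> carrier F" and "length (wd g) = 1"
  then obtain x where x: "wd g = [x]" by (cases "wd g") auto
  then have "x \<in> ltrs" using wd_words[OF g] by (auto simp: words_iff)
  then show "g \<in> lt ` ltrs" using ev_wd[OF g] x lt_closed by (auto simp: ev_Cons)
qed (auto simp: wd_lt)

lemma hom_eqI:
  assumes "f \<in> hom F H" "g \<in> hom F H" "group H" "\<And>k. k \<in> {1..n} \<Longrightarrow> f (v k) = g (v k)" "x \<in> carrier F"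
  shows "f x = g x"
proof -
  interpret f: group_hom F H f using assms is_group by (simp add: group_hom_def group_hom_axioms_def)
  interpret g: group_hom F H g using assms is_group by (simp add: group_hom_def group_hom_axioms_def)
  have "f (word_eval F v w) = g (word_eval F v w)" if "set w \<subseteq> ltrs" for w
    using that
  proof (induction w)
    case (Cons y w)
    then have y: "y \<in> ltrs" "fst y \<in> {1..n}" and w: "word_eval F v w \<in> carrier F"
      using word_eval_closed[OF is_group v_closed(2), of w] by auto
    have "f (lt y) = g (lt y)" using assms(4)[OF y(2)] v_closed(1)[OF y(2)] by (simp add: lt_def)
    then show ?case using Cons lt_closed[OF y(1)] w by (simp add: ev_Cons)
  qed simp
  then show ?thesis using ev_wd[OF assms(5)] wd_words[OF assms(5)] by (metis wordsD(1))
qed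

lemma wd_hom: "wd \<in> hom F (free_group {1..n})"
proof (rule homI)
  show "wd (g \<otimes> h) = wd g \<otimes>\<^bsub>free_group {1..n}\<^esub> wd h" if "g \<in> carrier F" "h \<in> carrier F" for g h
    using wd_mult[OF that] by (simp add: free_group_def)
qed (rule wd_words)

lemma hom_exists:
  assumes "t \<in> {1..n} \<rightarrow> carrier F"
  shows "\<exists>f \<in> hom F F. \<forall>k\<in>{1..n}. f (v k) = t k"
proof (intro bexI[of _ "compose (carrier F) (word_eval F t) wd"] ballI)
  show "compose (carrier F) (word_eval F t) wd \<in> hom F F"
    using hom_compose[OF wd_hom word_eval_hom[OF is_group assms]] .
  fix k assume k: "k \<in> {1..n}"
  have "lt (k, True) = v k" by (simp add: lt_def)
  then have "wd (v k) = [(k, True)]" using wd_lt[of "(k, True)"] k by simp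
  moreover have "t k \<in> carrier F" using assms k by auto
  ultimately show "compose (carrier F) (word_eval F t) wd (v k) = t k"
    using v_closed(1)[OF k] by (simp add: word_eval_Cons compose_def)
qed

subsection \<open>The rank of a group element\<close>

lemma opp_eq_iff: "x = opp y \<longleftrightarrow> y = opp x"
  by auto

definition R :: "'a \<Rightarrow> nat" where
  "R g = rank n (wd g)"

lemma R_diff: "g \<in> carrier F \<Longrightarrow> h \<in> carrier F \<Longrightarrow> R (inv g \<otimes> h) = rank n (wdiff (wd g) (wd h))"
  by (simp add: R_def wd_diff)

lemma R_mult_lt: "x \<in> ltrs \<Longrightarrow> g \<in> carrier F \<Longrightarrow> R (lt x \<otimes> g) = rank n (push x (wd g))"
  by (simp add: R_def wd_mult lt_closed wd_lt)

lemma R_not_double: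
  assumes "x \<in> carrier F" "y \<in> carrier F" "y \<noteq> \<one>" "R (y \<otimes> x) < R x"
  shows "\<not> R (inv y \<otimes> x) < R x"
proof
  assume "R (inv y \<otimes> x) < R x"
  then have "rank n (foldr push (wd y) (wd x)) < rank n (wd x)"
    "rank n (foldr push (winv (wd y)) (wd x)) < rank n (wd x)"
    using assms by (simp_all add: R_def wd_mult wd_inv)
  then have "length (foldr push (wd y) (wd x)) \<le> length (wd x)"
    "length (foldr push (winv (wd y)) (wd x)) \<le> length (wd x)"
    using rank_less_lengthD[OF wd_words[OF assms(1)]] by blast+
  then have "wd y = []"
    by (rule no_double_shortening[OF wordsD(2)[OF wd_words[OF assms(1)]] wordsD(2)[OF wd_words[OF assms(2)]]])
  then show False using assms wd_inject[of y \<one>] wd_one by simp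
qed

lemma R_two_letters:
  assumes "x \<in> ltrs" "y \<in> ltrs" "y \<noteq> opp x"
  shows "R (lt x) \<le> R (lt y \<otimes> lt x)"
proof -
  have "wd (lt y \<otimes> lt x) = [y, x]"
    using assms(3) by (simp add: wd_mult[OF lt_closed[OF assms(2)] lt_closed[OF assms(1)]] wd_lt[OF assms(1)] wd_lt[OF assms(2)] opp_eq_iff)
  then show ?thesis
    using rank_less_length[OF single_word[OF assms(1)], of "[y, x]"] assms by (simp add: R_def wd_lt)
qed

lemma lt_not_square:
  assumes "x \<in> ltrs" "y \<in> ltrs"
  shows "lt y \<noteq> lt x \<otimes> lt x"
proof
  assume "lt y = lt x \<otimes> lt x"
  then have "[y] = wd (lt x \<otimes> lt x)" using wd_lt[OF assms(2)] by simp
  also have "\<dots> = [x, x]" by (simp add: wd_mult[OF lt_closed[OF assms(1)] lt_closed[OF assms(1)]] wd_lt[OF assms(1)] opp_neq[symmetric])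
  finally show False by simp
qed

text \<open>The images of the letters form a Nielsen reduced set. Every letter is the image of some reduced word, hence a product
  of images without adjacent inverse factors; such a product has at least as many letters as factors, so the letter is itself
  one of the images. Counting shows that there are no other images.\<close>

lemma irreducible_permutes:
  assumes \<phi>: "\<phi> \<in> hom F F" and bij: "bij_betw \<phi> (carrier F) (carrier F)"
    and irr: "\<And>a b. a \<in> lt ` ltrs \<Longrightarrow> b \<in> lt ` ltrs \<Longrightarrow> b \<noteq> a \<Longrightarrow> b \<noteq> inv a \<Longrightarrow> \<phi> a \<noteq> a
        \<Longrightarrow> \<not> R (\<phi> b \<otimes> \<phi> a) < R (\<phi> a)"
    and c: "c \<in> lt ` ltrs"
  shows "\<phi> c \<in> lt ` ltrs"
proof -
  interpret h: group_hom F F \<phi> using \<phi> by unfold_locales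
  let ?L = "lt ` ltrs"
  let ?A = "(\<lambda>c. wd (\<phi> c)) ` ?L"
  have inj: "inj_on \<phi> (carrier F)" using bij by (simp add: bij_betw_def)
  have LF: "?L \<subseteq> carrier F" using lt_closed by auto
  have iL: "inv c \<in> ?L" if "c \<in> ?L" for c using that by (auto simp: inv_lt)
  interpret N: nielsen_reduced n ?A
  proof
    show "?A \<subseteq> words n"
    proof
      fix a assume "a \<in> ?A"
      then obtain c where c: "c \<in> ?L" "a = wd (\<phi> c)" by blast
      have "\<phi> c \<in> carrier F" using subsetD[OF LF c(1)] by (rule h.hom_closed)
      then show "a \<in> words n" using c(2) wd_words by simp
    qed
    show "winv a \<in> ?A" if aA: "a \<in> ?A" for a
    proof -
      obtain c where c: "c \<in> ?L" "a = wd (\<phi> c)" using aA by blast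
      then have "winv a = wd (\<phi> (inv c))" using LF by (auto simp: wd_inv)
      then show ?thesis using iL c by blast
    qed
    show "[] \<notin> ?A"
    proof
      assume "[] \<in> ?A"
      then obtain c where c: "[] = wd (\<phi> c)" "c \<in> ?L" by (rule imageE)
      have cF: "c \<in> carrier F" using LF c(2) by (rule subsetD)
      have "\<phi> c = \<phi> \<one>" using wd_inject[OF h.hom_closed[OF cF] one_closed] wd_one c(1) by simp
      then have "c = \<one>" using inj_onD[OF inj _ cF one_closed] by simp
      then have "wd c = []" using wd_one by simp
      then show False using length_wd_lt[OF cF] c(2) by simp
    qed
    show "rank n a \<le> rank n (foldr push b a)"
      if ab: "a \<in> ?A" "b \<in> ?A" "b \<noteq> a" "b \<noteq> winv a" "length a \<ge> 2" for a b
    proof -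
      obtain c d where c: "c \<in> ?L" "a = wd (\<phi> c)" "d \<in> ?L" "b = wd (\<phi> d)" using ab(1,2) by blast
      have cF: "c \<in> carrier F" "d \<in> carrier F" using c LF by auto
      have "winv a = wd (\<phi> (inv c))" using c cF by (simp add: wd_inv)
      then have "d \<noteq> c" "d \<noteq> inv c" using ab c by auto
      moreover have "\<phi> c \<noteq> c"
      proof
        assume "\<phi> c = c"
        then have "length a = 1" using c(1,2) length_wd_lt[OF cF(1)] by simp
        then show False using ab(5) by simp
      qed
      ultimately have "\<not> R (\<phi> d \<otimes> \<phi> c) < R (\<phi> c)" using irr c by blast
      then show ?thesis using c cF by (simp add: R_def wd_mult)
    qed
  qed
  have sub: "?L \<subseteq> \<phi> ` ?L"
  proof
    fix a assume a: "a \<in> ?L"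
    then obtain x where x: "x \<in> ltrs" "a = lt x" by auto
    have "a \<in> \<phi> ` carrier F" using bij LF a by (auto simp: bij_betw_def)
    then obtain g where g: "g \<in> carrier F" "\<phi> g = a" by auto
    let ?us = "map (\<lambda>y. wd (\<phi> (lt y))) (wd g)"
    have ws: "set (wd g) \<subseteq> ltrs" "reduced (wd g)" using wd_words[OF g(1)] by (auto simp: words_iff)
    have "foldr (foldr push) (map (\<lambda>y. wd (\<phi> (lt y))) w) [] = wd (\<phi> (word_eval F v w))" if "set w \<subseteq> ltrs" for w
      using that
    proof (induction w)
      case (Cons y w)
      then have y: "y \<in> ltrs" and w: "word_eval F v w \<in> carrier F"
        using word_eval_closed[OF is_group v_closed(2), of w] by auto
      then show ?case using Cons by (simp add: ev_Cons wd_mult lt_closed)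
    qed (simp add: wd_one)
    then have "foldr (foldr push) ?us [] = [x]"
      using ws g x by (simp add: ev_wd wd_lt)
    moreover have "set ?us \<subseteq> ?A" using ws by auto
    moreover have "successively (\<lambda>u v. v \<noteq> winv u) ?us"
    proof -
      have ne: "wd (\<phi> (lt z)) \<noteq> winv (wd (\<phi> (lt y)))" if "y \<in> ltrs" "z \<in> ltrs" "z \<noteq> opp y" for y z
      proof
        assume "wd (\<phi> (lt z)) = winv (wd (\<phi> (lt y)))"
        also have "\<dots> = wd (\<phi> (lt (opp y)))" using that lt_closed by (simp add: inv_lt[symmetric] wd_inv)
        finally have e: "wd (\<phi> (lt z)) = wd (\<phi> (lt (opp y)))" .
        have oy: "opp y \<in> ltrs" using opp_mem that(1) by blast
        have cz: "lt z \<in> carrier F" "lt (opp y) \<in> carrier F" using lt_closed[OF that(2)] lt_closed[OF oy] by auto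
        have "\<phi> (lt z) = \<phi> (lt (opp y))"
          using e wd_inject[OF h.hom_closed[OF cz(1)] h.hom_closed[OF cz(2)]] by simp
        then have "lt z = lt (opp y)" using inj_onD[OF inj _ cz] by simp
        then show False using lt_inject[OF that(2) oy] that(3) by simp
      qed
      have "successively (\<lambda>y z. z \<noteq> opp y) (wd g)" using ws by (simp add: reduced_def)
      then show ?thesis
        unfolding successively_map
        by (rule successively_mono) (use ws(1) ne in blast)
    qed
    ultimately have "[x] \<in> ?A" by (intro N.letter_product)
    then obtain c where c: "[x] = wd (\<phi> c)" "c \<in> ?L" by (rule imageE)
    have "\<phi> c \<in> carrier F" using subsetD[OF LF c(2)] by (rule h.hom_closed)
    moreover have "wd (\<phi> c) = wd a" using c(1) x wd_lt by simp
    ultimately have "\<phi> c = a" using wd_inject subsetD[OF LF a] by simp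
    then show "a \<in> \<phi> ` ?L" using c(2) by blast
  qed
  have fin: "finite ?L" by simp
  have "card (\<phi> ` ?L) \<le> card ?L" using fin by (rule card_image_le)
  then have "?L = \<phi> ` ?L" using sub fin by (intro card_seteq) auto
  then show ?thesis using c by blast
qed

subsection \<open>Automorphisms\<close>

abbreviation "A \<equiv> AutoGroup F"

lemma A_simps: "carrier A = auto F" "x \<in> carrier F \<Longrightarrow> \<one>\<^bsub>A\<^esub> x = x"
  by (simp_all add: AutoGroup_def BijGroup_def)

lemma A_group: "group A"
  by (rule AutoGroup)

lemma autoD: "\<phi> \<in> auto F \<Longrightarrow> \<phi> \<in> hom F F" "\<phi> \<in> auto F \<Longrightarrow> bij_betw \<phi> (carrier F) (carrier F)"
  "\<phi> \<in> auto F \<Longrightarrow> \<phi> \<in> extensional (carrier F)"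
  by (auto simp: auto_def Bij_def)

lemma A_mult: "\<phi> \<in> auto F \<Longrightarrow> \<psi> \<in> auto F \<Longrightarrow> x \<in> carrier F \<Longrightarrow> (\<phi> \<otimes>\<^bsub>A\<^esub> \<psi>) x = \<phi> (\<psi> x)"
  by (simp add: AutoGroup_def BijGroup_def auto_def compose_def)

lemma auto_eval:
  assumes "\<phi> \<in> auto F"
  shows "x \<in> carrier F \<Longrightarrow> \<phi> x \<in> carrier F"
    and "x \<in> carrier F \<Longrightarrow> y \<in> carrier F \<Longrightarrow> \<phi> (x \<otimes> y) = \<phi> x \<otimes> \<phi> y"
    and "x \<in> carrier F \<Longrightarrow> \<phi> (inv x) = inv (\<phi> x)"
proof -
  interpret h: group_hom F F \<phi> using autoD(1)[OF assms] by unfold_locales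
  show "x \<in> carrier F \<Longrightarrow> \<phi> x \<in> carrier F" "x \<in> carrier F \<Longrightarrow> y \<in> carrier F \<Longrightarrow> \<phi> (x \<otimes> y) = \<phi> x \<otimes> \<phi> y"
    "x \<in> carrier F \<Longrightarrow> \<phi> (inv x) = inv (\<phi> x)" by simp_all
qed

lemma auto_eqI:
  assumes "\<phi> \<in> auto F" "\<psi> \<in> auto F" "\<And>x. x \<in> ltrs \<Longrightarrow> \<phi> (lt x) = \<psi> (lt x) \<or> \<phi> (inv (lt x)) = \<psi> (inv (lt x))"
  shows "\<phi> = \<psi>"
proof (rule extensionalityI[OF autoD(3)[OF assms(1)] autoD(3)[OF assms(2)]])
  have "\<phi> (v k) = \<psi> (v k)" if "k \<in> {1..n}" for k
  proof -
    have l: "lt (k, True) = v k" "(k, True) \<in> ltrs" "v k \<in> carrier F" using that v_closed(1) by (auto simp: lt_def)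
    then show ?thesis using assms(3)[OF l(2)] auto_eval(1,3)[OF assms(1) l(3)] auto_eval(1,3)[OF assms(2) l(3)]
      by auto
  qed
  then show "\<phi> x = \<psi> x" if "x \<in> carrier F" for x
    using hom_eqI[OF autoD(1)[OF assms(1)] autoD(1)[OF assms(2)] is_group _ that] by blast
qed

lemma restrict_auto:
  assumes f: "f \<in> hom F F" and g: "g \<in> hom F F"
    and fg: "\<And>k. k \<in> {1..n} \<Longrightarrow> f (g (v k)) = v k" and gf: "\<And>k. k \<in> {1..n} \<Longrightarrow> g (f (v k)) = v k"
  shows "restrict f (carrier F) \<in> auto F"
proof -
  have c: "f x \<in> carrier F" "g x \<in> carrier F" if "x \<in> carrier F" for x
    using that hom_in_carrier[OF f] hom_in_carrier[OF g] by auto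
  have id: "(\<lambda>x. x) \<in> hom F F" by (auto simp: hom_def)
  have "(\<lambda>x. f (g x)) \<in> hom F F" "(\<lambda>x. g (f x)) \<in> hom F F"
    using f g c by (auto simp: hom_def)
  then have i: "f (g x) = x" "g (f x) = x" if "x \<in> carrier F" for x
    using hom_eqI[OF _ id is_group _ that] fg gf by auto
  have "bij_betw f (carrier F) (carrier F)"
    by (rule bij_betwI[where g = g]) (use c i in auto)
  then have "bij_betw (restrict f (carrier F)) (carrier F) (carrier F)"
    by (simp cong: bij_betw_cong)
  moreover have "restrict f (carrier F) \<in> hom F F" using f by (auto simp: hom_def)
  ultimately show ?thesis by (simp add: auto_def Bij_def)
qed

abbreviation "L \<equiv> letters F v n"

lemma L_lt: "L = lt ` ltrs"
  by (rule letters_lt) simp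

lemma L_closed: "a \<in> L \<Longrightarrow> a \<in> carrier F" "a \<in> L \<Longrightarrow> inv a \<in> L"
  by (auto simp: L_lt lt_closed inv_lt)

lemma L_inv_neq: "a \<in> L \<Longrightarrow> inv a \<noteq> a"
  by (auto simp: L_lt inv_lt lt_inject)

lemma auto_letters_eqI:
  assumes "\<phi> \<in> auto F" "\<psi> \<in> auto F" "\<And>c. c \<in> L \<Longrightarrow> \<phi> c = \<psi> c \<or> \<phi> (inv c) = \<psi> (inv c)"
  shows "\<phi> = \<psi>"
  using assms by (intro auto_eqI) (auto simp: L_lt)

lemma transvection_hom:
  assumes "a \<in> L" "b \<in> L"
  shows "\<exists>f\<in>hom F F. f a = b \<otimes> a \<and> (\<forall>c\<in>L - {a, inv a}. f c = c)"
proof -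
  define t where "t k = (if v k = a then b \<otimes> a else if v k = inv a then inv a \<otimes> inv b else v k)" for k
  have "t \<in> {1..n} \<rightarrow> carrier F" using assms L_closed v_closed(1) by (auto simp: t_def)
  then obtain f where f: "f \<in> hom F F" "\<forall>k\<in>{1..n}. f (v k) = t k" using hom_exists by blast
  interpret f: group_hom F F f using f by unfold_locales
  have ac: "a \<in> carrier F" "b \<in> carrier F" using assms L_closed by auto
  have on: "f c = (if c = a then b \<otimes> a else if c = inv a then inv a \<otimes> inv b else c)" if "c \<in> L" for c
  proof -
    obtain k where k: "k \<in> {1..n}" "c = v k \<or> c = inv (v k)"
      using \<open>c \<in> L\<close> by (auto simp: letters_def)
    have vc: "v k \<in> carrier F" using k v_closed(1) by auto
    have neq: "a \<noteq> inv a" using L_inv_neq[OF assms(1)] by simp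
    from k(2) show ?thesis
    proof
      assume "c = v k"
      then show ?thesis using f(2) k(1) by (simp add: t_def)
    next
      assume c: "c = inv (v k)"
      then have "f c = inv (t k)" using f(2) k(1) vc by simp
      moreover have "v k = a \<longleftrightarrow> c = inv a" "v k = inv a \<longleftrightarrow> c = a" using c vc ac by auto
      ultimately show ?thesis using ac neq c by (auto simp: t_def inv_mult_group)
    qed
  qed
  show ?thesis using f(1) on assms by (intro bexI[of _ f]) auto
qed

lemma transvection_auto:
  assumes a: "a \<in> L" and b: "b \<in> L" "b \<noteq> a" "b \<noteq> inv a"
  shows "\<exists>\<phi>\<in>auto F. \<phi> a = b \<otimes> a \<and> (\<forall>c\<in>L - {a, inv a}. \<phi> c = c)"
proof -
  have ac: "a \<in> carrier F" "b \<in> carrier F" using assms L_closed by auto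
  obtain f where f: "f \<in> hom F F" "f a = b \<otimes> a" "\<forall>c\<in>L - {a, inv a}. f c = c"
    using transvection_hom[OF a b(1)] by blast
  obtain g where g: "g \<in> hom F F" "g a = inv b \<otimes> a" "\<forall>c\<in>L - {a, inv a}. g c = c"
    using transvection_hom[OF a L_closed(2)[OF b(1)]] by blast
  interpret f: group_hom F F f using f by unfold_locales
  interpret g: group_hom F F g using g by unfold_locales
  have fb: "f b = b" "g b = b" using f g b by auto
  have ba: "f (g a) = a" "g (f a) = a"
    using f(2) g(2) ac fb by (simp_all add: m_assoc[symmetric])
  then have ba': "f (g (inv a)) = inv a" "g (f (inv a)) = inv a" using ac by simp_all
  have id: "f (g (v k)) = v k" "g (f (v k)) = v k" if "k \<in> {1..n}" for k
  proof -
    have "v k \<in> L" using that by (auto simp: letters_def)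
    then show "f (g (v k)) = v k" "g (f (v k)) = v k"
      using ba ba' f(3) g(3) by (cases "v k = a"; cases "v k = inv a"; simp)+
  qed
  have "restrict f (carrier F) \<in> auto F" by (rule restrict_auto[OF f(1) g(1) id])
  then show ?thesis using f ac L_closed(1) by (intro bexI[of _ "restrict f (carrier F)"]) auto
qed

abbreviation "tr \<equiv> trans_aut F L"

lemma tr_props:
  assumes a: "a \<in> L" and b: "b \<in> L" "b \<noteq> a" "b \<noteq> inv a"
  shows "tr a b \<in> auto F" "tr a b a = b \<otimes> a" "\<And>c. c \<in> L \<Longrightarrow> c \<noteq> a \<Longrightarrow> c \<noteq> inv a \<Longrightarrow> tr a b c = c"
proof -
  have "\<exists>!\<phi>. \<phi> \<in> auto F \<and> \<phi> a = b \<otimes> a \<and> (\<forall>c\<in>L - {a, inv a}. \<phi> c = c)"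
  proof (rule ex_ex1I)
    show "\<exists>\<phi>. \<phi> \<in> auto F \<and> \<phi> a = b \<otimes> a \<and> (\<forall>c\<in>L - {a, inv a}. \<phi> c = c)"
      using transvection_auto[OF assms] by blast
    fix \<phi> \<psi>
    assume p: "\<phi> \<in> auto F \<and> \<phi> a = b \<otimes> a \<and> (\<forall>c\<in>L - {a, inv a}. \<phi> c = c)"
      and q: "\<psi> \<in> auto F \<and> \<psi> a = b \<otimes> a \<and> (\<forall>c\<in>L - {a, inv a}. \<psi> c = c)"
    show "\<phi> = \<psi>"
    proof (rule auto_letters_eqI)
      show "\<phi> c = \<psi> c \<or> \<phi> (inv c) = \<psi> (inv c)" if c: "c \<in> L" for c
      proof (cases "c = a \<or> c = inv a")
        case True
        then have "c = a \<or> inv c = a" using L_closed(1)[OF a] by auto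
        then show ?thesis using p q by auto
      next
        case False
        then show ?thesis using p q c by simp
      qed
    qed (use p q in auto)
  qed
  from theI'[OF this] show "tr a b \<in> auto F" "tr a b a = b \<otimes> a"
    "\<And>c. c \<in> L \<Longrightarrow> c \<noteq> a \<Longrightarrow> c \<noteq> inv a \<Longrightarrow> tr a b c = c"
    unfolding trans_aut_def by auto
qed

end

section \<open>Quotients of free groups by relations\<close>

text \<open>\<open>Q\<close> is the group that the relations define on the symbols \<open>S\<close>, and \<open>cs\<close> the canonical homomorphism onto it.\<close>

locale relators =
  fixes S :: "'s set" and Rel :: "('s sword \<times> 's sword) set"
  assumes Rel: "Rel \<subseteq> carrier (free_group S) \<times> carrier (free_group S)"
begin

abbreviation "P \<equiv> free_group S"

definition N :: "'s sword set" where
  "N = normal_closure P ((\<lambda>(u, w). u \<otimes>\<^bsub>P\<^esub> inv\<^bsub>P\<^esub> w) ` Rel)"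

abbreviation "Q \<equiv> P Mod N"

definition cs :: "'s sword \<Rightarrow> 's sword set" where
  "cs x = N #>\<^bsub>P\<^esub> x"

sublocale P: group P
  by (rule group_free_group)

lemma relator_closed: "(\<lambda>(u, w). u \<otimes>\<^bsub>P\<^esub> inv\<^bsub>P\<^esub> w) ` Rel \<subseteq> carrier P"
  using Rel by auto

lemma N_normal: "N \<lhd> P"
proof -
  let ?R = "(\<lambda>(u, w). u \<otimes>\<^bsub>P\<^esub> inv\<^bsub>P\<^esub> w) ` Rel"
  let ?C = "{N. N \<lhd> P \<and> ?R \<subseteq> N}"
  have "carrier P \<lhd> P"
    unfolding P.normal_inv_iff using P.subgroup_self by auto
  then have ne: "?C \<noteq> {}" using relator_closed by auto
  have "subgroup (\<Inter> ?C) P"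
    by (rule P.subgroups_Inter) (use ne in \<open>auto simp: P.normal_inv_iff\<close>)
  then show ?thesis
    unfolding N_def normal_closure_def P.normal_inv_iff by (auto simp: P.normal_inv_iff)
qed

sublocale N: normal N P
  by (rule N_normal)

sublocale Q: group Q
  by (rule N.factorgroup_is_group)

lemma cs_hom: "cs \<in> hom P Q"
  unfolding cs_def by (rule N.r_coset_hom_Mod)

sublocale cs: group_hom P Q cs
  using cs_hom by unfold_locales

lemma carrier_Q: "\<rho> \<in> carrier Q \<Longrightarrow> \<exists>u\<in>carrier P. \<rho> = cs u"
  by (auto simp: FactGroup_def RCOSETS_def cs_def)

lemma cs_one_iff: "u \<in> carrier P \<Longrightarrow> cs u = \<one>\<^bsub>Q\<^esub> \<longleftrightarrow> u \<in> N"
  using P.coset_join1[OF _ _ N.subgroup_axioms] P.coset_join2[OF _ N.subgroup_axioms]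
  by (auto simp: cs_def FactGroup_def)

lemma cs_eq_iff:
  assumes "u \<in> carrier P" "w \<in> carrier P"
  shows "cs u = cs w \<longleftrightarrow> u \<otimes>\<^bsub>P\<^esub> inv\<^bsub>P\<^esub> w \<in> N"
proof -
  have "u \<otimes>\<^bsub>P\<^esub> inv\<^bsub>P\<^esub> w \<in> N \<longleftrightarrow> cs u \<otimes>\<^bsub>Q\<^esub> inv\<^bsub>Q\<^esub> cs w = \<one>\<^bsub>Q\<^esub>"
    using assms by (simp add: cs_one_iff[symmetric])
  also have "\<dots> \<longleftrightarrow> cs u = cs w"
    using assms by (metis Q.inv_equality Q.inv_inv Q.inv_closed Q.r_inv cs.hom_closed)
  finally show ?thesis by simp
qed

lemma cs_rel: "(u, w) \<in> Rel \<Longrightarrow> cs u = cs w"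
proof -
  assume r: "(u, w) \<in> Rel"
  then have "u \<in> carrier P" "w \<in> carrier P" using Rel by auto
  moreover have "u \<otimes>\<^bsub>P\<^esub> inv\<^bsub>P\<^esub> w \<in> N" using r by (force simp: N_def normal_closure_def)
  ultimately show ?thesis by (simp add: cs_eq_iff)
qed

lemma word_factor:
  assumes "x # u \<in> carrier P" "g \<in> hom P H" "group H"
  shows "u \<in> carrier P" "fst x \<in> S"
    "g (x # u) = (if snd x then g (free_gen (fst x)) else inv\<^bsub>H\<^esub> g (free_gen (fst x))) \<otimes>\<^bsub>H\<^esub> g u"
proof -
  interpret g: group_hom P H g using assms P.is_group by (simp add: group_hom_def group_hom_axioms_def)
  show u: "u \<in> carrier P" and s: "fst x \<in> S" using assms(1) by (auto simp: free_group_def reduced_Cons)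
  have fg: "free_gen (fst x) \<in> carrier P" using s by (rule free_gen_closed)
  define y where "y = (if snd x then free_gen (fst x) else inv\<^bsub>P\<^esub> free_gen (fst x))"
  have y: "y = [x]" using inv_free_gen[OF s] by (cases x) (auto simp: y_def free_gen_def)
  have yc: "y \<in> carrier P" using fg by (simp add: y_def)
  have "push x u = x # u" using assms(1) by (cases u) (auto simp: free_group_def reduced_Cons)
  then have "x # u = y \<otimes>\<^bsub>P\<^esub> u" unfolding y by (simp add: free_group_def)
  then have "g (x # u) = g y \<otimes>\<^bsub>H\<^esub> g u" using yc u by simp
  then show "g (x # u) = (if snd x then g (free_gen (fst x)) else inv\<^bsub>H\<^esub> g (free_gen (fst x))) \<otimes>\<^bsub>H\<^esub> g u"
    using fg by (simp add: y_def)
qed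

end

locale satisfied_relators = relators S Rel + G: group G
  for S :: "'s set" and Rel and G :: "('g, 'z) monoid_scheme" +
  fixes f :: "'s \<Rightarrow> 'g"
  assumes f_closed: "f \<in> S \<rightarrow> carrier G"
    and satisfied: "(u, w) \<in> Rel \<Longrightarrow> word_eval G f u = word_eval G f w"
begin

abbreviation "E \<equiv> word_eval G f"

lemma E_hom: "E \<in> hom P G"
  by (rule word_eval_hom[OF G.is_group f_closed])

sublocale E: group_hom P G E
  using E_hom by unfold_locales

lemma E_gen: "s \<in> S \<Longrightarrow> E (free_gen s) = f s"
  using funcset_mem[OF f_closed] by (simp add: free_gen_def word_eval_Cons)

lemma N_kernel: "N \<subseteq> kernel P G E"
proof -
  have "(\<lambda>(u, w). u \<otimes>\<^bsub>P\<^esub> inv\<^bsub>P\<^esub> w) ` Rel \<subseteq> kernel P G E"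
  proof clarify
    fix u w assume r: "(u, w) \<in> Rel"
    then have "u \<in> carrier P" "w \<in> carrier P" using Rel by auto
    then show "u \<otimes>\<^bsub>P\<^esub> inv\<^bsub>P\<^esub> w \<in> kernel P G E" using satisfied[OF r] by (simp add: kernel_def)
  qed
  then show ?thesis using E.normal_kernel by (auto simp: N_def normal_closure_def)
qed

lemma factor_exists: "\<exists>pr. pr \<in> hom Q G \<and> (\<forall>x\<in>carrier P. pr (cs x) = E x)"
proof -
  have "E x = E y" if "x \<in> carrier P" "y \<in> carrier P" "N #>\<^bsub>P\<^esub> x = N #>\<^bsub>P\<^esub> y" for x y
  proof -
    have "x \<otimes>\<^bsub>P\<^esub> inv\<^bsub>P\<^esub> y \<in> N" using that cs_eq_iff by (simp add: cs_def)
    then have "E x \<otimes>\<^bsub>G\<^esub> inv\<^bsub>G\<^esub> E y = \<one>\<^bsub>G\<^esub>" using N_kernel that by (auto simp: kernel_def)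
    then show ?thesis using that by (metis G.inv_equality G.inv_inv G.inv_closed E.hom_closed)
  qed
  from FactGroup_universal[OF E_hom N_normal this] obtain g
    where "g \<in> hom Q G" "\<And>x. x \<in> carrier P \<Longrightarrow> g (N #>\<^bsub>P\<^esub> x) = E x" by blast
  then show ?thesis unfolding cs_def by blast
qed

definition pr :: "'s sword set \<Rightarrow> 'g" where
  "pr = (SOME pr. pr \<in> hom Q G \<and> (\<forall>x\<in>carrier P. pr (cs x) = E x))"

lemma pr_hom: "pr \<in> hom Q G" and pr_cs: "x \<in> carrier P \<Longrightarrow> pr (cs x) = E x"
  using someI_ex[OF factor_exists] by (auto simp: pr_def)

text \<open>Satisfied relations give one inclusion between the normal closure and the kernel; the second assumption is the other one.\<close>

lemma has_presentationI:
  assumes "\<And>\<phi>. \<phi> \<in> carrier G \<Longrightarrow> \<exists>u\<in>carrier P. E u = \<phi>"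
    and "\<And>u. u \<in> carrier P \<Longrightarrow> E u = \<one>\<^bsub>G\<^esub> \<Longrightarrow> cs u = \<one>\<^bsub>Q\<^esub>"
  shows "has_presentation G S f Rel"
proof -
  have "E ` carrier P = carrier G" using assms(1) by force
  moreover have "kernel P G E = N"
    using assms(2) N_kernel cs_one_iff by (auto simp: kernel_def)
  ultimately show ?thesis
    unfolding has_presentation_def using G.is_group f_closed Rel by (simp add: N_def)
qed

end

section \<open>The special automorphisms that fix an initial part of the basis\<close>

locale fixed_basis = free_basis F n v for F :: "('a, 'm) monoid_scheme" (structure) and n v +
  fixes l :: nat
  assumes l_n: "l \<le> n" and rank3: "n - l \<ge> 3"
begin

definition L' :: "'a set" where
  "L' = L - letters F v l"

lemma L'_lt: "L' = lt ` ({l + 1..n} \<times> UNIV)"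
proof -
  have "letters F v l = lt ` ({1..l} \<times> UNIV)" by (rule letters_lt[OF l_n])
  moreover have "inj_on lt ltrs" using lt_inject by (auto simp: inj_on_def)
  moreover have "{1..l} \<times> UNIV \<subseteq> ltrs" using l_n by auto
  ultimately have "L' = lt ` (ltrs - {1..l} \<times> UNIV)"
    unfolding L'_def L_lt by (simp add: inj_on_image_set_diff)
  also have "ltrs - {1..l} \<times> UNIV = {l + 1..n} \<times> UNIV" by auto
  finally show ?thesis .
qed

sublocale signed_letters L L' "m_inv F"
proof
  show "L' \<subseteq> L" by (auto simp: L'_def)
  show "inv a \<in> L'" if "a \<in> L'" for a
  proof -
    obtain x where x: "x \<in> {l + 1..n} \<times> UNIV" "a = lt x" using \<open>a \<in> L'\<close> by (auto simp: L'_lt)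
    then have "x \<in> ltrs" "opp x \<in> {l + 1..n} \<times> UNIV" using opp_mem by auto
    then show ?thesis using x by (auto simp: inv_lt L'_lt)
  qed
qed (use L_closed L_inv_neq in auto)

lemma third_letter:
  assumes "a \<in> L'" "b \<in> L'"
  shows "\<exists>e\<in>L'. e \<notin> {a, inv a, b, inv b}"
proof -
  obtain x y where xy: "x \<in> {l + 1..n} \<times> UNIV" "a = lt x" "y \<in> {l + 1..n} \<times> UNIV" "b = lt y"
    using assms by (auto simp: L'_lt)
  have lx: "x \<in> ltrs" "y \<in> ltrs" using xy by auto
  have "\<not> {l + 1..n} \<subseteq> {fst x, fst y}"
  proof
    assume "{l + 1..n} \<subseteq> {fst x, fst y}"
    then have "card {l + 1..n} \<le> card {fst x, fst y}" by (intro card_mono) auto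
    also have "\<dots> \<le> 2" by (simp add: card_insert_if)
    finally show False using rank3 by simp
  qed
  then obtain k where "k \<in> {l + 1..n}" "k \<notin> {fst x, fst y}" by blast
  then have k: "k \<in> {l + 1..n}" "k \<noteq> fst x" "k \<noteq> fst y" by auto
  have kl: "(k, True) \<in> ltrs" using k by auto
  have o: "opp x \<in> ltrs" "opp y \<in> ltrs" using lx opp_mem by blast+
  have "lt (k, True) \<notin> {a, inv a, b, inv b}"
    using k lx kl o lt_inject[OF kl] xy by (auto simp: inv_lt opp_def)
  moreover have "lt (k, True) \<in> L'" using k by (auto simp: L'_lt)
  ultimately show ?thesis by blast
qed

lemma adm_L: "adm a b \<Longrightarrow> a \<in> L" "adm a b \<Longrightarrow> b \<in> L" "adm a b \<Longrightarrow> a \<in> L'" "adm a b \<Longrightarrow> b \<noteq> a" "adm a b \<Longrightarrow> b \<noteq> inv a"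
  using L'_sub L_closed by (auto simp: adm_def)

lemma tr_auto: "adm a b \<Longrightarrow> tr a b \<in> auto F"
  using tr_props(1) adm_L by blast

lemma tr_eval:
  assumes "adm a b" "c \<in> L"
  shows "tr a b c = (if c = a then b \<otimes> a else if c = inv a then inv a \<otimes> inv b else c)"
proof -
  note p = tr_props[OF adm_L(1,2,4,5)[OF assms(1)]]
  have c: "a \<in> carrier F" "b \<in> carrier F" using adm_L assms(1) L_closed by auto
  then have "tr a b (inv a) = inv a \<otimes> inv b" using auto_eval(3)[OF p(1)] p(2) by (simp add: inv_mult_group)
  then show ?thesis using p assms(2) by auto
qed

lemma A_closed: "\<phi> \<in> auto F \<Longrightarrow> \<psi> \<in> auto F \<Longrightarrow> \<phi> \<otimes>\<^bsub>A\<^esub> \<psi> \<in> auto F"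
  using monoid.m_closed[OF group.is_monoid[OF A_group]] by (simp add: A_simps)

lemma A_one: "\<one>\<^bsub>A\<^esub> \<in> auto F"
  using monoid.one_closed[OF group.is_monoid[OF A_group]] by (simp add: A_simps)

lemma tr_inverse:
  assumes "adm a b"
  shows "tr a b \<otimes>\<^bsub>A\<^esub> tr a (inv b) = \<one>\<^bsub>A\<^esub>"
proof (rule auto_letters_eqI)
  note ad = assms adm_i(1)[OF assms]
  have c: "a \<in> carrier F" "b \<in> carrier F" "a \<in> L" "b \<in> L" "inv b \<in> L" "b \<noteq> a" "b \<noteq> inv a" "inv b \<noteq> a" "inv b \<noteq> inv a"
    using adm_L[OF ad(1)] adm_L[OF ad(2)] L_closed by auto
  fix x assume x: "x \<in> L"
  show "(tr a b \<otimes>\<^bsub>A\<^esub> tr a (inv b)) x = \<one>\<^bsub>A\<^esub> x \<or> (tr a b \<otimes>\<^bsub>A\<^esub> tr a (inv b)) (inv x) = \<one>\<^bsub>A\<^esub> (inv x)"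
  proof (cases "x = a \<or> x = inv a")
    case True
    have "(tr a b \<otimes>\<^bsub>A\<^esub> tr a (inv b)) a = \<one>\<^bsub>A\<^esub> a"
      using c ad by (simp add: A_mult tr_auto tr_eval auto_eval(2)[OF tr_auto] A_simps m_assoc[symmetric])
    then show ?thesis using True c by auto
  next
    case False
    then show ?thesis using c ad x L_closed by (simp add: A_mult tr_auto tr_eval A_simps)
  qed
qed (use assms adm_i in \<open>auto simp: A_closed A_one tr_auto\<close>)

lemma tr_commute:
  assumes ad: "adm a b" "adm c d" and ne: "b \<noteq> c" "b \<noteq> inv c" "a \<noteq> d" "a \<noteq> inv d" "a \<noteq> c"
  shows "tr a b \<otimes>\<^bsub>A\<^esub> tr c d = tr c d \<otimes>\<^bsub>A\<^esub> tr a b"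
proof (rule auto_letters_eqI)
  have c: "a \<in> carrier F" "b \<in> carrier F" "c \<in> carrier F" "d \<in> carrier F" "a \<in> L" "b \<in> L" "c \<in> L" "d \<in> L"
     "b \<noteq> a" "b \<noteq> inv a" "d \<noteq> c" "d \<noteq> inv c" "inv a \<in> L" "inv b \<in> L" "inv c \<in> L" "inv d \<in> L"
    using adm_L[OF ad(1)] adm_L[OF ad(2)] L_closed by auto
  have da: "d \<noteq> a" "d \<noteq> inv a" "c \<noteq> a" using ne c by auto
  note simps = A_mult tr_auto tr_eval auto_eval(2)[OF tr_auto] A_simps
  let ?x = "tr a b \<otimes>\<^bsub>A\<^esub> tr c d" and ?y = "tr c d \<otimes>\<^bsub>A\<^esub> tr a b"
  have xa: "?x a = ?y a"
  proof (cases "a = inv c")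
    case True
    then have ac: "inv a = c" using c by simp
    have "tr c d a = a \<otimes> inv d" "tr a b a = b \<otimes> a" "tr a b (inv d) = inv d" "tr c d b = b"
      using ad c ne da ac True by (auto simp: tr_eval inv_eq_1_iff i_inject)
    then show ?thesis using ad c by (simp add: A_mult tr_auto auto_eval(2)[OF tr_auto] m_assoc)
  next
    case False
    then show ?thesis using ad c ne da by (simp add: simps)
  qed
  have yc: "?x c = ?y c"
  proof (cases "c = inv a")
    case True
    then have ac: "inv c = a" using c by simp
    have "tr c d c = d \<otimes> c" "tr a b c = c \<otimes> inv b" "tr a b d = d" "tr c d (inv b) = inv b"
      using ad c ne da ac True by (auto simp: tr_eval i_inject)
    then show ?thesis using ad c by (simp add: A_mult tr_auto auto_eval(2)[OF tr_auto] m_assoc)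
  next
    case False
    have "a \<noteq> inv c" using False c by auto
    then show ?thesis using ad c ne da False by (simp add: simps)
  qed
  fix x assume x: "x \<in> L"
  consider "x = a \<or> inv x = a" | "x = c \<or> inv x = c" | "x \<noteq> a" "x \<noteq> inv a" "x \<noteq> c" "x \<noteq> inv c"
    using i_eq_iff[OF x c(5)] i_eq_iff[OF x c(7)] by blast
  then show "?x x = ?y x \<or> ?x (inv x) = ?y (inv x)"
  proof cases
    case 3
    then show ?thesis using ad c x L_closed by (simp add: A_mult tr_auto tr_eval)
  qed (use xa yc in auto)
qed (use ad in \<open>auto simp: A_closed tr_auto\<close>)

lemma tr_triangle:
  assumes ad: "adm b (inv a)" "adm c (inv b)" "adm c a"
  shows "tr b (inv a) \<otimes>\<^bsub>A\<^esub> tr c (inv b) = tr c a \<otimes>\<^bsub>A\<^esub> (tr c (inv b) \<otimes>\<^bsub>A\<^esub> tr b (inv a))"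
proof (rule auto_letters_eqI)
  let ?x = "tr b (inv a)" and ?y = "tr c (inv b)" and ?z = "tr c a"
  have c: "a \<in> carrier F" "b \<in> carrier F" "c \<in> carrier F" "a \<in> L" "b \<in> L" "c \<in> L" "inv a \<in> L" "inv b \<in> L" "inv c \<in> L"
    using adm_L[OF ad(1)] adm_L[OF ad(2)] adm_L[OF ad(3)] L_closed by auto
  have ne: "inv a \<noteq> b" "inv a \<noteq> inv b" "a \<noteq> b" "a \<noteq> inv b" "inv b \<noteq> c" "inv b \<noteq> inv c" "b \<noteq> c" "b \<noteq> inv c"
    "a \<noteq> c" "a \<noteq> inv c" "inv a \<noteq> c" "inv a \<noteq> inv c" "c \<noteq> b" "c \<noteq> inv b" "inv b \<noteq> b" "inv c \<noteq> c"
    using ad c L_inv_neq by (auto simp: adm_def i_eq_iff i_inject)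
  have e: "?x b = inv a \<otimes> b" "?x c = c" "?x (inv b) = inv b \<otimes> a" "?x (inv a) = inv a" "?x a = a"
    "?y b = b" "?y c = inv b \<otimes> c" "?y a = a" "?y (inv a) = inv a"
    "?z a = a" "?z b = b" "?z (inv a) = inv a" "?z (inv b) = inv b" "?z c = a \<otimes> c"
    using ad c ne by (simp_all add: tr_eval)
  let ?l = "?x \<otimes>\<^bsub>A\<^esub> ?y" and ?r = "?z \<otimes>\<^bsub>A\<^esub> (?y \<otimes>\<^bsub>A\<^esub> ?x)"
  have lr: "?l x = ?x (?y x)" "?r x = ?z (?y (?x x))" if "x \<in> carrier F" for x
    using that ad by (simp_all add: A_mult tr_auto A_closed auto_eval(1)[OF tr_auto])
  note hom = auto_eval(2)[OF tr_auto]
  have b: "?l b = ?r b" using e c ad by (simp add: lr hom)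
  have cc: "?l c = ?r c" using e c ad by (simp add: lr hom m_assoc)
  fix x assume x: "x \<in> L"
  consider "x = b \<or> inv x = b" | "x = c \<or> inv x = c" | "x \<noteq> b" "x \<noteq> inv b" "x \<noteq> c" "x \<noteq> inv c"
    using i_eq_iff[OF x c(5)] i_eq_iff[OF x c(6)] by blast
  then show "?l x = ?r x \<or> ?l (inv x) = ?r (inv x)"
  proof cases
    case 3
    then show ?thesis using ad c x L_closed by (simp add: lr tr_eval)
  qed (use b cc in auto)
qed (use ad in \<open>auto simp: A_closed tr_auto\<close>)

text \<open>Since automorphisms compose from right to left, \<open>b\<close> is mapped by the rightmost factor to \<open>a b\<close> and by the next one to
  \<open>a\<close>, while \<open>a\<close> goes to \<open>a\<close> times the inverse of \<open>b\<close> and then to the inverse of \<open>b\<close>.\<close>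

lemma turn_product:
  assumes ab: "adm a b" "b \<in> L'"
  defines "\<omega> \<equiv> tr (inv b) (inv a) \<otimes>\<^bsub>A\<^esub> tr (inv a) b \<otimes>\<^bsub>A\<^esub> tr b a"
  shows "\<omega> \<in> auto F" "\<And>c. c \<in> L \<Longrightarrow> \<omega> c = sw a b c"
proof -
  have ad: "adm (inv b) (inv a)" "adm (inv a) b" "adm b a" using ab by (auto simp: adm_i adm_sym)
  show w: "\<omega> \<in> auto F" using ad by (simp add: \<omega>_def A_closed tr_auto)
  have c: "a \<in> carrier F" "b \<in> carrier F" "a \<in> L" "b \<in> L" "inv a \<in> L" "inv b \<in> L"
    using adm_L[OF ab(1)] L_closed by auto
  have ne: "a \<noteq> b" "b \<noteq> a" "b \<noteq> inv a" "a \<noteq> inv b" "inv a \<noteq> inv b" "inv b \<noteq> inv a" "inv b \<noteq> a" "inv a \<noteq> b"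
    "inv a \<noteq> a" "inv b \<noteq> b" "a \<noteq> inv a" "b \<noteq> inv b"
    using ab c L_inv_neq[OF c(3)] L_inv_neq[OF c(4)] by (auto simp: adm_def i_eq_iff i_inject)
  have ev: "\<omega> x = tr (inv b) (inv a) (tr (inv a) b (tr b a x))" if "x \<in> carrier F" for x
    using that ad by (simp add: \<omega>_def A_mult tr_auto A_closed auto_eval(1)[OF tr_auto])
  note hom = auto_eval(2)[OF tr_auto]
  have e: "tr b a a = a" "tr b a b = a \<otimes> b" "tr (inv a) b a = a \<otimes> inv b" "tr (inv a) b b = b"
    "tr (inv b) (inv a) a = a" "tr (inv b) (inv a) (inv b) = inv a \<otimes> inv b"
    using ad c ne by (simp_all add: tr_eval)
  have a: "\<omega> a = inv b" using e c ad by (simp add: ev hom m_assoc[symmetric])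
  have b: "\<omega> b = a" using e c ad by (simp add: ev hom m_assoc)
  fix x assume x: "x \<in> L"
  consider "x = a" | "x = inv a" | "x = b" | "x = inv b" | "x \<notin> {a, inv a, b, inv b}" by blast
  then show "\<omega> x = sw a b x"
  proof cases
    case 5
    then show ?thesis using ad c x L_closed by (simp add: ev tr_eval sw_other)
  qed (use a b c ab auto_eval(3)[OF w] in \<open>auto simp: sw_values\<close>)
qed

lemma swap_aut_product:
  assumes ab: "adm a b" "b \<in> L'"
  shows "swap_aut F L a b = tr (inv b) (inv a) \<otimes>\<^bsub>A\<^esub> tr (inv a) b \<otimes>\<^bsub>A\<^esub> tr b a"
proof -
  define \<omega> where "\<omega> = tr (inv b) (inv a) \<otimes>\<^bsub>A\<^esub> tr (inv a) b \<otimes>\<^bsub>A\<^esub> tr b a"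
  note w = turn_product[OF ab, folded \<omega>_def]
  have c: "a \<in> L" "b \<in> L" "a \<in> carrier F" "b \<in> carrier F" using adm_L[OF ab(1)] L_closed by auto
  have wab: "\<omega> a = inv b" "\<omega> b = a" using w(2)[OF c(1)] w(2)[OF c(2)] sw_values[OF ab] by simp_all
  have wo: "\<omega> x = x" if "x \<in> L - {a, inv a, b, inv b}" for x
    using w(2)[of x] that sw_other[of x a b] by auto
  have "swap_aut F L a b = \<omega>"
    unfolding swap_aut_def
  proof (rule the_equality)
    show "\<omega> \<in> auto F \<and> \<omega> a = inv b \<and> \<omega> b = a \<and> (\<forall>x\<in>L - {a, inv a, b, inv b}. \<omega> x = x)"
      using w(1) wab wo by blast
    fix \<phi>
    assume p: "\<phi> \<in> auto F \<and> \<phi> a = inv b \<and> \<phi> b = a \<and> (\<forall>x\<in>L - {a, inv a, b, inv b}. \<phi> x = x)"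
    then have pa: "\<phi> \<in> auto F" by blast
    show "\<phi> = \<omega>"
    proof (rule auto_letters_eqI[OF pa w(1)])
      fix x assume x: "x \<in> L"
      consider "x = a \<or> inv x = a" | "x = b \<or> inv x = b" | "x \<notin> {a, inv a, b, inv b}"
        using i_eq_iff[OF x c(1)] i_eq_iff[OF x c(2)] by blast
      then show "\<phi> x = \<omega> x \<or> \<phi> (inv x) = \<omega> (inv x)"
      proof cases
        case 3
        then have "\<phi> x = x" using p x by blast
        then show ?thesis using wo[of x] 3 x by simp
      qed (use p wab in auto)
    qed
  qed
  then show ?thesis by (simp add: \<omega>_def)
qed

lemma swap_aut_eval:
  assumes "adm a b" "b \<in> L'"
  shows "swap_aut F L a b \<in> auto F" "\<And>c. c \<in> L \<Longrightarrow> swap_aut F L a b c = sw a b c"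
  using turn_product[OF assms] swap_aut_product[OF assms] by auto

subsection \<open>Determinants\<close>

abbreviation "im \<equiv> induced_matrix F n v"

lemma im_carrier: "im \<phi> \<in> carrier_mat n n"
  by (auto simp: induced_matrix_def mat_of_cols_def)

lemma im_col: "j < n \<Longrightarrow> col (im \<phi>) j = abelianization F n v (\<phi> (v (Suc j)))"
  by (simp add: induced_matrix_def)

lemma im_mult:
  assumes "\<phi> \<in> auto F" "\<psi> \<in> auto F"
  shows "im (\<phi> \<otimes>\<^bsub>A\<^esub> \<psi>) = im \<phi> * im \<psi>"
proof (rule mat_col_eqI)
  fix j assume "j < dim_col (im \<phi> * im \<psi>)"
  then have j: "j < n" using im_carrier[of \<psi>] by simp
  have vc: "v (Suc j) \<in> carrier F" using j v_closed(1) by auto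
  have "col (im (\<phi> \<otimes>\<^bsub>A\<^esub> \<psi>)) j = abelianization F n v (\<phi> (\<psi> (v (Suc j))))"
    using j assms vc by (simp add: im_col A_mult)
  also have "\<dots> = im \<phi> *\<^sub>v col (im \<psi>) j"
    using abelianization_auto[OF basis assms(1) auto_eval(1)[OF assms(2) vc]] j by (simp add: im_col)
  also have "\<dots> = col (im \<phi> * im \<psi>) j"
    using col_mult2[OF im_carrier im_carrier j] by simp
  finally show "col (im (\<phi> \<otimes>\<^bsub>A\<^esub> \<psi>)) j = col (im \<phi> * im \<psi>) j" .
qed (use im_carrier[of "\<phi> \<otimes>\<^bsub>A\<^esub> \<psi>"] im_carrier[of \<phi>] im_carrier[of \<psi>] in auto)

lemma det_im_mult: "\<phi> \<in> auto F \<Longrightarrow> \<psi> \<in> auto F \<Longrightarrow> det (im (\<phi> \<otimes>\<^bsub>A\<^esub> \<psi>)) = det (im \<phi>) * det (im \<psi>)"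
  by (simp add: im_mult det_mult[OF im_carrier im_carrier])

lemma det_im_one: "det (im \<one>\<^bsub>A\<^esub>) = 1"
proof -
  have "im \<one>\<^bsub>A\<^esub> = 1\<^sub>m n"
  proof (rule mat_col_eqI)
    fix j assume "j < dim_col (1\<^sub>m n :: int mat)"
    then have j: "j < n" by simp
    have "v (Suc j) \<in> carrier F" using j v_closed(1) by auto
    then show "col (im \<one>\<^bsub>A\<^esub>) j = col (1\<^sub>m n) j"
      using j abelianization_basis[OF basis j] by (simp add: im_col A_simps)
  qed (use im_carrier[of "\<one>\<^bsub>A\<^esub>"] in auto)
  then show ?thesis by simp
qed

lemma det_im_inverse:
  assumes "\<phi> \<in> auto F"
  shows "det (im \<phi>) * det (im (inv\<^bsub>A\<^esub> \<phi>)) = 1"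
proof -
  have "inv\<^bsub>A\<^esub> \<phi> \<in> auto F" using group.inv_closed[OF A_group] assms by (simp add: A_simps)
  moreover have "\<phi> \<otimes>\<^bsub>A\<^esub> inv\<^bsub>A\<^esub> \<phi> = \<one>\<^bsub>A\<^esub>" using group.r_inv[OF A_group] assms by (simp add: A_simps)
  ultimately show ?thesis using det_im_mult[OF assms] det_im_one by metis
qed

text \<open>The triangle relation makes \<open>tr c a\<close> a commutator, so that its determinant is 1.\<close>

lemma det_tr:
  assumes "adm c a"
  shows "det (im (tr c a)) = 1"
proof -
  have c: "c \<in> L'" "a \<in> L" "c \<in> L" "a \<noteq> c" "a \<noteq> inv c" "c \<in> carrier F" "a \<in> carrier F" 
    using adm_L[OF assms] L_closed by auto
  have "\<exists>b\<in>L'. b \<notin> {c, inv c, a, inv a}"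
  proof (cases "a \<in> L'")
    case True
    then show ?thesis using third_letter[OF c(1)] by blast
  next
    case False
    then have "inv a \<notin> L'" using i_L'[of "inv a"] c by auto
    then show ?thesis using third_letter[OF c(1) c(1)] False by auto
  qed
  then obtain b where b: "b \<in> L'" "b \<notin> {c, inv c, a, inv a}" by blast
  have bF: "b \<in> L" "b \<in> carrier F" using b L'_sub L_closed by auto
  have ad: "adm b (inv a)" "adm c (inv b)"
    using b c bF L_closed by (auto simp: adm_def i_eq_iff i_inject)
  let ?x = "tr b (inv a)" and ?y = "tr c (inv b)"
  have au: "?x \<in> auto F" "?y \<in> auto F" "tr c a \<in> auto F" using ad assms tr_auto by auto
  have "det (im ?x) * det (im ?y) = det (im (tr c a)) * (det (im ?y) * det (im ?x))"
    using tr_triangle[OF ad assms] au by (metis det_im_mult A_closed)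
  moreover have "det (im ?x) \<noteq> 0" "det (im ?y) \<noteq> 0"
    using det_im_inverse[OF au(1)] det_im_inverse[OF au(2)] by auto
  ultimately show ?thesis by simp
qed

definition H :: "('a \<Rightarrow> 'a) set" where
  "H = {\<phi> \<in> auto F. det (im \<phi>) = 1 \<and> (\<forall>x\<in>v ` {1..l}. \<phi> x = x)}"

abbreviation "G \<equiv> SAut_fixing F n v (v ` {1..l})"

lemma G_eq: "G = A\<lparr>carrier := H\<rparr>"
  by (simp add: SAut_fixing_def SAut_def H_def)

lemma H_subgroup: "subgroup H A"
proof -
  interpret A: group A by (rule A_group)
  show ?thesis
  proof (rule A.subgroupI)
    show "H \<subseteq> carrier A" by (auto simp: H_def A_simps)
    have "\<one>\<^bsub>A\<^esub> \<in> H"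
      using A_one det_im_one v_closed(1) l_n by (auto simp: H_def A_simps)
    then show "H \<noteq> {}" by blast
    fix \<phi> assume p: "\<phi> \<in> H"
    then have pa: "\<phi> \<in> auto F" by (simp add: H_def)
    then have ia: "inv\<^bsub>A\<^esub> \<phi> \<in> auto F" using A.inv_closed[of \<phi>] by (simp add: A_simps)
    have "(inv\<^bsub>A\<^esub> \<phi>) x = x" if "x \<in> v ` {1..l}" for x
    proof -
      have x: "x \<in> carrier F" "\<phi> x = x" using that p v_closed(1) l_n by (auto simp: H_def)
      have "(inv\<^bsub>A\<^esub> \<phi>) (\<phi> x) = (inv\<^bsub>A\<^esub> \<phi> \<otimes>\<^bsub>A\<^esub> \<phi>) x" using x pa ia by (simp add: A_mult)
      also have "\<dots> = x" using A.l_inv[of \<phi>] pa x by (simp add: A_simps)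
      finally show ?thesis using x by simp
    qed
    then show "inv\<^bsub>A\<^esub> \<phi> \<in> H" using p ia det_im_inverse[OF pa] by (simp add: H_def)
    fix \<psi> assume q: "\<psi> \<in> H"
    show "\<phi> \<otimes>\<^bsub>A\<^esub> \<psi> \<in> H"
      using p q v_closed(1) l_n by (auto simp: H_def A_closed det_im_mult A_mult)
  qed
qed

lemma G_group: "group G"
  unfolding G_eq using group.subgroup_imp_group[OF A_group H_subgroup] .

lemma G_simps: "carrier G = H" "\<phi> \<otimes>\<^bsub>G\<^esub> \<psi> = \<phi> \<otimes>\<^bsub>A\<^esub> \<psi>" "\<one>\<^bsub>G\<^esub> = \<one>\<^bsub>A\<^esub>"
  by (simp_all add: G_eq)

lemma H_auto: "\<phi> \<in> H \<Longrightarrow> \<phi> \<in> auto F"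
  by (simp add: H_def)

lemma v_fixed_L: "k \<in> {1..l} \<Longrightarrow> v k \<in> L" "k \<in> {1..l} \<Longrightarrow> v k \<notin> L'"
  using l_n by (auto simp: L'_def letters_def)

lemma H_fix:
  assumes "\<phi> \<in> H" "c \<in> L" "c \<notin> L'"
  shows "\<phi> c = c"
proof -
  obtain k where k: "k \<in> {1..l}" "c = v k \<or> c = inv (v k)"
  proof -
    have "c \<in> letters F v l" using assms(2,3) by (simp add: L'_def)
    then show ?thesis using that by (auto simp: letters_def)
  qed
  then have "\<phi> (v k) = v k" "v k \<in> carrier F" using assms v_closed(1) l_n by (auto simp: H_def)
  then show ?thesis using k auto_eval(3)[OF H_auto[OF assms(1)]] by auto
qed

lemma tr_H: "adm a b \<Longrightarrow> tr a b \<in> H"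
proof -
  assume ad: "adm a b"
  have "tr a b (v k) = v k" if "k \<in> {1..l}" for k
    using v_fixed_L[OF that] ad adm_L(3)[OF ad] i_L'[of a] by (auto simp: tr_eval)
  then show ?thesis using ad by (simp add: H_def tr_auto det_tr)
qed

lemma H_mult: "\<phi> \<in> H \<Longrightarrow> \<psi> \<in> H \<Longrightarrow> \<phi> \<otimes>\<^bsub>A\<^esub> \<psi> \<in> H"
  using H_subgroup by (rule subgroup.m_closed)

lemma swap_H: "adm a b \<Longrightarrow> b \<in> L' \<Longrightarrow> swap_aut F L a b \<in> H"
  by (simp add: swap_aut_product H_mult tr_H adm_i adm_sym)

text \<open>An automorphism that inverts one basis element and fixes the others has a diagonal matrix with determinant -1.\<close>

lemma reflection_det:
  assumes "\<phi> \<in> H" "c \<in> L'" and other: "\<And>a. a \<in> L \<Longrightarrow> a \<noteq> c \<Longrightarrow> a \<noteq> inv c \<Longrightarrow> \<phi> a = a"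
    and "\<phi> c \<in> {c, inv c}"
  shows "\<phi> c = c"
proof (rule ccontr)
  assume nc: "\<phi> c \<noteq> c"
  have cc: "c \<in> carrier F" "c \<in> L" using assms(2) L'_sub L_closed by auto
  then obtain k where k: "k \<in> {1..n}" "c = v k \<or> c = inv (v k)" by (auto simp: letters_def)
  define j where "j = k - 1"
  have j: "j < n" "Suc j = k" using k by (auto simp: j_def)
  have vk: "v k \<in> carrier F" using k v_closed(1) by auto
  have pa: "\<phi> \<in> auto F" using assms H_auto by simp
  have "\<phi> c = inv c" using nc assms(4) by simp
  then have pk: "\<phi> (v k) = inv (v k)" using k(2) vk auto_eval[OF pa vk] by (metis inv_inv)
  let ?D = "mat n n (\<lambda>(i, i'). if i = i' then if i = j then -1 else 1 else 0 :: int)"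
  have "im \<phi> = ?D"
  proof (rule mat_col_eqI)
    fix i assume "i < dim_col ?D"
    then have i: "i < n" by simp
    have vi: "v (Suc i) \<in> L" "v (Suc i) \<in> carrier F" using i v_closed(1) by (auto simp: letters_def)
    show "col (im \<phi>) i = col ?D i"
    proof (cases "i = j")
      case True
      have "abelianization F n v (inv (v k)) + abelianization F n v (v k) = abelianization F n v \<one>"
        using abelianization_mult[OF basis inv_closed[OF vk] vk] vk by simp
      moreover have "abelianization F n v \<one> = 0\<^sub>v n"
        using wd_one by (intro eq_vecI) (auto simp: abelianization_def wd_def exp_sum_def)
      moreover have "abelianization F n v (v k) = unit_vec n j" using abelianization_basis[OF basis j(1)] j by simp
      ultimately have s: "abelianization F n v (inv (v k)) + unit_vec n j = 0\<^sub>v n" by simp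
      have "abelianization F n v (inv (v k)) $ i' = (if i' = j then -1 else 0)" if "i' < n" for i'
      proof -
        have "(abelianization F n v (inv (v k)) + unit_vec n j) $ i' = 0" using s that by simp
        then show ?thesis using that j by (auto simp: unit_vec_def split: if_splits)
      qed
      then show ?thesis using True i j pk by (intro eq_vecI) (auto simp: im_col)
    next
      case False
      have "v (Suc i) \<noteq> v k" "v (Suc i) \<noteq> inv (v k)"
        using lt_inject[of "(Suc i, True)" "(k, True)"] lt_inject[of "(Suc i, True)" "(k, False)"] i k False j
        by (auto simp: lt_def)
      then have "\<phi> (v (Suc i)) = v (Suc i)" using k(2) vk by (intro other vi) auto
      then show ?thesis
        using False i abelianization_basis[OF basis i] by (intro eq_vecI) (auto simp: im_col unit_vec_def)
    qed
  qed (use im_carrier[of \<phi>] in auto)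
  moreover have "det ?D = -1"
  proof -
    have "det ?D = prod_list (diag_mat ?D)" by (rule det_upper_triangular) auto
    also have "diag_mat ?D = map (\<lambda>i. if i = j then -1 else 1) [0..<n]" by (auto simp: diag_mat_def)
    also have "prod_list \<dots> = (\<Prod>i\<in>{0..<n}. if i = j then -1 else 1)"
      using prod.distinct_set_conv_list[of "[0..<n]" "\<lambda>i. if i = j then -1 else (1::int)"] by simp
    also have "\<dots> = -1" using j by (simp add: prod.delta)
    finally show ?thesis .
  qed
  ultimately show False using assms(1) by (simp add: H_def)
qed

end

section \<open>The presentation\<close>

lemma (in group) commutator_eqI:
  assumes "x \<in> carrier G" "y \<in> carrier G" "z \<in> carrier G" "x \<otimes> y = z \<otimes> (y \<otimes> x)"
  shows "commutator G x y = z"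
proof -
  have "commutator G x y = z \<otimes> (y \<otimes> x) \<otimes> inv x \<otimes> inv y" using assms by (simp add: commutator_def)
  also have "\<dots> = z" using assms(1-3) by (simp add: m_assoc)
  finally show ?thesis .
qed

lemma (in group_hom) hom_commutator:
  "x \<in> carrier G \<Longrightarrow> y \<in> carrier G \<Longrightarrow> h (commutator G x y) = commutator H (h x) (h y)"
  by (simp add: commutator_def)

lemma relations_cases:
  assumes "(u, t) \<in> relations F S"
  obtains
    (inverse) a b where "M a b \<in> S" "M a (inv\<^bsub>F\<^esub> b) \<in> S"
      "u = free_gen (M a b) \<otimes>\<^bsub>free_group S\<^esub> free_gen (M a (inv\<^bsub>F\<^esub> b))" "t = \<one>\<^bsub>free_group S\<^esub>"
  | (commute) a b c d where "M a b \<in> S" "M c d \<in> S" "b \<noteq> c" "b \<noteq> inv\<^bsub>F\<^esub> c" "a \<noteq> d" "a \<noteq> inv\<^bsub>F\<^esub> d" "a \<noteq> c"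
      "u = commutator (free_group S) (free_gen (M a b)) (free_gen (M c d))" "t = \<one>\<^bsub>free_group S\<^esub>"
  | (triangle) a b c where "M b (inv\<^bsub>F\<^esub> a) \<in> S" "M c (inv\<^bsub>F\<^esub> b) \<in> S" "M c a \<in> S"
      "u = commutator (free_group S) (free_gen (M b (inv\<^bsub>F\<^esub> a))) (free_gen (M c (inv\<^bsub>F\<^esub> b)))" "t = free_gen (M c a)"
  | (turn) a b where "W a b \<in> S" "M (inv\<^bsub>F\<^esub> b) (inv\<^bsub>F\<^esub> a) \<in> S" "M (inv\<^bsub>F\<^esub> a) b \<in> S" "M b a \<in> S"
      "u = free_gen (W a b)" "t = free_gen (M (inv\<^bsub>F\<^esub> b) (inv\<^bsub>F\<^esub> a)) \<otimes>\<^bsub>free_group S\<^esub>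
        free_gen (M (inv\<^bsub>F\<^esub> a) b) \<otimes>\<^bsub>free_group S\<^esub> free_gen (M b a)"
  | (flip) a b where "W a b \<in> S" "W (inv\<^bsub>F\<^esub> a) (inv\<^bsub>F\<^esub> b) \<in> S" "u = free_gen (W a b)"
      "t = free_gen (W (inv\<^bsub>F\<^esub> a) (inv\<^bsub>F\<^esub> b))"
  | (order) a b where "W a b \<in> S" "u = free_gen (W a b) [^]\<^bsub>free_group S\<^esub> (4::nat)" "t = \<one>\<^bsub>free_group S\<^esub>"
  using assms unfolding relations_def Let_def
proof (elim UnE CollectE exE conjE Pair_inject)
qed (erule that, assumption+)+

lemma relations_intros:
  shows "M a b \<in> S \<Longrightarrow> M a (inv\<^bsub>F\<^esub> b) \<in> S \<Longrightarrow>
      (free_gen (M a b) \<otimes>\<^bsub>free_group S\<^esub> free_gen (M a (inv\<^bsub>F\<^esub> b)), \<one>\<^bsub>free_group S\<^esub>) \<in> relations F S"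
    and "M a b \<in> S \<Longrightarrow> M c d \<in> S \<Longrightarrow> b \<noteq> c \<Longrightarrow> b \<noteq> inv\<^bsub>F\<^esub> c \<Longrightarrow> a \<noteq> d \<Longrightarrow> a \<noteq> inv\<^bsub>F\<^esub> d \<Longrightarrow> a \<noteq> c \<Longrightarrow>
      (commutator (free_group S) (free_gen (M a b)) (free_gen (M c d)), \<one>\<^bsub>free_group S\<^esub>) \<in> relations F S"
    and "M b (inv\<^bsub>F\<^esub> a) \<in> S \<Longrightarrow> M c (inv\<^bsub>F\<^esub> b) \<in> S \<Longrightarrow> M c a \<in> S \<Longrightarrow>
      (commutator (free_group S) (free_gen (M b (inv\<^bsub>F\<^esub> a))) (free_gen (M c (inv\<^bsub>F\<^esub> b))), free_gen (M c a)) \<in> relations F S"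
    and "W a b \<in> S \<Longrightarrow> M (inv\<^bsub>F\<^esub> b) (inv\<^bsub>F\<^esub> a) \<in> S \<Longrightarrow> M (inv\<^bsub>F\<^esub> a) b \<in> S \<Longrightarrow> M b a \<in> S \<Longrightarrow>
      (free_gen (W a b), free_gen (M (inv\<^bsub>F\<^esub> b) (inv\<^bsub>F\<^esub> a)) \<otimes>\<^bsub>free_group S\<^esub>
        free_gen (M (inv\<^bsub>F\<^esub> a) b) \<otimes>\<^bsub>free_group S\<^esub> free_gen (M b a)) \<in> relations F S"
    and "W a b \<in> S \<Longrightarrow> W (inv\<^bsub>F\<^esub> a) (inv\<^bsub>F\<^esub> b) \<in> S \<Longrightarrow>
      (free_gen (W a b), free_gen (W (inv\<^bsub>F\<^esub> a) (inv\<^bsub>F\<^esub> b))) \<in> relations F S"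
    and "W a b \<in> S \<Longrightarrow> (free_gen (W a b) [^]\<^bsub>free_group S\<^esub> (4::nat), \<one>\<^bsub>free_group S\<^esub>) \<in> relations F S"
  unfolding relations_def Let_def by blast+

lemma relations_closed: "relations F S \<subseteq> carrier (free_group S) \<times> carrier (free_group S)"
proof clarify
  interpret P: group "free_group S" by (rule group_free_group)
  fix u t assume "(u, t) \<in> relations F S"
  then show "u \<in> carrier (free_group S) \<and> t \<in> carrier (free_group S)"
    by (cases rule: relations_cases) (simp_all add: free_gen_closed commutator_def)
qed

context fixed_basis
begin

abbreviation "S \<equiv> symbols F L L'"

lemma M_S: "M a b \<in> S \<longleftrightarrow> adm a b"
  by (auto simp: symbols_def adm_def)

lemma W_S: "W a b \<in> S \<longleftrightarrow> adm a b \<and> b \<in> L'"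
  using L'_sub by (auto simp: symbols_def adm_def)

lemma sw_flip: "adm a b \<Longrightarrow> b \<in> L' \<Longrightarrow> c \<in> L \<Longrightarrow> sw (inv a) (inv b) c = sw a b c"
  using adm_L[of a b] L_closed L_inv_neq by (auto simp: sw_def i_inject i_eq_iff)

lemma swap_flip:
  assumes "adm a b" "b \<in> L'"
  shows "swap_aut F L (inv a) (inv b) = swap_aut F L a b"
  using assms swap_aut_eval[of "inv a" "inv b"] swap_aut_eval[OF assms] sw_flip[OF assms]
  by (intro auto_letters_eqI) (auto simp: adm_i i_L')

lemma sw_order:
  assumes "adm a b" "b \<in> L'" "c \<in> L"
  shows "sw a b (sw a b (sw a b (sw a b c))) = c"
proof -
  have ii: "inv (inv a) = a" "inv (inv b) = b" using adm_L[OF assms(1)] L_closed by auto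
  note v = sw_values[OF assms(1,2)]
  consider "c = a" | "c = inv a" | "c = b" | "c = inv b" | "c \<notin> {a, inv a, b, inv b}" by blast
  then show ?thesis by cases (simp_all add: v ii sw_other)
qed

lemma swap_order:
  assumes "adm a b" "b \<in> L'"
  shows "swap_aut F L a b \<otimes>\<^bsub>A\<^esub> (swap_aut F L a b \<otimes>\<^bsub>A\<^esub> (swap_aut F L a b \<otimes>\<^bsub>A\<^esub> swap_aut F L a b)) = \<one>\<^bsub>A\<^esub>"
proof -
  define \<omega> where "\<omega> = swap_aut F L a b"
  have w: "\<omega> \<in> auto F" "\<And>c. c \<in> L \<Longrightarrow> \<omega> c = sw a b c" using swap_aut_eval[OF assms] by (auto simp: \<omega>_def)
  have "\<omega> \<otimes>\<^bsub>A\<^esub> (\<omega> \<otimes>\<^bsub>A\<^esub> (\<omega> \<otimes>\<^bsub>A\<^esub> \<omega>)) = \<one>\<^bsub>A\<^esub>"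
  proof (rule auto_letters_eqI)
    fix c assume c: "c \<in> L"
    have "(\<omega> \<otimes>\<^bsub>A\<^esub> (\<omega> \<otimes>\<^bsub>A\<^esub> (\<omega> \<otimes>\<^bsub>A\<^esub> \<omega>))) c = \<omega> (\<omega> (\<omega> (\<omega> c)))"
      using L_closed[OF c] by (simp add: A_mult w(1) A_closed auto_eval(1)[OF w(1)])
    also have "\<dots> = c" using c sw_L[OF assms] sw_order[OF assms c] by (simp add: w(2))
    finally show "(\<omega> \<otimes>\<^bsub>A\<^esub> (\<omega> \<otimes>\<^bsub>A\<^esub> (\<omega> \<otimes>\<^bsub>A\<^esub> \<omega>))) c = \<one>\<^bsub>A\<^esub> c \<or>
        (\<omega> \<otimes>\<^bsub>A\<^esub> (\<omega> \<otimes>\<^bsub>A\<^esub> (\<omega> \<otimes>\<^bsub>A\<^esub> \<omega>))) (inv c) = \<one>\<^bsub>A\<^esub> (inv c)"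
      using L_closed(1)[OF c] by (simp add: A_simps)
  qed (simp_all add: w A_closed A_one)
  then show ?thesis by (simp add: \<omega>_def)
qed

lemma symbol_aut_closed: "symbol_aut F L \<in> S \<rightarrow> carrier G"
proof
  fix s assume "s \<in> S"
  then show "symbol_aut F L s \<in> carrier G"
    by (cases s) (auto simp: M_S W_S G_simps tr_H swap_H)
qed

lemma relations_satisfied:
  assumes "(u, t) \<in> relations F S"
  shows "word_eval G (symbol_aut F L) u = word_eval G (symbol_aut F L) t"
proof -
  let ?E = "word_eval G (symbol_aut F L)"
  interpret G: group G by (rule G_group)
  interpret E: group_hom "free_group S" G ?E
    using word_eval_hom[OF G_group symbol_aut_closed] group_free_group[of S] G_group
    by (simp add: group_hom_def group_hom_axioms_def)
  have gen: "?E (free_gen s) = symbol_aut F L s" if "s \<in> S" for s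
    using funcset_mem[OF symbol_aut_closed that] by (simp add: free_gen_def word_eval_Cons)
  have cl: "free_gen s \<in> carrier (free_group S)" if "s \<in> S" for s using that by (rule free_gen_closed)
  from assms show ?thesis
  proof (cases rule: relations_cases)
    case (inverse a b)
    then show ?thesis by (simp add: cl gen M_S G_simps(2,3) tr_inverse)
  next
    case (commute a b c d)
    then have ad: "adm a b" "adm c d" by (auto simp: M_S)
    have t: "tr a b \<in> carrier G" "tr c d \<in> carrier G" using ad tr_H by (simp_all add: G_simps(1))
    have "commutator G (tr a b) (tr c d) = \<one>\<^bsub>G\<^esub>"
    proof (rule G.commutator_eqI)
      have "tr a b \<otimes>\<^bsub>G\<^esub> tr c d = tr c d \<otimes>\<^bsub>G\<^esub> tr a b"
        using tr_commute[OF ad] commute by (simp add: G_simps(2))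
      then show "tr a b \<otimes>\<^bsub>G\<^esub> tr c d = \<one>\<^bsub>G\<^esub> \<otimes>\<^bsub>G\<^esub> (tr c d \<otimes>\<^bsub>G\<^esub> tr a b)"
        using G.l_one[OF G.m_closed[OF t(2,1)]] by simp
    qed (use t in auto)
    then show ?thesis using commute by (simp add: E.hom_commutator cl gen)
  next
    case (triangle a b c)
    then have ad: "adm b (inv a)" "adm c (inv b)" "adm c a" by (auto simp: M_S)
    have "commutator G (tr b (inv a)) (tr c (inv b)) = tr c a"
      by (rule G.commutator_eqI) (use ad tr_H tr_triangle[OF ad] in \<open>auto simp: G_simps(1,2)\<close>)
    then show ?thesis using triangle by (simp add: E.hom_commutator cl gen)
  next
    case (turn a b)
    then show ?thesis by (simp add: cl gen W_S G_simps(2) swap_aut_product)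
  next
    case (flip a b)
    then have "adm a b" "b \<in> L'" by (auto simp: W_S)
    then show ?thesis using flip by (simp add: gen swap_flip)
  next
    case (order a b)
    then have ad: "adm a b" "b \<in> L'" by (auto simp: W_S)
    have t: "swap_aut F L a b \<in> carrier G" using swap_H[OF ad] by (simp add: G_simps(1))
    have "?E u = swap_aut F L a b [^]\<^bsub>G\<^esub> (4::nat)"
      using order by (simp add: E.hom_nat_pow cl gen)
    also have "\<dots> = swap_aut F L a b \<otimes>\<^bsub>G\<^esub> (swap_aut F L a b \<otimes>\<^bsub>G\<^esub> (swap_aut F L a b \<otimes>\<^bsub>G\<^esub> swap_aut F L a b))"
      using t by (simp add: numeral_eq_Suc G.m_assoc)
    also have "\<dots> = \<one>\<^bsub>G\<^esub>" using swap_order[OF ad] by (simp add: G_simps(2,3))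
    finally show ?thesis using order by simp
  qed
qed

sublocale rels: satisfied_relators S "relations F S" G "symbol_aut F L"
  using relations_closed[of F S] symbol_aut_closed relations_satisfied G_group
  by (simp add: satisfied_relators_def satisfied_relators_axioms_def relators_def)

abbreviation "QM a b \<equiv> rels.cs (free_gen (M a b))"
abbreviation "QW a b \<equiv> rels.cs (free_gen (W a b))"

lemma gen_closed: "adm a b \<Longrightarrow> free_gen (M a b) \<in> carrier (free_group S)"
  "adm a b \<Longrightarrow> b \<in> L' \<Longrightarrow> free_gen (W a b) \<in> carrier (free_group S)"
  by (simp_all add: free_gen_closed M_S W_S)

lemma gersten_quotient: "gersten L L' (m_inv F) rels.Q QM QW"
proof (intro gersten.intro gersten_axioms.intro)
  show "signed_letters L L' (m_inv F)" by unfold_locales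
  show "group rels.Q" by (rule rels.Q.is_group)
  note cl = gen_closed
  show "\<exists>e\<in>L'. e \<notin> {a, inv a, b, inv b}" if "a \<in> L'" "b \<in> L'" for a b
    using third_letter[OF that] .
  show "QM a b \<in> carrier rels.Q" if "adm a b" for a b
    using cl that by simp
  show "QW a b \<in> carrier rels.Q" if "adm a b" "b \<in> L'" for a b
    using cl that by simp
  show "QM a b \<otimes>\<^bsub>rels.Q\<^esub> QM a (inv b) = \<one>\<^bsub>rels.Q\<^esub>" if ad: "adm a b" for a b
    using rels.cs_rel[OF relations_intros(1)[of a b S F]] ad adm_i(1)[OF ad]
      rels.cs.hom_mult[OF cl(1)[OF ad] cl(1)[OF adm_i(1)[OF ad]]] rels.cs.hom_one
    by (simp add: M_S)
  show "commutator rels.Q (QM a b) (QM c d) = \<one>\<^bsub>rels.Q\<^esub>"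
    if "adm a b" "adm c d" "b \<noteq> c" "b \<noteq> inv c" "a \<noteq> d" "a \<noteq> inv d" "a \<noteq> c" for a b c d
    using rels.cs_rel[OF relations_intros(2)[of a b S c d F]] that
      rels.cs.hom_commutator[OF cl(1)[OF that(1)] cl(1)[OF that(2)]] rels.cs.hom_one
    by (simp add: M_S)
  show "commutator rels.Q (QM b (inv a)) (QM c (inv b)) = QM c a"
    if "adm b (inv a)" "adm c (inv b)" "adm c a" for a b c
    using rels.cs_rel[OF relations_intros(3)[of b F a S c]] that
      rels.cs.hom_commutator[OF cl(1)[OF that(1)] cl(1)[OF that(2)]]
    by (simp add: M_S)
  show "QW a b = QM (inv b) (inv a) \<otimes>\<^bsub>rels.Q\<^esub> QM (inv a) b \<otimes>\<^bsub>rels.Q\<^esub> QM b a"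
    if ab: "adm a b" "b \<in> L'" for a b
  proof -
    have ad: "adm (inv b) (inv a)" "adm (inv a) b" "adm b a" using ab by (auto simp: adm_i adm_sym)
    show ?thesis
      using rels.cs_rel[OF relations_intros(4)[of a b S F]] ad ab cl by (simp add: M_S W_S)
  qed
  show "QW a b = QW (inv a) (inv b)" if ab: "adm a b" "b \<in> L'" for a b
    using rels.cs_rel[OF relations_intros(5)[of a b S F]] ab by (simp add: W_S adm_i i_L')
  show "QW a b [^]\<^bsub>rels.Q\<^esub> (4::nat) = \<one>\<^bsub>rels.Q\<^esub>" if ab: "adm a b" "b \<in> L'" for a b
    using rels.cs_rel[OF relations_intros(6)[of a b S F]] ab cl(2)[OF ab] rels.cs.hom_one
    by (simp add: W_S rels.cs.hom_nat_pow)
qed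

lemma pr_QM: "adm a b \<Longrightarrow> rels.pr (QM a b) = tr a b"
  using rels.pr_cs gen_closed rels.E_gen by (simp add: M_S)

lemma pr_QW: "adm a b \<Longrightarrow> b \<in> L' \<Longrightarrow> rels.pr (QW a b) = swap_aut F L a b"
  using rels.pr_cs gen_closed rels.E_gen by (simp add: W_S)

lemma nielsen_quotient: "nielsen_action F G L L' rels.Q QM QW rels.pr R"
proof (intro nielsen_action.intro nielsen_action_axioms.intro)
  show "group F" by (rule is_group)
  show "group G" by (rule G_group)
  show "gersten L L' (m_inv F) rels.Q QM QW" by (rule gersten_quotient)
  show "finite L" by (simp add: letters_def)
  show "L \<subseteq> carrier F" using L_closed by auto
  show "rels.pr \<in> hom rels.Q G" by (rule rels.pr_hom)
  show "\<phi> \<in> hom F F" if "\<phi> \<in> carrier G" for \<phi>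
    using that autoD H_auto by (simp add: G_simps(1))
  show "inj_on \<phi> (carrier F)" if "\<phi> \<in> carrier G" for \<phi>
    using that autoD(2) H_auto by (auto simp: G_simps(1) bij_betw_def)
  show "(\<phi> \<otimes>\<^bsub>G\<^esub> \<psi>) x = \<phi> (\<psi> x)" if "\<phi> \<in> carrier G" "\<psi> \<in> carrier G" "x \<in> carrier F" for \<phi> \<psi> x
    using that H_auto by (simp add: G_simps(1,2) A_mult)
  show "\<one>\<^bsub>G\<^esub> x = x" if "x \<in> carrier F" for x using that by (simp add: G_simps(3) A_simps)
  show "\<phi> = \<psi>" if "\<phi> \<in> carrier G" "\<psi> \<in> carrier G" "\<And>c. c \<in> L \<Longrightarrow> \<phi> c = \<psi> c" for \<phi> \<psi>
    using that H_auto by (intro auto_letters_eqI) (auto simp: G_simps(1))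
  show "\<phi> c = c" if "\<phi> \<in> carrier G" "c \<in> L" "c \<notin> L'" for \<phi> c
    using that H_fix by (simp add: G_simps(1))
  show "rels.pr (QM a b) a = b \<otimes> a" if "adm a b" for a b
    using that adm_L(1)[OF that] by (simp add: pr_QM tr_eval)
  show "rels.pr (QM a b) c = c" if "adm a b" "c \<in> L" "c \<noteq> a" "c \<noteq> inv a" for a b c
    using that by (simp add: pr_QM tr_eval)
  show "rels.pr (QW a b) c = sw a b c" if "adm a b" "b \<in> L'" "c \<in> L" for a b c
    using that by (simp add: pr_QW swap_aut_eval)
  show "b \<noteq> inv a \<otimes> inv a" if "adm a b" for a b
  proof -
    have "inv a \<in> lt ` ltrs" "b \<in> lt ` ltrs" using adm_L[OF that] L_closed by (auto simp: L_lt)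
    then show ?thesis using lt_not_square by auto
  qed
  show "R (inv x) = R x" if "x \<in> carrier F" for x using that by (simp add: R_def wd_inv)
  show "x = y \<or> x = inv y" if "x \<in> carrier F" "y \<in> carrier F" "R x = R y" for x y
  proof -
    have "wd x = wd y \<or> wd x = wd (inv y)"
      using rank_inject[OF wd_words[OF that(1)] wd_words[OF that(2)]] that by (simp add: R_def wd_inv)
    then show ?thesis using that wd_inject by simp
  qed
  show "R (inv z \<otimes> t) < R (inv x \<otimes> y)"
    if "x \<in> carrier F" "y \<in> carrier F" "z \<in> carrier F" "t \<in> carrier F"
      "R (inv x \<otimes> z) < R (inv x \<otimes> y)" "R (inv z \<otimes> y) < R (inv x \<otimes> y)"
      "R (inv x \<otimes> t) < R (inv x \<otimes> y)" "R (inv t \<otimes> y) < R (inv x \<otimes> y)" for x y z t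
    using rank_lens_dist[of "wd x" n "wd y" "wd z" "wd t"] that by (simp add: R_diff wd_words)
  show "R (inv t \<otimes> y) < R (inv x \<otimes> y)"
    if "x \<in> carrier F" "y \<in> carrier F" "z \<in> carrier F" "t \<in> carrier F"
      "R (inv x \<otimes> z) < R (inv x \<otimes> y)" "R (inv z \<otimes> y) < R (inv x \<otimes> y)"
      "R (inv x \<otimes> t) < R (inv x \<otimes> z)" "R (inv t \<otimes> z) < R (inv x \<otimes> z)" for x y z t
    using rank_lens_trans[of "wd x" n "wd y" "wd z" "wd t"] that by (simp add: R_diff wd_words)
  show "\<not> R (inv y \<otimes> x) < R x" if "x \<in> carrier F" "y \<in> carrier F" "y \<noteq> \<one>" "R (y \<otimes> x) < R x" for x y
    using R_not_double that by blast
  show "\<not> R x < R b" if "b \<in> L" "x \<in> carrier F" "R (b \<otimes> x) < R b" for b x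
  proof -
    obtain z where z: "z \<in> ltrs" "b = lt z" using \<open>b \<in> L\<close> by (auto simp: L_lt)
    then show ?thesis
      using letter_not_max[OF single_word[OF z(1)] wd_words[OF that(2)]] that(3) R_mult_lt[OF z(1) that(2)]
      by (auto simp: R_def wd_lt)
  qed
  show "b = d" if "b \<in> L" "d \<in> L" "x \<in> carrier F" "R (b \<otimes> x) < R x" "R (d \<otimes> x) < R x" for b d x
  proof -
    obtain z y where z: "z \<in> ltrs" "b = lt z" "y \<in> ltrs" "d = lt y" using \<open>b \<in> L\<close> \<open>d \<in> L\<close> by (auto simp: L_lt)
    then show ?thesis
      using letters_not_both_shorten[OF wd_words[OF that(3)], of z y] that(4,5)
        R_mult_lt[OF z(1) that(3)] R_mult_lt[OF z(3) that(3)] by (simp add: R_def)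
  qed
  show "R a \<le> R (b \<otimes> a)" if "a \<in> L" "b \<in> L" "b \<noteq> inv a" for a b
  proof -
    obtain z y where z: "z \<in> ltrs" "b = lt z" "y \<in> ltrs" "a = lt y" using \<open>b \<in> L\<close> \<open>a \<in> L\<close> by (auto simp: L_lt)
    then have "z \<noteq> opp y" using that(3) by (auto simp: inv_lt)
    then show ?thesis using R_two_letters[OF z(3,1)] z by simp
  qed
  show "\<phi> c \<in> L"
    if p: "\<phi> \<in> carrier G" "\<And>a b. adm a b \<Longrightarrow> \<not> R (\<phi> b \<otimes> \<phi> a) < R (\<phi> a)" "c \<in> L" for \<phi> c
  proof -
    have pH: "\<phi> \<in> H" using p by (simp add: G_simps(1))
    have "\<not> R (\<phi> b \<otimes> \<phi> a) < R (\<phi> a)" if "a \<in> L" "b \<in> L" "b \<noteq> a" "b \<noteq> inv a" "\<phi> a \<noteq> a" for a b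
    proof (rule p(2))
      have "a \<in> L'" using H_fix[OF pH that(1)] that(5) by blast
      then show "adm a b" using that i_eq_iff[OF that(1,2)] by (auto simp: adm_def)
    qed
    then show ?thesis
      using irreducible_permutes[OF autoD(1,2)[OF H_auto[OF pH] ]] H_auto[OF pH] p(3) by (simp add: L_lt)
  qed
  show "\<phi> c = c"
    if "\<phi> \<in> carrier G" "c \<in> L'" "\<And>a. a \<in> L \<Longrightarrow> a \<noteq> c \<Longrightarrow> a \<noteq> inv c \<Longrightarrow> \<phi> a = a"
      "\<phi> c \<in> {c, inv c}" for \<phi> c
    using that reflection_det by (simp add: G_simps(1))
qed

text \<open>Reading a word letter by letter and following its value along the moves and turns shows that the element that it
  defines in the quotient is a value of the automorphism that it represents. A word that represents the identity therefore
  defines the unique value of the identity, which is trivial.\<close>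

theorem presentation: "has_presentation G S (symbol_aut F L) (relations F S)"
proof (rule rels.has_presentationI)
  interpret nielsen_action F G L L' rels.Q QM QW rels.pr R by (rule nielsen_quotient)
  let ?f = "symbol_aut F L"
  show "\<exists>u\<in>carrier (free_group S). rels.E u = \<phi>" if \<phi>: "\<phi> \<in> carrier G" for \<phi>
  proof -
    obtain \<rho> where v: "V \<phi> \<rho>" using V_exists[OF \<phi>] by blast
    obtain u where u: "u \<in> carrier (free_group S)" "\<rho> = rels.cs u"
      using rels.carrier_Q[OF V_closed(2)[OF v]] by blast
    then show ?thesis using V_pr[OF v] rels.pr_cs by auto
  qed
  have step: "V (\<phi> \<otimes>\<^bsub>G\<^esub> (if e then ?f s else inv\<^bsub>G\<^esub> ?f s))
      (\<rho> \<otimes>\<^bsub>rels.Q\<^esub> (if e then rels.cs (free_gen s) else inv\<^bsub>rels.Q\<^esub> rels.cs (free_gen s)))"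
    if v: "V \<phi> \<rho>" and s: "s \<in> S" for \<phi> \<rho> s e
  proof (cases s)
    case (M a b)
    then have ab: "adm a b" using s by (simp add: M_S)
    have i: "inv\<^bsub>rels.Q\<^esub> QM a b = QM a (inv b)" using m_inv[OF ab] .
    have "inv\<^bsub>G\<^esub> ?f s = rels.pr (QM a (inv b))"
      using pr_inv[of "QM a b"] gen_closed(1)[OF ab] i by (simp add: M pr_QM[OF ab])
    then show ?thesis
      using V_step[OF v ab] V_step[OF v adm_i(1)[OF ab]] M i by (simp add: pr_QM[OF ab])
  next
    case (W a b)
    then have ab: "adm a b" "b \<in> L'" using s by (auto simp: W_S)
    then have ab': "adm a (inv b)" "inv b \<in> L'" by (auto simp: adm_i i_L')
    have i: "inv\<^bsub>rels.Q\<^esub> QW a b = QW a (inv b)" using w_inv[OF ab] .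
    have "inv\<^bsub>G\<^esub> ?f s = rels.pr (QW a (inv b))"
      using pr_inv[of "QW a b"] gen_closed(2)[OF ab] i by (simp add: W pr_QW[OF ab])
    then show ?thesis
      using V_turn[OF v ab] V_turn[OF v ab'] W i by (simp add: turn_def pr_QW[OF ab])
  qed
  have walk: "V (\<phi> \<otimes>\<^bsub>G\<^esub> rels.E u) (\<rho> \<otimes>\<^bsub>rels.Q\<^esub> rels.cs u)"
    if "V \<phi> \<rho>" "u \<in> carrier (free_group S)" for \<phi> \<rho> u
    using that
  proof (induction u arbitrary: \<phi> \<rho>)
    case Nil
    have "rels.cs [] = \<one>\<^bsub>rels.Q\<^esub>" using rels.cs.hom_one by (simp add: free_group_def)
    then show ?case
      using Nil rels.G.r_one[OF V_closed(1)[OF Nil(1)]] rels.Q.r_one[OF V_closed(2)[OF Nil(1)]]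
      by (simp del: one_FactGroup mult_FactGroup)
  next
    case (Cons x u)
    note Ef = rels.word_factor[OF Cons.prems(2) rels.E_hom rels.G.is_group]
    note cf = rels.word_factor(3)[OF Cons.prems(2) rels.cs_hom rels.Q.is_group]
    let ?g = "if snd x then ?f (fst x) else inv\<^bsub>G\<^esub> ?f (fst x)"
    let ?q = "if snd x then rels.cs (free_gen (fst x)) else inv\<^bsub>rels.Q\<^esub> rels.cs (free_gen (fst x))"
    have fg: "free_gen (fst x) \<in> carrier (free_group S)" using Ef(2) by (rule free_gen_closed)
    have cl: "?g \<in> carrier G" "?q \<in> carrier rels.Q" "rels.E u \<in> carrier G" "rels.cs u \<in> carrier rels.Q"
      "\<phi> \<in> carrier G" "\<rho> \<in> carrier rels.Q"
      using funcset_mem[OF symbol_aut_closed Ef(2)] fg Ef(1) V_closed[OF Cons.prems(1)] by auto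
    have "V (\<phi> \<otimes>\<^bsub>G\<^esub> ?g \<otimes>\<^bsub>G\<^esub> rels.E u) (\<rho> \<otimes>\<^bsub>rels.Q\<^esub> ?q \<otimes>\<^bsub>rels.Q\<^esub> rels.cs u)"
      by (rule Cons.IH[OF step[OF Cons.prems(1) Ef(2)] Ef(1)])
    moreover have "\<phi> \<otimes>\<^bsub>G\<^esub> ?g \<otimes>\<^bsub>G\<^esub> rels.E u = \<phi> \<otimes>\<^bsub>G\<^esub> rels.E (x # u)"
      using rels.G.m_assoc[OF cl(5,1,3)] Ef(3) rels.E_gen[OF Ef(2)] by simp
    moreover have "\<rho> \<otimes>\<^bsub>rels.Q\<^esub> ?q \<otimes>\<^bsub>rels.Q\<^esub> rels.cs u = \<rho> \<otimes>\<^bsub>rels.Q\<^esub> rels.cs (x # u)"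
      using rels.Q.m_assoc[OF cl(6,2,4)] cf by simp
    ultimately show ?case by simp
  qed
  show "rels.cs u = \<one>\<^bsub>rels.Q\<^esub>" if u: "u \<in> carrier (free_group S)" "rels.E u = \<one>\<^bsub>G\<^esub>" for u
  proof -
    have "V \<one>\<^bsub>G\<^esub> (rels.cs u)" using walk[OF V_one u(1)] u rels.G.l_one[OF rels.G.one_closed] rels.Q.l_one[OF rels.cs.hom_closed[OF u(1)]]
      by (simp del: one_FactGroup mult_FactGroup)
    then show ?thesis by (rule V_one_unique)
  qed
qed

end

theorem theorem2p11:
  fixes F :: "('a, 'm) monoid_scheme" and v :: "nat \<Rightarrow> 'a" and n l :: nat
  defines "L \<equiv> letters F v n"
  defines "L' \<equiv> L - letters F v l"
  assumes "free_with_basis F {1..n} v"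
    and "l \<le> n"
    and "n - l \<ge> 3"
  shows "has_presentation (SAut_fixing F n v (v ` {1..l}))
           (symbols F L L') (symbol_aut F L) (relations F (symbols F L L'))"
proof -
  interpret group F using assms(3) by (simp add: free_with_basis_def)
  interpret fixed_basis F n v l using assms(3-5) by unfold_locales
  show ?thesis using presentation unfolding assms(1,2) L'_def .
qed

end
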